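(* Let $E$ be a Hausdorff locally convex space, $U\subseteq\mathbb R^n$ and $V\subseteq\mathbb R^m$ be open subsets, and $k,l\in\mathbb N_0\cup\{\infty\}$. Let $\mathcal W_1\subseteq C^k(U,[0,\infty))$ be a set of weights on $U$ such that (i) $\mathcal W_1$ satisfies the $o$-condition, (ii) for each $f\in\mathcal W_1$ and $\alpha\in\mathbb N_0^n$ with $|\alpha|\le k$ there exists $g\in\mathcal W_1$ such that $\left|\frac{\partial^\alpha}{\partial x^\alpha}f(x)\right|\le g(x)$ for all $x\in U$. Likewise, let $\mathcal W_2\subseteq C^l(V,[0,\infty))$ be a set of weights on $V$ which satisfies the $o$-condition and such that for each $f\in\mathcal W_2$ and $\beta\in\mathbb N_0^m$ with $|\beta|\le l$ there exists $g\in\mathcal W_2$ with $\left|\frac{\partial^\beta}{\partial y^\beta}f(y)\right|\le g(y)$ for all $y\in V$. Then the space $C_c^{k,l}(U\times V,E)$ is dense in $C^{k,l}_{\mathcal W}(U\times V,E)$, where $\mathcal W=\mathcal W_1\otimes\mathcal W_2$.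
   Context: Topological vector spaces are over $\mathbb K\in\{\mathbb R,\mathbb C\}$; $\mathcal P_E$ is the set of all continuous seminorms on a locally convex space $E$; $\mathbb N_0=\{0,1,2,\dots\}$. $C^k(U,[0,\infty))$ denotes the real-valued $C^k$-functions on $U$ with values in $[0,\infty)$. For open $U\subseteq\mathbb R^n$, $V\subseteq\mathbb R^m$, $C^{k,l}(U\times V,E)$ is the space of maps $\gamma:U\times V\to E$ such that for all $\alpha\in\mathbb N_0^n$, $|\alpha|\le k$, and $\beta\in\mathbb N_0^m$, $|\beta|\le l$, the partial derivative $\frac{\partial^\alpha}{\partial x^\alpha}\frac{\partial^\beta}{\partial y^\beta}\gamma(x,y)$ exists in $E$ for all $(x,y)\in U\times V$ and is continuous in $(x,y)$. $C_c^{k,l}(U\times V,E)$ is the subspace of those $\gamma\in C^{k,l}(U\times V,E)$ whose support is a compact subset of $U\times V$. A set of weights on a Hausdorff space $X$ is a nonempty set $\mathcal W$ of functions $f:X\to[0,\infty)$ such that for each $x\in X$ there is $f_x\in\mathcal W$ with $f_x(x)>0$. For $f,g:X\to[0,\infty)$, $f=o(g)$ means: for each $\varepsilon>0$ there is a compact $K_\varepsilon\subseteq X$ with $f\le\varepsilon g$ on $X\setminus K_\varepsilon$. $\mathcal W$ satisfies the $o$-condition if for each $f\in\mathcal W$ there is $g\in\mathcal W$ with $f=o(g)$. $\mathcal W_1\otimes\mathcal W_2:=\{f_1\otimes f_2:f_i\in\mathcal W_i\}$, $(f_1\otimes f_2)(x,y):=f_1(x)f_2(y)$. $C^{k,l}_{\mathcal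 W_1\otimes\mathcal W_2}(U\times V,E)$ is the space of all $\gamma\in C^{k,l}(U\times V,E)$ with $\|\gamma\|_{f_1\otimes f_2,(\alpha,\beta),q}:=\sup_{(x,y)\in U\times V}f_1(x)f_2(y)q(\frac{\partial^\alpha}{\partial x^\alpha}\frac{\partial^\beta}{\partial y^\beta}\gamma(x,y))<\infty$ for all $f_1\in\mathcal W_1$, $f_2\in\mathcal W_2$, $q\in\mathcal P_E$, $|\alpha|\le k$, $|\beta|\le l$, with the locally convex topology defined by these seminorms. *)

theory Defs
  imports "HOL-Analysis.Analysis"
begin

section \<open>Locally convex spaces\<close>

text \<open>
  The ground field is a type of class \<^class>\<open>real_normed_field\<close>. Both \<^typ>\<open>real\<close> and \<^typ>\<open>complex\<close>
  are instances, and by the Gelfand--Mazur theorem every instance is isometrically isomorphic to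
  one of these two, so this class ranges exactly over the admissible ground fields. The space
  carries its underlying real vector space structure as type class structure (so that \<^const>\<open>convex\<close>
  and real difference quotients are available) and the scalar multiplication as a locale
  parameter extending the real one. Hausdorffness is the class \<^class>\<open>t2_space\<close>, which is not
  part of this locale.
\<close>

locale locally_convex_space = vector_space smul
  for smul :: "'k::real_normed_field \<Rightarrow> 'e \<Rightarrow> 'e::{real_vector, topological_ab_group_add}" +
  assumes smul_of_real: "smul (of_real r) x = r *\<^sub>R x"
    and continuous_smul: "continuous_on UNIV (\<lambda>(c, x). smul c x)"
    and convex_nhds_0: "open (S :: 'e set) \<Longrightarrow> 0 \<in> S \<Longrightarrow>
          \<exists>N C. open (N :: 'e set) \<and> 0 \<in> N \<and> N \<subseteq> C \<and> convex C \<and> C \<subseteq> S"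

definition continuous_seminorms ::
    "('k::real_normed_field \<Rightarrow> 'e \<Rightarrow> 'e::{ab_group_add, topological_space}) \<Rightarrow> ('e \<Rightarrow> real) set" where
  "continuous_seminorms smul =
     {q. (\<forall>x y. q (x + y) \<le> q x + q y) \<and> (\<forall>c x. q (smul c x) = norm c * q x) \<and>
         continuous_on UNIV q}"

section \<open>Partial derivatives\<close>

definition has_dir_deriv ::
    "('a::real_vector \<Rightarrow> 'e::{real_vector, topological_space}) \<Rightarrow> 'a \<Rightarrow> 'a \<Rightarrow> 'e \<Rightarrow> bool" where
  "has_dir_deriv f v x D \<longleftrightarrow> ((\<lambda>t::real. (1 / t) *\<^sub>R (f (x + t *\<^sub>R v) - f x)) \<longlongrightarrow> D) (at 0)"

definition dir_deriv ::
    "'a::real_vector \<Rightarrow> ('a \<Rightarrow> 'e::{real_vector, t2_space}) \<Rightarrow> 'a \<Rightarrow> 'e" where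
  "dir_deriv v f x = (THE D. has_dir_deriv f v x D)"

text \<open>The head of the list is the direction of the outermost derivative.\<close>

primrec iter_deriv ::
    "'a::real_vector list \<Rightarrow> ('a \<Rightarrow> 'e::{real_vector, t2_space}) \<Rightarrow> 'a \<Rightarrow> 'e" where
  "iter_deriv [] f = f"
| "iter_deriv (v # vs) f = dir_deriv v (iter_deriv vs f)"

primrec iter_differentiable_on ::
    "'a set \<Rightarrow> 'a::real_vector list \<Rightarrow> ('a \<Rightarrow> 'e::{real_vector, t2_space}) \<Rightarrow> bool" where
  "iter_differentiable_on S [] f \<longleftrightarrow> True"
| "iter_differentiable_on S (v # vs) f \<longleftrightarrow>
     iter_differentiable_on S vs f \<and> (\<forall>x\<in>S. \<exists>D. has_dir_deriv (iter_deriv vs f) v x D)"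

text \<open>
  Multi-indices are functions \<open>\<alpha> :: 'n \<Rightarrow> nat\<close>. The linear order on \<open>'n\<close> orders the
  coordinates: \<open>\<partial>\<^sup>\<alpha>\<close> is \<open>\<partial>\<^sub>1\<close> iterated \<open>\<alpha> 1\<close> times, applied to \<open>\<partial>\<^sub>2\<close> iterated
  \<open>\<alpha> 2\<close> times, and so on.
\<close>

definition mi_order :: "('n::finite \<Rightarrow> nat) \<Rightarrow> enat" where
  "mi_order \<alpha> = enat (\<Sum>i\<in>UNIV. \<alpha> i)"

definition mi_dirs :: "('n::{finite, linorder} \<Rightarrow> nat) \<Rightarrow> (real, 'n) vec list" where
  "mi_dirs \<alpha> = concat (map (\<lambda>i. replicate (\<alpha> i) (axis i 1)) (sorted_list_of_set UNIV))"

definition mi_dirs2 ::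
    "('n::{finite, linorder} \<Rightarrow> nat) \<Rightarrow> ('m::{finite, linorder} \<Rightarrow> nat) \<Rightarrow> ((real, 'n) vec \<times> (real, 'm) vec) list"
  where "mi_dirs2 \<alpha> \<beta> = map (\<lambda>v. (v, 0)) (mi_dirs \<alpha>) @ map (\<lambda>w. (0, w)) (mi_dirs \<beta>)"

abbreviation partial_deriv ::
    "('n::{finite, linorder} \<Rightarrow> nat) \<Rightarrow> ((real, 'n) vec \<Rightarrow> 'e::{real_vector, t2_space}) \<Rightarrow> (real, 'n) vec \<Rightarrow> 'e" where
  "partial_deriv \<alpha> \<equiv> iter_deriv (mi_dirs \<alpha>)"

abbreviation partial_deriv2 ::
    "('n::{finite, linorder} \<Rightarrow> nat) \<Rightarrow> ('m::{finite, linorder} \<Rightarrow> nat) \<Rightarrow>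
     ((real, 'n) vec \<times> (real, 'm) vec \<Rightarrow> 'e::{real_vector, t2_space}) \<Rightarrow> (real, 'n) vec \<times> (real, 'm) vec \<Rightarrow> 'e" where
  "partial_deriv2 \<alpha> \<beta> \<equiv> iter_deriv (mi_dirs2 \<alpha> \<beta>)"

section \<open>Function spaces\<close>

text \<open>
  A function with domain \<open>X\<close> is a member of \<^term>\<open>X \<rightarrow>\<^sub>E Y\<close>, i.e. it takes a fixed dummy value
  off \<open>X\<close>. All domains are open, so this value does not enter the derivatives at points of \<open>X\<close>.
\<close>

definition Ck_nonneg :: "enat \<Rightarrow> (real, 'n::{finite, linorder}) vec set \<Rightarrow> ((real, 'n) vec \<Rightarrow> real) set" where
  "Ck_nonneg k U =
     {f \<in> U \<rightarrow>\<^sub>E {0..}. \<forall>\<alpha>. mi_order \<alpha> \<le> k \<longrightarrow>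
        iter_differentiable_on U (mi_dirs \<alpha>) f \<and> continuous_on U (partial_deriv \<alpha> f)}"

definition Ckl ::
    "enat \<Rightarrow> enat \<Rightarrow> (real, 'n::{finite, linorder}) vec set \<Rightarrow> (real, 'm::{finite, linorder}) vec set \<Rightarrow>
     ((real, 'n) vec \<times> (real, 'm) vec \<Rightarrow> 'e::{real_vector, t2_space}) set" where
  "Ckl k l U V =
     {\<gamma> \<in> (U \<times> V) \<rightarrow>\<^sub>E UNIV. \<forall>\<alpha> \<beta>. mi_order \<alpha> \<le> k \<longrightarrow> mi_order \<beta> \<le> l \<longrightarrow>
        iter_differentiable_on (U \<times> V) (mi_dirs2 \<alpha> \<beta>) \<gamma> \<and>
        continuous_on (U \<times> V) (partial_deriv2 \<alpha> \<beta> \<gamma>)}"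

text \<open>The support is the closure relative to \<open>X\<close> of the set where the function is nonzero.\<close>

definition support_in :: "'a::topological_space set \<Rightarrow> ('a \<Rightarrow> 'e::zero) \<Rightarrow> 'a set" where
  "support_in X \<gamma> = X \<inter> closure {x \<in> X. \<gamma> x \<noteq> 0}"

definition Ckl_compact_supp ::
    "enat \<Rightarrow> enat \<Rightarrow> (real, 'n::{finite, linorder}) vec set \<Rightarrow> (real, 'm::{finite, linorder}) vec set \<Rightarrow>
     ((real, 'n) vec \<times> (real, 'm) vec \<Rightarrow> 'e::{real_vector, t2_space}) set" where
  "Ckl_compact_supp k l U V = {\<gamma> \<in> Ckl k l U V. compact (support_in (U \<times> V) \<gamma>)}"

section \<open>Weights\<close>

definition set_of_weights :: "'a set \<Rightarrow> ('a \<Rightarrow> real) set \<Rightarrow> bool" where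
  "set_of_weights X W \<longleftrightarrow> W \<noteq> {} \<and> W \<subseteq> X \<rightarrow>\<^sub>E {0..} \<and> (\<forall>x\<in>X. \<exists>f\<in>W. f x > 0)"

definition little_o_on ::
    "'a::topological_space set \<Rightarrow> ('a \<Rightarrow> real) \<Rightarrow> ('a \<Rightarrow> real) \<Rightarrow> bool" where
  "little_o_on X f g \<longleftrightarrow>
     (\<forall>\<epsilon>>0. \<exists>K. compact K \<and> K \<subseteq> X \<and> (\<forall>x\<in>X - K. f x \<le> \<epsilon> * g x))"

definition o_condition :: "'a::topological_space set \<Rightarrow> ('a \<Rightarrow> real) set \<Rightarrow> bool" where
  "o_condition X W \<longleftrightarrow> (\<forall>f\<in>W. \<exists>g\<in>W. little_o_on X f g)"

definition tensor_weights ::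
    "'a set \<Rightarrow> 'b set \<Rightarrow> ('a \<Rightarrow> real) set \<Rightarrow> ('b \<Rightarrow> real) set \<Rightarrow> ('a \<times> 'b \<Rightarrow> real) set" where
  "tensor_weights X Y W1 W2 = {(\<lambda>(x, y)\<in>X \<times> Y. f1 x * f2 y) | f1 f2. f1 \<in> W1 \<and> f2 \<in> W2}"

section \<open>Weighted function spaces\<close>

text \<open>Suprema are taken in \<^typ>\<open>ennreal\<close>: they may be infinite, and are \<open>0\<close> for an empty domain.\<close>

definition weighted_seminorm ::
    "(real, 'n::{finite, linorder}) vec set \<Rightarrow> (real, 'm::{finite, linorder}) vec set \<Rightarrow>
     ((real, 'n) vec \<times> (real, 'm) vec \<Rightarrow> real) \<Rightarrow> ('n \<Rightarrow> nat) \<Rightarrow> ('m \<Rightarrow> nat) \<Rightarrow> ('e \<Rightarrow> real) \<Rightarrow>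
     ((real, 'n) vec \<times> (real, 'm) vec \<Rightarrow> 'e::{real_vector, t2_space}) \<Rightarrow> ennreal" where
  "weighted_seminorm U V f \<alpha> \<beta> q \<gamma> =
     (SUP p\<in>U \<times> V. ennreal (f p * q (partial_deriv2 \<alpha> \<beta> \<gamma> p)))"

definition weighted_Ckl ::
    "('k::real_normed_field \<Rightarrow> 'e \<Rightarrow> 'e) \<Rightarrow> enat \<Rightarrow> enat \<Rightarrow>
     (real, 'n::{finite, linorder}) vec set \<Rightarrow> (real, 'm::{finite, linorder}) vec set \<Rightarrow>
     ((real, 'n) vec \<times> (real, 'm) vec \<Rightarrow> real) set \<Rightarrow>
     ((real, 'n) vec \<times> (real, 'm) vec \<Rightarrow> 'e::{real_vector, t2_space}) set" where
  "weighted_Ckl smul k l U V W =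
     {\<gamma> \<in> Ckl k l U V. \<forall>f\<in>W. \<forall>q\<in>continuous_seminorms smul. \<forall>\<alpha> \<beta>.
        mi_order \<alpha> \<le> k \<longrightarrow> mi_order \<beta> \<le> l \<longrightarrow> weighted_seminorm U V f \<alpha> \<beta> q \<gamma> < \<infinity>}"

text \<open>
  The topology defined by the seminorms, with all open seminorm balls as a subbase. Differences
  are formed pointwise on the whole type, but only their restriction to \<open>U \<times> V\<close> matters.
\<close>

definition weighted_topology ::
    "('k::real_normed_field \<Rightarrow> 'e \<Rightarrow> 'e) \<Rightarrow> enat \<Rightarrow> enat \<Rightarrow>
     (real, 'n::{finite, linorder}) vec set \<Rightarrow> (real, 'm::{finite, linorder}) vec set \<Rightarrow>
     ((real, 'n) vec \<times> (real, 'm) vec \<Rightarrow> real) set \<Rightarrow>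
     ((real, 'n) vec \<times> (real, 'm) vec \<Rightarrow> 'e::{real_vector, t2_space}) topology" where
  "weighted_topology smul k l U V W = topology_generated_by
     {{\<eta> \<in> weighted_Ckl smul k l U V W.
         weighted_seminorm U V f \<alpha> \<beta> q (\<lambda>p. \<eta> p - \<gamma> p) < ennreal \<epsilon>} | \<gamma> f \<alpha> \<beta> q \<epsilon>.
      \<gamma> \<in> weighted_Ckl smul k l U V W \<and> f \<in> W \<and> q \<in> continuous_seminorms smul \<and>
      mi_order \<alpha> \<le> k \<and> mi_order \<beta> \<le> l \<and> \<epsilon> > 0}"

end

theory Submission
  imports Defs
begin

text \<open>
  Let \<open>\<gamma>\<close> belong to the weighted space, and let \<open>f\<close> be a weight. The derivatives of \<open>f\<close> are dominated
  by weights, and each weight is negligible outside compact sets compared with another weight,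
  against which the derivatives of \<open>\<gamma>\<close> are bounded. Hence all derivatives of \<open>f \<gamma>\<close>, and all products
  of a derivative of \<open>f\<close> with a derivative of \<open>\<gamma>\<close>, tend to zero towards the boundary of the domain
  and towards infinity.

  The approximants are \<open>h \<gamma>\<close> with smooth compactly supported \<open>h\<close>. The difficulty is that \<open>h\<close> has to
  drop from \<open>1\<close> to \<open>0\<close> within a narrow collar along the boundary, of width \<open>\<rho>\<close> say, so that its
  derivatives of order \<open>a\<close> are of size \<open>1 / \<rho>\<^sup>a\<close>. This is made up for by Taylor's formula at the
  boundary: in the Leibniz expansion of the error such a derivative multiplies \<open>f\<close> times a derivative
  of \<open>\<gamma>\<close> which can still be differentiated \<open>a\<close> times with all results vanishing at the boundary, and
  which is therefore \<open>o(\<rho>\<^sup>a)\<close> in the collar (\<open>collar_estimate\<close>). Far out, away from the boundary,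
  \<open>h\<close> is cut off at a distance \<open>R\<close> that may be chosen after \<open>\<rho>\<close>, so that smallness at infinity
  suffices. The two effects are combined in \<open>eventually_cutoff_close\<close>.

  Cutoff functions whose derivatives obey these bounds, for an arbitrary open set, are sums of bump
  functions of a grid of mesh proportional to \<open>\<rho>\<close> (\<open>exists_cutoff\<close>).

  In the product \<open>U \<times> V\<close> the function is cut off first in the variables of \<open>U\<close> and then in those of
  \<open>V\<close>. In each step only the boundary of one factor and the derivatives of the weights on this factor
  matter, and both steps are instances of the same statement (\<open>approx_block\<close>).

  The Taylor estimate differentiates in arbitrary order, while membership in the function spaces only
  speaks of derivatives in one standard order. A version of Schwarz's theorem bridges this gap
  (\<open>iter_deriv_sort_key\<close>). For values in a locally convex space it rests, like the Taylor estimate, on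
  the mean value inequality for seminorms (\<open>mean_value_interval\<close>).
\<close>

section \<open>Iterated directional derivatives\<close>

lemma dir_deriv_eqI:
  assumes "has_dir_deriv f v x D"
  shows "dir_deriv v f x = D"
  unfolding dir_deriv_def
  using assms unfolding has_dir_deriv_def
  by (intro the_equality) (auto intro: tendsto_unique[OF trivial_limit_at])

lemma line_in_open:
  fixes x v :: "'a::real_normed_vector"
  assumes "open S" "x \<in> S"
  shows "eventually (\<lambda>t. x + t *\<^sub>R v \<in> S) (nhds 0)"
proof -
  have "((\<lambda>t. x + t *\<^sub>R v) \<longlongrightarrow> x + 0 *\<^sub>R v) (nhds 0)"
    by (intro tendsto_intros filterlim_ident)
  then show ?thesis
    using assms by (auto simp: tendsto_def)
qed

lemma has_dir_deriv_cong:
  fixes x v :: "'a::real_normed_vector"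
  assumes "open S" "x \<in> S" "\<And>y. y \<in> S \<Longrightarrow> f y = g y"
  shows "has_dir_deriv f v x D \<longleftrightarrow> has_dir_deriv g v x D"
  unfolding has_dir_deriv_def
proof (rule tendsto_cong)
  show "eventually (\<lambda>t. (1 / t) *\<^sub>R (f (x + t *\<^sub>R v) - f x) = (1 / t) *\<^sub>R (g (x + t *\<^sub>R v) - g x)) (at 0)"
    using line_in_open[OF assms(1,2), of v] assms
    unfolding eventually_at_filter by (auto elim!: eventually_mono)
qed

lemma iter_deriv_cong:
  fixes f g :: "'a::real_normed_vector \<Rightarrow> 'e::{real_vector,t2_space}"
  assumes "open S" "\<And>y. y \<in> S \<Longrightarrow> f y = g y" "x \<in> S"
  shows "iter_deriv vs f x = iter_deriv vs g x"
  using assms(3)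
proof (induction vs arbitrary: x)
  case (Cons v vs)
  then show ?case
    using has_dir_deriv_cong[OF assms(1) Cons.prems Cons.IH]
    by (simp add: dir_deriv_def)
qed (use assms in auto)

lemma iter_differentiable_on_cong:
  fixes f g :: "'a::real_normed_vector \<Rightarrow> 'e::{real_vector,t2_space}"
  assumes "open S" "\<And>y. y \<in> S \<Longrightarrow> f y = g y"
  shows "iter_differentiable_on S vs f \<longleftrightarrow> iter_differentiable_on S vs g"
proof (induction vs)
  case (Cons v vs)
  show ?case
    using Cons has_dir_deriv_cong[OF assms(1) _ iter_deriv_cong[OF assms]]
    by simp
qed simp

lemma has_dir_deriv_iter:
  assumes "iter_differentiable_on S (v # vs) f" "x \<in> S"
  shows "has_dir_deriv (iter_deriv vs f) v x (iter_deriv (v # vs) f x)"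
  using assms dir_deriv_eqI by fastforce

lemma iter_deriv_minus_const:
  fixes f :: "'a::real_vector \<Rightarrow> 'e::{real_vector,t2_space}"
  shows "iter_deriv vs (\<lambda>x. f x - c) = (if vs = [] then (\<lambda>x. f x - c) else iter_deriv vs f)"
    and "iter_differentiable_on S vs (\<lambda>x. f x - c) \<longleftrightarrow> iter_differentiable_on S vs f"
proof -
  have dd: "has_dir_deriv (\<lambda>x. f x - c) v x D \<longleftrightarrow> has_dir_deriv f v x D" for v x D
    by (simp add: has_dir_deriv_def)
  show *: "iter_deriv vs (\<lambda>x. f x - c) = (if vs = [] then (\<lambda>x. f x - c) else iter_deriv vs f)" for vs
  proof (induction vs)
    case (Cons v vs)
    have "has_dir_deriv (iter_deriv vs (\<lambda>x. f x - c)) v x D \<longleftrightarrow> has_dir_deriv (iter_deriv vs f) v x D" for x D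
      using Cons dd by (cases vs) auto
    then show ?case by (simp add: dir_deriv_def fun_eq_iff)
  qed simp
  show "iter_differentiable_on S vs (\<lambda>x. f x - c) \<longleftrightarrow> iter_differentiable_on S vs f"
    by (induction vs) (auto simp: * dd)
qed

lemma iter_deriv_zero: "iter_deriv vs (\<lambda>_. 0) = (\<lambda>_. 0 :: 'e::{real_vector, t2_space})"
proof (induction vs)
  case (Cons v vs)
  have "has_dir_deriv (iter_deriv vs (\<lambda>_. 0 :: 'e)) v x 0" for x
    unfolding Cons by (simp add: has_dir_deriv_def)
  then show ?case by (simp add: fun_eq_iff dir_deriv_eqI)
qed simp

lemma has_dir_deriv_line:
  assumes "has_dir_deriv f v (p + t *\<^sub>R v) D"
  shows "has_dir_deriv (\<lambda>s. f (p + s *\<^sub>R v)) 1 t D"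
  using assms unfolding has_dir_deriv_def by (simp add: algebra_simps)

lemma has_dir_deriv_compose_linear:
  assumes "linear L" "has_dir_deriv f (L v) (L p) D"
  shows "has_dir_deriv (\<lambda>p. f (L p)) v p D"
  using assms unfolding has_dir_deriv_def by (simp add: linear_add linear_scale)

lemma iter_deriv_compose_linear:
  fixes f :: "'b::real_vector \<Rightarrow> 'e::{real_vector,t2_space}"
  assumes "linear L" "iter_differentiable_on S (map L vs) f" "\<And>p. p \<in> T \<Longrightarrow> L p \<in> S"
    and T: "open T"
  shows "iter_differentiable_on (T::'a::real_normed_vector set) vs (\<lambda>p. f (L p)) \<and>
    (\<forall>p\<in>T. iter_deriv vs (\<lambda>p. f (L p)) p = iter_deriv (map L vs) f (L p))"
  using assms(2)
proof (induction vs)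
  case (Cons v vs)
  have IH: "iter_differentiable_on T vs (\<lambda>p. f (L p))"
    "\<And>p. p \<in> T \<Longrightarrow> iter_deriv vs (\<lambda>p. f (L p)) p = iter_deriv (map L vs) f (L p)"
    using Cons by auto
  have "has_dir_deriv (iter_deriv vs (\<lambda>p. f (L p))) v p (iter_deriv (map L (v#vs)) f (L p))"
    if "p \<in> T" for p
  proof -
    have "has_dir_deriv (iter_deriv (map L vs) f) (L v) (L p) (iter_deriv (map L (v#vs)) f (L p))"
      using Cons.prems assms(3)[OF that] has_dir_deriv_iter by fastforce
    then show ?thesis
      by (subst has_dir_deriv_cong[OF T that IH(2)]) (use that has_dir_deriv_compose_linear[OF assms(1)] in auto)
  qed
  then show ?case using IH dir_deriv_eqI by fastforce
qed simp

section \<open>Spaces whose topology is given by seminorms\<close>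

text \<open>
  All analysis of vector-valued functions below is carried out through a family of seminorms
  that generates the topology. This covers a locally convex space with all its continuous real
  seminorms as well as the real line with the absolute value, so that the same calculus serves
  the functions and the weights. The family is taken to be rich enough that each neighbourhood
  contains the ball of a single seminorm. Continuity of the vector space operations follows from
  the seminorm estimates.
\<close>

locale seminorm_space =
  fixes Q :: "('e::{real_vector,t2_space} \<Rightarrow> real) set"
  assumes Q_add: "q \<in> Q \<Longrightarrow> q (x + y) \<le> q x + q y"
    and Q_scale: "q \<in> Q \<Longrightarrow> q (r *\<^sub>R x) = \<bar>r\<bar> * q x"
    and Q_open: "open S \<longleftrightarrow> (\<forall>x\<in>S. \<exists>q\<in>Q. \<exists>\<epsilon>>0. \<forall>y. q (y - x) < \<epsilon> \<longrightarrow> y \<in> S)"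
begin

lemma Q_zero: assumes "q \<in> Q" shows "q 0 = 0"
  using Q_scale[OF assms, of 0 0] by simp

lemma Q_minus: assumes "q \<in> Q" shows "q (- x) = q x"
  using Q_scale[OF assms, of "-1" x] by simp

lemma Q_nonneg: assumes "q \<in> Q" shows "0 \<le> q x"
proof -
  have "q (x + - x) \<le> q x + q x"
    using Q_add[OF assms, of x "- x"] unfolding Q_minus[OF assms] .
  then show ?thesis by (simp add: Q_zero[OF assms])
qed

lemma Q_diff: assumes "q \<in> Q" shows "q (x - y) \<le> q x + q y"
  using Q_add[OF assms, of x "- y"] unfolding Q_minus[OF assms] by simp

lemma Q_diff_rev: assumes "q \<in> Q" shows "\<bar>q x - q y\<bar> \<le> q (x - y)"
proof -
  have "q x \<le> q (x - y) + q y"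
    using Q_add[OF assms, of "x - y" y] by simp
  moreover have "q y \<le> q (- (x - y)) + q x"
    using Q_add[OF assms, of "- (x - y)" x] by simp
  ultimately show ?thesis unfolding Q_minus[OF assms] by linarith
qed

lemma Q_sum_list:
  assumes "q \<in> Q"
  shows "q (sum_list xs) \<le> sum_list (map q xs)"
proof (induction xs)
  case (Cons a xs)
  then show ?case using Q_add[OF assms, of a "sum_list xs"] by simp
qed (simp add: Q_zero[OF assms])

lemma open_Q_ball:
  assumes "q \<in> Q"
  shows "open {y. q (y - x) < \<epsilon>}"
  unfolding Q_open
proof safe
  fix y assume y: "q (y - x) < \<epsilon>"
  have "q (z - x) < \<epsilon>" if "q (z - y) < \<epsilon> - q (y - x)" for z
    using that Q_add[OF assms, of "z - y" "y - x"] by simp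
  with y assms show "\<exists>q'\<in>Q. \<exists>\<epsilon>'>0. \<forall>z. q' (z - y) < \<epsilon>' \<longrightarrow> z \<in> {y. q (y - x) < \<epsilon>}"
    by (intro bexI[of _ q] exI[of _ "\<epsilon> - q (y - x)"]) auto
qed

lemma tendsto_iff_Q: "(f \<longlongrightarrow> D) F \<longleftrightarrow> (\<forall>q\<in>Q. ((\<lambda>t. q (f t - D)) \<longlongrightarrow> 0) F)"
proof safe
  fix q assume f: "(f \<longlongrightarrow> D) F" and q: "q \<in> Q"
  show "((\<lambda>t. q (f t - D)) \<longlongrightarrow> 0) F"
  proof (rule tendstoI)
    fix e :: real assume "e > 0"
    then have "eventually (\<lambda>t. f t \<in> {y. q (y - D) < e}) F"
      using f open_Q_ball[OF q] q by (intro topological_tendstoD) (auto simp: Q_zero)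
    then show "eventually (\<lambda>t. dist (q (f t - D)) 0 < e) F"
      by eventually_elim (simp add: dist_norm abs_of_nonneg[OF Q_nonneg[OF q]])
  qed
next
  assume *: "\<forall>q\<in>Q. ((\<lambda>t. q (f t - D)) \<longlongrightarrow> 0) F"
  show "(f \<longlongrightarrow> D) F"
  proof (rule topological_tendstoI)
    fix S assume "open S" "D \<in> S"
    then obtain q e where q: "q \<in> Q" "e > 0" "\<And>y. q (y - D) < e \<Longrightarrow> y \<in> S"
      unfolding Q_open by blast
    then have "eventually (\<lambda>t. q (f t - D) < e) F"
      using * order_tendstoD(2)[of "\<lambda>t. q (f t - D)" 0 F e] by blast
    then show "eventually (\<lambda>t. f t \<in> S) F"
      by eventually_elim (use q in auto)
  qed
qed

lemma tendsto_Q: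
  assumes "q \<in> Q" "(f \<longlongrightarrow> D) F"
  shows "((\<lambda>t. q (f t)) \<longlongrightarrow> q D) F"
proof (rule LIM_zero_cancel)
  have lim: "((\<lambda>t. q (f t - D)) \<longlongrightarrow> 0) F"
    using assms(2)[unfolded tendsto_iff_Q] assms(1) by (rule bspec)
  have "\<forall>\<^sub>F t in F. norm (q (f t) - q D) \<le> q (f t - D)"
    by (simp add: Q_diff_rev[OF assms(1)])
  then show "((\<lambda>t. q (f t) - q D) \<longlongrightarrow> 0) F"
    using lim by (rule Lim_null_comparison)
qed

lemma continuous_on_Q: "q \<in> Q \<Longrightarrow> continuous_on S f \<Longrightarrow> continuous_on S (\<lambda>x. q (f x))"
  unfolding continuous_on_def by (intro ballI tendsto_Q) auto

lemma tendsto_add_Q: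
  fixes a b :: 'e
  assumes "(f \<longlongrightarrow> a) F" "(g \<longlongrightarrow> b) F"
  shows "((\<lambda>x. f x + g x) \<longlongrightarrow> a + b) F"
proof (subst tendsto_iff_Q, rule ballI)
  fix q assume q: "q \<in> Q"
  have "((\<lambda>x. q (f x - a) + q (g x - b)) \<longlongrightarrow> 0 + 0) F"
    using assms[unfolded tendsto_iff_Q] q by (intro tendsto_add) blast+
  then have lim: "((\<lambda>x. q (f x - a) + q (g x - b)) \<longlongrightarrow> 0) F"
    by simp
  show "((\<lambda>x. q (f x + g x - (a + b))) \<longlongrightarrow> 0) F"
  proof (rule Lim_null_comparison[OF _ lim], rule always_eventually, rule allI)
    fix x show "norm (q (f x + g x - (a + b))) \<le> q (f x - a) + q (g x - b)"
      using Q_add[OF q, of "f x - a" "g x - b"]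
      by (simp only: real_norm_def abs_of_nonneg[OF Q_nonneg[OF q]] add_diff_add)
  qed
qed

lemma tendsto_scaleR_Q:
  fixes a :: 'e
  assumes "(r \<longlongrightarrow> r0) F" "(f \<longlongrightarrow> a) F"
  shows "((\<lambda>x. r x *\<^sub>R f x) \<longlongrightarrow> r0 *\<^sub>R a) F"
proof (subst tendsto_iff_Q, rule ballI)
  fix q assume q: "q \<in> Q"
  have "((\<lambda>x. \<bar>r x\<bar> * q (f x - a) + \<bar>r x - r0\<bar> * q a) \<longlongrightarrow> \<bar>r0\<bar> * 0 + \<bar>r0 - r0\<bar> * q a) F"
    using assms(1) assms(2)[unfolded tendsto_iff_Q] q by (intro tendsto_intros) blast+
  then have lim: "((\<lambda>x. \<bar>r x\<bar> * q (f x - a) + \<bar>r x - r0\<bar> * q a) \<longlongrightarrow> 0) F"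
    by simp
  show "((\<lambda>x. q (r x *\<^sub>R f x - r0 *\<^sub>R a)) \<longlongrightarrow> 0) F"
  proof (rule Lim_null_comparison[OF _ lim], rule always_eventually, rule allI)
    fix x
    have "r x *\<^sub>R f x - r0 *\<^sub>R a = r x *\<^sub>R (f x - a) + (r x - r0) *\<^sub>R a"
      by (simp add: algebra_simps)
    then show "norm (q (r x *\<^sub>R f x - r0 *\<^sub>R a)) \<le> \<bar>r x\<bar> * q (f x - a) + \<bar>r x - r0\<bar> * q a"
      using Q_add[OF q, of "r x *\<^sub>R (f x - a)" "(r x - r0) *\<^sub>R a"]
      by (simp only: real_norm_def abs_of_nonneg[OF Q_nonneg[OF q]] Q_scale[OF q])
  qed
qed

lemma continuous_on_scaleR_Q:
  fixes f :: "'b::topological_space \<Rightarrow> 'e"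
  shows
  "continuous_on S r \<Longrightarrow> continuous_on S f \<Longrightarrow> continuous_on S (\<lambda>x. r x *\<^sub>R f x)"
  unfolding continuous_on_def by (intro ballI tendsto_scaleR_Q) auto

lemma continuous_on_sum_list_Q:
  fixes f :: "'z \<Rightarrow> 'b::topological_space \<Rightarrow> 'e"
  shows
  "(\<And>z. z \<in> set zs \<Longrightarrow> continuous_on S (f z)) \<Longrightarrow> continuous_on S (\<lambda>x. \<Sum>z\<leftarrow>zs. f z x)"
proof (induction zs)
  case (Cons z zs)
  have "continuous_on S (\<lambda>x. f z x + (\<Sum>z\<leftarrow>zs. f z x))"
    unfolding continuous_on_def
  proof
    fix x assume "x \<in> S"
    then show "((\<lambda>x. f z x + (\<Sum>z\<leftarrow>zs. f z x)) \<longlongrightarrow> f z x + (\<Sum>z\<leftarrow>zs. f z x)) (at x within S)"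
      using Cons.IH Cons.prems by (intro tendsto_add_Q) (auto simp: continuous_on_def)
  qed
  then show ?case by simp
qed simp

text \<open>
  Differentiability as a first-order estimate in each seminorm, free of division by \<open>t\<close>; the
  mean value inequality is derived from this form.
\<close>

lemma has_dir_deriv_iff:
  fixes f :: "'a::real_normed_vector \<Rightarrow> 'e"
  shows
  "has_dir_deriv f v x D \<longleftrightarrow> (\<forall>q\<in>Q. \<forall>\<epsilon>>0. \<forall>\<^sub>F t in at 0. q (f (x + t *\<^sub>R v) - f x - t *\<^sub>R D) \<le> \<epsilon> * \<bar>t\<bar>)"
  (is "_ \<longleftrightarrow> ?R")
proof -
  have key: "q ((1/t) *\<^sub>R (f (x + t *\<^sub>R v) - f x) - D) = q (f (x + t *\<^sub>R v) - f x - t *\<^sub>R D) / \<bar>t\<bar>"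
    if "q \<in> Q" "t \<noteq> 0" for q t
  proof -
    have "(1/t) *\<^sub>R (f (x + t *\<^sub>R v) - f x) - D = (1/t) *\<^sub>R (f (x + t *\<^sub>R v) - f x - t *\<^sub>R D)"
      using that by (simp add: algebra_simps)
    then show ?thesis using Q_scale[OF that(1)] by (simp add: divide_simps)
  qed
  have ne: "eventually (\<lambda>t::real. t \<noteq> 0) (at 0)"
    by (simp add: eventually_at_filter)
  show ?thesis
    unfolding has_dir_deriv_def tendsto_iff_Q
  proof safe
    fix q and \<epsilon> :: real assume *: "\<forall>q\<in>Q. ((\<lambda>t. q ((1/t) *\<^sub>R (f (x + t *\<^sub>R v) - f x) - D)) \<longlongrightarrow> 0) (at 0)"
      and q: "q \<in> Q" "\<epsilon> > 0"
    then have "\<forall>\<^sub>F t in at 0. q ((1/t) *\<^sub>R (f (x + t *\<^sub>R v) - f x) - D) < \<epsilon>"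
      using order_tendstoD(2)[OF bspec[OF * q(1)] q(2)] by simp
    then show "\<forall>\<^sub>F t in at 0. q (f (x + t *\<^sub>R v) - f x - t *\<^sub>R D) \<le> \<epsilon> * \<bar>t\<bar>"
      using ne by eventually_elim (use key[OF q(1)] in \<open>simp add: divide_simps\<close>)
  next
    fix q assume *: ?R and q: "q \<in> Q"
    show "((\<lambda>t. q ((1/t) *\<^sub>R (f (x + t *\<^sub>R v) - f x) - D)) \<longlongrightarrow> 0) (at 0)"
    proof (rule tendstoI)
      fix e :: real assume "e > 0"
      then have "\<forall>\<^sub>F t in at 0. q (f (x + t *\<^sub>R v) - f x - t *\<^sub>R D) \<le> (e/2) * \<bar>t\<bar>"
        using * q by (meson half_gt_zero)
      then show "\<forall>\<^sub>F t in at 0. dist (q ((1/t) *\<^sub>R (f (x + t *\<^sub>R v) - f x) - D)) 0 < e"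
        using ne
      proof eventually_elim
        case (elim t)
        have "q (f (x + t *\<^sub>R v) - f x - t *\<^sub>R D) / \<bar>t\<bar> \<le> e/2"
          using elim by (simp add: divide_simps)
        then show ?case
          unfolding key[OF q elim(2)] dist_norm using Q_nonneg[OF q] \<open>e > 0\<close>
          by (simp only: diff_0_right real_norm_def abs_of_nonneg divide_nonneg_nonneg abs_ge_zero)
      qed
    qed
  qed
qed

text \<open>
  With \<open>M\<close> replaced by the slightly larger \<open>M + \<epsilon>\<close>, the estimate is local at each point by
  differentiability, and estimates on adjacent intervals add up by the triangle inequality, so
  bisection gives it on the whole interval.
\<close>

lemma mean_value_interval:
  fixes f :: "real \<Rightarrow> 'e"
  assumes q: "q \<in> Q" and ab: "a \<le> b"
    and der: "\<And>t. t \<in> {a..b} \<Longrightarrow> has_dir_deriv f 1 t (g t)"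
    and bound: "\<And>t. t \<in> {a..b} \<Longrightarrow> q (g t - D) \<le> M"
  shows "q (f b - f a - (b - a) *\<^sub>R D) \<le> M * (b - a)"
proof (rule field_le_epsilon)
  fix e :: real assume e: "e > 0"
  define \<epsilon> where "\<epsilon> = e / (b - a + 1)"
  have \<epsilon>: "\<epsilon> > 0" "\<epsilon> * (b - a) \<le> e"
    using e ab unfolding \<epsilon>_def by (auto simp: field_simps)
  define P where "P = (\<lambda>c d. a \<le> c \<and> d \<le> b \<longrightarrow> q (f d - f c - (d - c) *\<^sub>R D) \<le> (M + \<epsilon>) * (d - c))"
  have "P a b"
    using ab
  proof (induction rule: Bolzano)
    case (trans c d r)
    have "f r - f c - (r - c) *\<^sub>R D = (f d - f c - (d - c) *\<^sub>R D) + (f r - f d - (r - d) *\<^sub>R D)"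
      by (simp add: algebra_simps)
    then have "q (f r - f c - (r - c) *\<^sub>R D) \<le> q (f d - f c - (d - c) *\<^sub>R D) + q (f r - f d - (r - d) *\<^sub>R D)"
      using Q_add[OF q] by metis
    then show ?case
      using trans unfolding P_def by (auto simp: algebra_simps)
  next
    case (local x)
    then have x: "x \<in> {a..b}" by simp
    have "\<forall>\<^sub>F t in at 0. q (f (x + t *\<^sub>R 1) - f x - t *\<^sub>R g x) \<le> \<epsilon> * \<bar>t\<bar>"
      using der[OF x] has_dir_deriv_iff q \<epsilon>(1) by blast
    then obtain d where d: "d > 0"
      "\<And>t. t \<noteq> 0 \<Longrightarrow> \<bar>t\<bar> < d \<Longrightarrow> q (f (x + t) - f x - t *\<^sub>R g x) \<le> \<epsilon> * \<bar>t\<bar>"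
      by (auto simp: eventually_at dist_norm)
    have one: "q (f (x + t) - f x - t *\<^sub>R D) \<le> (M + \<epsilon>) * \<bar>t\<bar>" if "\<bar>t\<bar> < d" for t
    proof (cases "t = 0")
      case False
      have "f (x + t) - f x - t *\<^sub>R D = (f (x + t) - f x - t *\<^sub>R g x) + t *\<^sub>R (g x - D)"
        by (simp add: algebra_simps)
      then have "q (f (x + t) - f x - t *\<^sub>R D) \<le> q (f (x + t) - f x - t *\<^sub>R g x) + \<bar>t\<bar> * q (g x - D)"
        using Q_add[OF q] Q_scale[OF q] by metis
      also have "\<dots> \<le> \<epsilon> * \<bar>t\<bar> + \<bar>t\<bar> * q (g x - D)"
        using d(2)[OF False that] by simp
      also have "\<dots> \<le> \<epsilon> * \<bar>t\<bar> + \<bar>t\<bar> * M"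
        using bound[OF x] by (intro add_left_mono mult_left_mono) auto
      finally show ?thesis by (simp add: algebra_simps)
    qed (simp add: Q_zero q)
    have "P c r" if "c \<le> x" "x \<le> r" "r - c < d" for c r
    proof -
      have "f r - f c - (r - c) *\<^sub>R D =
          (f (x + (r - x)) - f x - (r - x) *\<^sub>R D) - (f (x + (c - x)) - f x - (c - x) *\<^sub>R D)"
        by (simp add: algebra_simps)
      then have "q (f r - f c - (r - c) *\<^sub>R D) \<le> q (f (x + (r - x)) - f x - (r - x) *\<^sub>R D) + q (f (x + (c - x)) - f x - (c - x) *\<^sub>R D)"
        using Q_diff[OF q] by metis
      also have "\<dots> \<le> (M + \<epsilon>) * \<bar>r - x\<bar> + (M + \<epsilon>) * \<bar>c - x\<bar>"
        using that by (intro add_mono one) auto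
      also have "\<dots> = (M + \<epsilon>) * (r - c)"
        using that by (simp add: algebra_simps)
      finally show ?thesis by (simp add: P_def)
    qed
    then show ?case using d(1) by blast
  qed
  then have "q (f b - f a - (b - a) *\<^sub>R D) \<le> M * (b - a) + \<epsilon> * (b - a)"
    by (simp add: P_def algebra_simps)
  then show "q (f b - f a - (b - a) *\<^sub>R D) \<le> M * (b - a) + e"
    using \<epsilon>(2) by simp
qed

lemma mean_value_inequality:
  fixes f :: "real \<Rightarrow> 'e"
  assumes q: "q \<in> Q"
    and der: "\<And>t. t \<in> closed_segment a b \<Longrightarrow> has_dir_deriv f 1 t (g t)"
    and bound: "\<And>t. t \<in> closed_segment a b \<Longrightarrow> q (g t - D) \<le> M"
  shows "q (f b - f a - (b - a) *\<^sub>R D) \<le> M * \<bar>b - a\<bar>"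
proof (cases "a \<le> b")
  case True
  then show ?thesis
    using mean_value_interval[OF q True, of f g D M] assms by (simp add: closed_segment_eq_real_ivl)
next
  case False
  then have "q (f a - f b - (a - b) *\<^sub>R D) \<le> M * (a - b)"
    using mean_value_interval[OF q, of b a f g D M] assms by (simp add: closed_segment_eq_real_ivl)
  moreover have "f b - f a - (b - a) *\<^sub>R D = - (f a - f b - (a - b) *\<^sub>R D)"
    by (simp add: algebra_simps)
  ultimately have "q (f b - f a - (b - a) *\<^sub>R D) \<le> M * (a - b)"
    using Q_minus[OF q] by metis
  then show ?thesis using False by simp
qed

lemma has_dir_deriv_add:
  fixes f g :: "'a::real_normed_vector \<Rightarrow> 'e"
  assumes "has_dir_deriv f v x D" "has_dir_deriv g v x D'"
  shows "has_dir_deriv (\<lambda>x. f x + g x) v x (D + D')"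
  using tendsto_add_Q[OF assms[unfolded has_dir_deriv_def]]
  unfolding has_dir_deriv_def by (simp add: algebra_simps)

lemma has_dir_deriv_scaleR:
  fixes f :: "'a::real_normed_vector \<Rightarrow> 'e" and h :: "'a::real_normed_vector \<Rightarrow> real"
  assumes "has_dir_deriv h v x h'" "has_dir_deriv f v x D"
  shows "has_dir_deriv (\<lambda>x. h x *\<^sub>R f x) v x (h' *\<^sub>R f x + h x *\<^sub>R D)"
proof -
  have "((\<lambda>t. t * ((1 / t) *\<^sub>R (h (x + t *\<^sub>R v) - h x)) + h x) \<longlongrightarrow> 0 * h' + h x) (at 0)"
    using assms(1) unfolding has_dir_deriv_def by (intro tendsto_intros) auto
  then have "((\<lambda>t. t * ((1 / t) *\<^sub>R (h (x + t *\<^sub>R v) - h x)) + h x) \<longlongrightarrow> h x) (at 0)"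
    by simp
  then have cont: "((\<lambda>t. h (x + t *\<^sub>R v)) \<longlongrightarrow> h x) (at 0)"
    by (rule Lim_transform_eventually) (auto simp: eventually_at_filter)
  have "((\<lambda>t. ((1 / t) *\<^sub>R (h (x + t *\<^sub>R v) - h x)) *\<^sub>R f x
      + h (x + t *\<^sub>R v) *\<^sub>R ((1 / t) *\<^sub>R (f (x + t *\<^sub>R v) - f x))) \<longlongrightarrow> h' *\<^sub>R f x + h x *\<^sub>R D) (at 0)"
    using assms cont unfolding has_dir_deriv_def
    by (intro tendsto_add_Q tendsto_scaleR_Q tendsto_const) auto
  then show ?thesis
    unfolding has_dir_deriv_def by (simp add: algebra_simps)
qed

lemma has_dir_deriv_diff:
  fixes f g :: "'a::real_normed_vector \<Rightarrow> 'e"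
  assumes "has_dir_deriv f v x D" "has_dir_deriv g v x D'"
  shows "has_dir_deriv (\<lambda>x. f x - g x) v x (D - D')"
proof -
  have "has_dir_deriv (\<lambda>_. -1 :: real) v x 0"
    by (simp add: has_dir_deriv_def)
  from has_dir_deriv_add[OF assms(1) has_dir_deriv_scaleR[OF this assms(2)]] show ?thesis by simp
qed

text \<open>
  Schwarz's theorem, including the existence of the second mixed derivative: the second
  difference of \<open>f\<close> is compared with \<open>s t\<close> times \<open>fvw x\<close> by applying the mean value inequality first in direction
  \<open>w\<close> and then in direction \<open>v\<close>. Letting \<open>t\<close> tend to \<open>0\<close> first leaves the difference quotient of
  \<open>fw\<close> in direction \<open>v\<close>.
\<close>

lemma symmetric_second_derivative:
  fixes f :: "'a::real_normed_vector \<Rightarrow> 'e"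
  assumes "open S"
    and fv: "\<And>z. z \<in> S \<Longrightarrow> has_dir_deriv f v z (fv z)"
    and fw: "\<And>z. z \<in> S \<Longrightarrow> has_dir_deriv f w z (fw z)"
    and fvw: "\<And>z. z \<in> S \<Longrightarrow> has_dir_deriv fv w z (fvw z)"
    and cont: "continuous_on S fvw" and x: "x \<in> S"
  shows "has_dir_deriv fw v x (fvw x)"
  unfolding has_dir_deriv_iff
proof (intro ballI allI impI)
  fix q and \<epsilon> :: real assume q: "q \<in> Q" and \<epsilon>: "\<epsilon> > 0"
  define D where "D = fvw x"
  have "(fvw \<longlongrightarrow> fvw x) (at x)"
    using cont x \<open>open S\<close> by (metis at_within_open continuous_on_def)
  then have "((\<lambda>z. q (fvw z - D)) \<longlongrightarrow> 0) (at x)"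
    using q unfolding D_def tendsto_iff_Q[of fvw] by (rule bspec)
  then have "eventually (\<lambda>z. q (fvw z - D) < \<epsilon>) (at x)"
    using \<epsilon> by (rule order_tendstoD(2))
  then have "eventually (\<lambda>z. q (fvw z - D) < \<epsilon>) (nhds x)"
    using \<epsilon> by (simp add: eventually_nhds_conv_at D_def Q_zero[OF q])
  moreover have "eventually (\<lambda>z. z \<in> S) (nhds x)"
    using \<open>open S\<close> x by (rule eventually_nhds_in_open)
  ultimately have "eventually (\<lambda>z. q (fvw z - D) < \<epsilon> \<and> z \<in> S) (nhds x)"
    by eventually_elim auto
  then obtain d where d: "d > 0" and dS: "\<And>z. dist z x < d \<Longrightarrow> z \<in> S"
    and dq: "\<And>z. dist z x < d \<Longrightarrow> q (fvw z - D) < \<epsilon>"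
    unfolding eventually_nhds_metric by blast
  define r where "r = d / (norm v + norm w + 1)"
  have r: "r > 0" using d by (simp add: r_def add_nonneg_pos)
  have near: "dist (x + s *\<^sub>R v + t *\<^sub>R w) x < d" if "\<bar>s\<bar> < r" "\<bar>t\<bar> < r" for s t
  proof -
    have nz: "norm v + norm w + 1 \<noteq> 0"
      using norm_ge_zero[of v] norm_ge_zero[of w] by linarith
    have "dist (x + s *\<^sub>R v + t *\<^sub>R w) x \<le> \<bar>s\<bar> * norm v + \<bar>t\<bar> * norm w"
      using norm_triangle_ineq[of "s *\<^sub>R v" "t *\<^sub>R w"] by (simp add: dist_norm add.assoc)
    also have "\<dots> \<le> r * norm v + r * norm w"
      using that by (intro add_mono mult_right_mono) auto
    also have "\<dots> < r * (norm v + norm w + 1)"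
      using r by (simp add: algebra_simps)
    also have "\<dots> = d"
      using nz unfolding r_def by simp
    finally show ?thesis .
  qed
  have seg: "\<bar>u\<bar> < r" if "u \<in> closed_segment 0 t" "\<bar>t\<bar> < r" for u t :: real
    using that by (auto simp: closed_segment_eq_real_ivl split: if_splits)
  have inner: "q (fv (x + s *\<^sub>R v + t *\<^sub>R w) - fv (x + s *\<^sub>R v) - t *\<^sub>R D) \<le> \<epsilon> * \<bar>t\<bar>"
    if st: "\<bar>s\<bar> < r" "\<bar>t\<bar> < r" for s t
  proof -
    have "q (fv (x + s *\<^sub>R v + t *\<^sub>R w) - fv (x + s *\<^sub>R v + 0 *\<^sub>R w) - (t - 0) *\<^sub>R D) \<le> \<epsilon> * \<bar>t - 0\<bar>"
    proof (rule mean_value_inequality[OF q])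
      fix u :: real assume "u \<in> closed_segment 0 t"
      then have u: "dist (x + s *\<^sub>R v + u *\<^sub>R w) x < d" using near seg st by blast
      show "has_dir_deriv (\<lambda>u. fv (x + s *\<^sub>R v + u *\<^sub>R w)) 1 u (fvw (x + s *\<^sub>R v + u *\<^sub>R w))"
        by (rule has_dir_deriv_line[OF fvw[OF dS[OF u]]])
      show "q (fvw (x + s *\<^sub>R v + u *\<^sub>R w) - D) \<le> \<epsilon>"
        using dq[OF u] by simp
    qed
    then show ?thesis by simp
  qed
  have outer: "q (f (x + s *\<^sub>R v + t *\<^sub>R w) - f (x + s *\<^sub>R v) - (f (x + t *\<^sub>R w) - f x) - s *\<^sub>R (t *\<^sub>R D)) \<le> \<epsilon> * \<bar>t\<bar> * \<bar>s\<bar>"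
    if st: "\<bar>s\<bar> < r" "\<bar>t\<bar> < r" for s t
  proof -
    define G where "G = (\<lambda>s. f (x + t *\<^sub>R w + s *\<^sub>R v) + (-1) *\<^sub>R f (x + s *\<^sub>R v))"
    have "q (G s - G 0 - (s - 0) *\<^sub>R (t *\<^sub>R D)) \<le> \<epsilon> * \<bar>t\<bar> * \<bar>s - 0\<bar>"
    proof (rule mean_value_inequality[OF q])
      fix u :: real assume "u \<in> closed_segment 0 s"
      then have u: "\<bar>u\<bar> < r" using seg st by blast
      then have 1: "x + u *\<^sub>R v + t *\<^sub>R w \<in> S" "x + u *\<^sub>R v \<in> S"
        using near[OF u st(2)] near[OF u, of 0] r dS by auto
      have "has_dir_deriv (\<lambda>u::real. -1 :: real) 1 u 0"
        by (simp add: has_dir_deriv_def)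
      from has_dir_deriv_scaleR[OF this has_dir_deriv_line[OF fv[OF 1(2)]]]
      have "has_dir_deriv (\<lambda>u. (-1) *\<^sub>R f (x + u *\<^sub>R v)) 1 u ((-1) *\<^sub>R fv (x + u *\<^sub>R v))"
        by simp
      moreover have "has_dir_deriv (\<lambda>u. f (x + t *\<^sub>R w + u *\<^sub>R v)) 1 u (fv (x + u *\<^sub>R v + t *\<^sub>R w))"
        by (rule has_dir_deriv_line) (use fv[OF 1(1)] in \<open>simp add: algebra_simps\<close>)
      ultimately show "has_dir_deriv G 1 u (fv (x + u *\<^sub>R v + t *\<^sub>R w) + (-1) *\<^sub>R fv (x + u *\<^sub>R v))"
        unfolding G_def using has_dir_deriv_add by blast
      show "q (fv (x + u *\<^sub>R v + t *\<^sub>R w) + (-1) *\<^sub>R fv (x + u *\<^sub>R v) - t *\<^sub>R D) \<le> \<epsilon> * \<bar>t\<bar>"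
        using inner[OF u st(2)] by simp
    qed
    then show ?thesis
      by (simp add: G_def algebra_simps)
  qed
  have main: "q (fw (x + s *\<^sub>R v) - fw x - s *\<^sub>R D) \<le> \<epsilon> * \<bar>s\<bar>" if s: "\<bar>s\<bar> < r" for s
  proof -
    have xs: "x + s *\<^sub>R v \<in> S" using near[OF s, of 0] r dS by auto
    define u where "u = (\<lambda>t. (1/t) *\<^sub>R (f (x + s *\<^sub>R v + t *\<^sub>R w) - f (x + s *\<^sub>R v)) +
      ((-1) *\<^sub>R ((1/t) *\<^sub>R (f (x + t *\<^sub>R w) - f x)) + - (s *\<^sub>R D)))"
    have "(u \<longlongrightarrow> fw (x + s *\<^sub>R v) + ((-1) *\<^sub>R fw x + - (s *\<^sub>R D))) (at 0)"
      unfolding u_def using fw[OF xs] fw[OF x] unfolding has_dir_deriv_def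
      by (intro tendsto_add_Q tendsto_scaleR_Q tendsto_const)
    then have lim: "((\<lambda>t. q (u t)) \<longlongrightarrow> q (fw (x + s *\<^sub>R v) + ((-1) *\<^sub>R fw x + - (s *\<^sub>R D)))) (at 0)"
      by (rule tendsto_Q[OF q])
    have "\<forall>\<^sub>F t in at 0. q (u t) \<le> \<epsilon> * \<bar>s\<bar>"
      unfolding eventually_at
    proof (intro exI[of _ r] conjI r ballI impI)
      fix t :: real assume "t \<noteq> 0 \<and> dist t 0 < r"
      then have t: "t \<noteq> 0" "\<bar>t\<bar> < r" by auto
      have "u t = (1/t) *\<^sub>R (f (x + s *\<^sub>R v + t *\<^sub>R w) - f (x + s *\<^sub>R v) - (f (x + t *\<^sub>R w) - f x) - s *\<^sub>R (t *\<^sub>R D))"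
        using t by (simp add: u_def algebra_simps)
      then have "q (u t) = (1/\<bar>t\<bar>) * q (f (x + s *\<^sub>R v + t *\<^sub>R w) - f (x + s *\<^sub>R v) - (f (x + t *\<^sub>R w) - f x) - s *\<^sub>R (t *\<^sub>R D))"
        using Q_scale[OF q] by simp
      also have "\<dots> \<le> (1/\<bar>t\<bar>) * (\<epsilon> * \<bar>t\<bar> * \<bar>s\<bar>)"
        using outer[OF s t(2)] by (intro mult_left_mono) auto
      also have "\<dots> = \<epsilon> * \<bar>s\<bar>" using t by simp
      finally show "q (u t) \<le> \<epsilon> * \<bar>s\<bar>" .
    qed
    then have "q (fw (x + s *\<^sub>R v) + ((-1) *\<^sub>R fw x + - (s *\<^sub>R D))) \<le> \<epsilon> * \<bar>s\<bar>"
      by (rule tendsto_upperbound[OF lim]) simp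
    moreover have "fw (x + s *\<^sub>R v) + ((-1) *\<^sub>R fw x + - (s *\<^sub>R D)) = fw (x + s *\<^sub>R v) - fw x - s *\<^sub>R D"
      by simp
    ultimately show ?thesis by metis
  qed
  show "\<forall>\<^sub>F s in at 0. q (fw (x + s *\<^sub>R v) - fw x - s *\<^sub>R fvw x) \<le> \<epsilon> * \<bar>s\<bar>"
    unfolding eventually_at D_def[symmetric]
  proof (intro exI[of _ r] conjI r ballI impI)
    fix s :: real assume "s \<noteq> 0 \<and> dist s 0 < r"
    then show "q (fw (x + s *\<^sub>R v) - fw x - s *\<^sub>R D) \<le> \<epsilon> * \<bar>s\<bar>"
      by (intro main) simp
  qed
qed

end

section \<open>The order of differentiation, and the Leibniz rule\<close>

text \<open>
  All ways to distribute the directions of an iterated derivative over the two factors of a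
  product, listed with multiplicity.
\<close>

primrec splits :: "'a list \<Rightarrow> ('a list \<times> 'a list) list" where
  "splits [] = [([], [])]"
| "splits (v # vs) = map (\<lambda>(as, bs). (v # as, bs)) (splits vs) @ map (\<lambda>(as, bs). (as, v # bs)) (splits vs)"

lemma mset_splits: "(as, bs) \<in> set (splits vs) \<Longrightarrow> mset vs = mset as + mset bs"
  by (induction vs arbitrary: as bs) auto

context seminorm_space
begin

text \<open>
  The spaces at hand only guarantee the derivatives taken in one standard order of the
  coordinates, whereas differentiating a derivative once more in an arbitrary direction leads to
  other orders. Insertion sort reduces them to the standard order: moving \<open>v\<close> past a smaller head
  \<open>w\<close> is one application of Schwarz's theorem, whose hypotheses concern the sorted list, which is
  covered by assumption, and a shorter list, which is covered by induction.
\<close>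

lemma iter_deriv_sort_key:
  fixes f :: "'a::real_normed_vector \<Rightarrow> 'e" and key :: "'a \<Rightarrow> 'k::linorder"
  assumes S: "open S"
    and closed: "\<And>vs ws. adm vs \<Longrightarrow> mset ws \<subseteq># mset vs \<Longrightarrow> adm ws"
    and sorted: "\<And>vs. adm vs \<Longrightarrow> sorted (map key vs) \<Longrightarrow>
      iter_differentiable_on S vs f \<and> continuous_on S (iter_deriv vs f)"
    and vs: "adm vs"
  shows "iter_differentiable_on S vs f \<and> (\<forall>x\<in>S. iter_deriv vs f x = iter_deriv (sort_key key vs) f x)"
  using vs
proof (induction vs rule: length_induct)
  case (1 vs)
  show ?case
  proof (cases vs)
    case (Cons v us)
    have adm_sub: "adm xs" if "mset xs \<subseteq># mset vs" for xs
      using closed "1.prems" that by blast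
    have us: "iter_differentiable_on S us f" "\<And>x. x \<in> S \<Longrightarrow> iter_deriv us f x = iter_deriv (sort_key key us) f x"
      using 1 adm_sub[of us] Cons by auto
    have us_cong: "has_dir_deriv (iter_deriv us f) v x D \<longleftrightarrow> has_dir_deriv (iter_deriv (sort_key key us) f) v x D"
      if "x \<in> S" for x D
      by (rule has_dir_deriv_cong[OF S that us(2)])
    have sorted_vs: "iter_differentiable_on S (sort_key key vs) f" "continuous_on S (iter_deriv (sort_key key vs) f)"
      using sorted[of "sort_key key vs"] adm_sub[of "sort_key key vs"] by auto
    have "has_dir_deriv (iter_deriv us f) v x (iter_deriv (sort_key key vs) f x)" if x: "x \<in> S" for x
    proof (cases "sort_key key us")
      case Nil
      then have "us = []" by (metis length_sort length_0_conv)
      then show ?thesis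
        using sorted_vs Cons x has_dir_deriv_iter[of S v "[]" f x] by simp
    next
      case ss: (Cons w ws)
      have us_mset: "mset us = mset (w # ws)" using ss by (metis mset_sort)
      have sorted_ss: "sorted (map key (w # ws))" using sorted_sort_key[of key us] ss by simp
      show ?thesis
      proof (cases "key v \<le> key w")
        case True
        then have eq: "sort_key key vs = v # sort_key key us"
          using Cons ss by simp
        then have "has_dir_deriv (iter_deriv (sort_key key us) f) v x (iter_deriv (sort_key key vs) f x)"
          using has_dir_deriv_iter[OF _ x] sorted_vs by metis
        then show ?thesis
          unfolding us_cong[OF x] .
      next
        case False
        define ts where "ts = insort_key key v ws"
        have eq: "sort_key key vs = w # ts"
          using Cons ss False by (simp add: ts_def)
        have ts: "sort_key key (v # ws) = ts"
          using sorted_ss by (simp add: ts_def sort_key_id_if_sorted)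
        have sub: "mset (v # ws) \<subseteq># mset vs" "mset (w # ws) \<subseteq># mset vs"
          using us_mset Cons by auto
        have "length (v # ws) < length vs"
          using Cons mset_eq_length[OF us_mset] by simp
        then have vws: "iter_differentiable_on S (v # ws) f"
          "\<And>x. x \<in> S \<Longrightarrow> iter_deriv (v # ws) f x = iter_deriv ts f x"
          using "1.IH" adm_sub[OF sub(1)] unfolding ts[symmetric] by blast+
        have wws: "iter_differentiable_on S (w # ws) f"
          using sorted[OF adm_sub[OF sub(2)] sorted_ss] by blast
        have "has_dir_deriv (iter_deriv (w # ws) f) v x (iter_deriv (w # ts) f x)"
        proof (rule symmetric_second_derivative[OF S, where w = w])
          show "has_dir_deriv (iter_deriv ws f) v z (iter_deriv (v # ws) f z)" if "z \<in> S" for z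
            using has_dir_deriv_iter[OF vws(1) that] .
          show "has_dir_deriv (iter_deriv ws f) w z (iter_deriv (w # ws) f z)" if "z \<in> S" for z
            using has_dir_deriv_iter[OF wws that] .
          show "has_dir_deriv (iter_deriv (v # ws) f) w z (iter_deriv (w # ts) f z)" if "z \<in> S" for z
            using has_dir_deriv_iter[OF sorted_vs(1)[unfolded eq] that]
            by (subst has_dir_deriv_cong[OF S that vws(2)])
          show "continuous_on S (iter_deriv (w # ts) f)"
            using sorted_vs(2) unfolding eq .
        qed (rule x)
        then show ?thesis
          unfolding eq us_cong[OF x] ss .
      qed
    qed
    then show ?thesis
      using us(1) Cons by (auto simp: dir_deriv_eqI)
  qed simp
qed

lemma has_dir_deriv_sum_list:
  fixes f :: "'z \<Rightarrow> 'a::real_normed_vector \<Rightarrow> 'e"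
  assumes "\<And>z. z \<in> set zs \<Longrightarrow> has_dir_deriv (f z) v x (D z)"
  shows "has_dir_deriv (\<lambda>x. \<Sum>z\<leftarrow>zs. f z x) v x (\<Sum>z\<leftarrow>zs. D z)"
  using assms
proof (induction zs)
  case (Cons z zs)
  then show ?case using has_dir_deriv_add[of "f z" v x "D z"] by simp
qed (simp add: has_dir_deriv_def)

lemma iter_deriv_scaleR:
  fixes f :: "'a::real_normed_vector \<Rightarrow> 'e" and h :: "'a \<Rightarrow> real"
  assumes S: "open S"
    and "\<And>as bs. (as, bs) \<in> set (splits vs) \<Longrightarrow> iter_differentiable_on S as h \<and> iter_differentiable_on S bs f"
  shows "iter_differentiable_on S vs (\<lambda>x. h x *\<^sub>R f x) \<and>
    (\<forall>x\<in>S. iter_deriv vs (\<lambda>x. h x *\<^sub>R f x) x = (\<Sum>(as, bs)\<leftarrow>splits vs. iter_deriv as h x *\<^sub>R iter_deriv bs f x))"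
  using assms(2)
proof (induction vs)
  case (Cons v vs)
  have diff: "iter_differentiable_on S (v # as) h" "iter_differentiable_on S (v # bs) f"
    if "(as, bs) \<in> set (splits vs)" for as bs
  proof -
    have "(v # as, bs) \<in> set (splits (v # vs))" "(as, v # bs) \<in> set (splits (v # vs))"
      using that by force+
    then show "iter_differentiable_on S (v # as) h" "iter_differentiable_on S (v # bs) f"
      using Cons.prems by blast+
  qed
  have IH: "iter_differentiable_on S vs (\<lambda>x. h x *\<^sub>R f x)"
    "\<And>x. x \<in> S \<Longrightarrow> iter_deriv vs (\<lambda>x. h x *\<^sub>R f x) x = (\<Sum>(as, bs)\<leftarrow>splits vs. iter_deriv as h x *\<^sub>R iter_deriv bs f x)"
    using Cons.IH diff by (auto simp: iter_differentiable_on.simps(2))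
  have "has_dir_deriv (iter_deriv vs (\<lambda>x. h x *\<^sub>R f x)) v x
     (\<Sum>(as, bs)\<leftarrow>splits (v # vs). iter_deriv as h x *\<^sub>R iter_deriv bs f x)" if x: "x \<in> S" for x
  proof -
    have "has_dir_deriv (\<lambda>x. \<Sum>z\<leftarrow>splits vs. iter_deriv (fst z) h x *\<^sub>R iter_deriv (snd z) f x) v x
      (\<Sum>z\<leftarrow>splits vs. iter_deriv (v # fst z) h x *\<^sub>R iter_deriv (snd z) f x + iter_deriv (fst z) h x *\<^sub>R iter_deriv (v # snd z) f x)"
    proof (rule has_dir_deriv_sum_list)
      fix z assume z: "z \<in> set (splits vs)"
      then have "iter_differentiable_on S (v # fst z) h" "iter_differentiable_on S (v # snd z) f"
        using diff[of "fst z" "snd z"] by auto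
      then show "has_dir_deriv (\<lambda>x. iter_deriv (fst z) h x *\<^sub>R iter_deriv (snd z) f x) v x
         (iter_deriv (v # fst z) h x *\<^sub>R iter_deriv (snd z) f x + iter_deriv (fst z) h x *\<^sub>R iter_deriv (v # snd z) f x)"
        by (intro has_dir_deriv_scaleR has_dir_deriv_iter[OF _ x])
    qed
    moreover have "(\<Sum>z\<leftarrow>splits vs. iter_deriv (v # fst z) h x *\<^sub>R iter_deriv (snd z) f x + iter_deriv (fst z) h x *\<^sub>R iter_deriv (v # snd z) f x)
      = (\<Sum>(as, bs)\<leftarrow>splits (v # vs). iter_deriv as h x *\<^sub>R iter_deriv bs f x)"
      by (simp add: sum_list_addf case_prod_unfold comp_def)
    ultimately show ?thesis
      by (subst has_dir_deriv_cong[OF S x IH(2)]) (simp_all add: case_prod_unfold)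
  qed
  then show ?case
    using IH(1) dir_deriv_eqI unfolding iter_deriv.simps(2) iter_differentiable_on.simps(2) by blast
qed simp

lemma iter_deriv_diff:
  fixes f g :: "'a::real_normed_vector \<Rightarrow> 'e"
  assumes S: "open S" and "iter_differentiable_on S vs f" "iter_differentiable_on S vs g"
  shows "iter_differentiable_on S vs (\<lambda>x. f x - g x)"
    and "x \<in> S \<Longrightarrow> iter_deriv vs (\<lambda>x. f x - g x) x = iter_deriv vs f x - iter_deriv vs g x"
proof -
  have "iter_differentiable_on S vs (\<lambda>x. f x - g x) \<and>
    (\<forall>x\<in>S. iter_deriv vs (\<lambda>x. f x - g x) x = iter_deriv vs f x - iter_deriv vs g x)"
    using assms(2,3)
  proof (induction vs)
    case (Cons v vs)
    then have IH: "iter_differentiable_on S vs (\<lambda>x. f x - g x)"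
      "\<And>x. x \<in> S \<Longrightarrow> iter_deriv vs (\<lambda>x. f x - g x) x = iter_deriv vs f x - iter_deriv vs g x" by auto
    have "has_dir_deriv (iter_deriv vs (\<lambda>x. f x - g x)) v x (iter_deriv (v # vs) f x - iter_deriv (v # vs) g x)"
      if x: "x \<in> S" for x
      by (subst has_dir_deriv_cong[OF S x IH(2)])
        (auto intro!: has_dir_deriv_diff has_dir_deriv_iter[OF Cons.prems(1) x, unfolded iter_deriv.simps]
          has_dir_deriv_iter[OF Cons.prems(2) x, unfolded iter_deriv.simps])
    then show ?case using IH(1) dir_deriv_eqI
      unfolding iter_deriv.simps(2) iter_differentiable_on.simps(2) by blast
  qed simp
  then show "iter_differentiable_on S vs (\<lambda>x. f x - g x)"
    and "x \<in> S \<Longrightarrow> iter_deriv vs (\<lambda>x. f x - g x) x = iter_deriv vs f x - iter_deriv vs g x" by auto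
qed

lemma mean_value_line:
  fixes f :: "'a::real_normed_vector \<Rightarrow> 'e"
  assumes q: "q \<in> Q"
    and der: "\<And>u. u \<in> closed_segment 0 t \<Longrightarrow> has_dir_deriv f v (p + u *\<^sub>R v) (g (p + u *\<^sub>R v))"
    and bound: "\<And>u. u \<in> closed_segment 0 t \<Longrightarrow> q (g (p + u *\<^sub>R v)) \<le> M"
  shows "q (f p) \<le> q (f (p + t *\<^sub>R v)) + M * \<bar>t\<bar>"
proof -
  have "q (f (p + t *\<^sub>R v) - f (p + 0 *\<^sub>R v) - (t - 0) *\<^sub>R 0) \<le> M * \<bar>t - 0\<bar>"
    by (rule mean_value_inequality[OF q, where g = "\<lambda>u. g (p + u *\<^sub>R v)"])
      (simp_all add: has_dir_deriv_line der bound)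
  then show ?thesis
    using Q_diff_rev[OF q, of "f (p + t *\<^sub>R v)" "f p"] by simp
qed

end

section \<open>Decay towards the boundary\<close>

text \<open>
  Distances are measured in the 1-norm because points are joined to the boundary by paths that
  run parallel to the coordinate axes: only partial derivatives are available, and the 1-norm is
  the length of such a path.
\<close>

definition l1_norm :: "real ^ 'j \<Rightarrow> real" where
  "l1_norm x = (\<Sum>i\<in>UNIV. \<bar>x $ i\<bar>)"

definition collar :: "real \<Rightarrow> (real ^ 'j) set \<Rightarrow> (real ^ 'j) set" where
  "collar \<rho> X = {x \<in> X. \<exists>y. y \<notin> X \<and> l1_norm (y - x) \<le> \<rho>}"

lemma l1_norm_nonneg: "0 \<le> l1_norm x"
  by (simp add: l1_norm_def sum_nonneg)

lemma norm_le_l1_norm: "norm x \<le> l1_norm x"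
  unfolding l1_norm_def using norm_le_l1_cart .

lemma l1_norm_move_axis:
  assumes "t \<in> closed_segment 0 (y $ j - x $ j)"
  shows "l1_norm (y - (x + t *\<^sub>R axis j 1)) = l1_norm (y - x) - \<bar>t\<bar>"
proof -
  have "l1_norm (y - (x + t *\<^sub>R axis j 1)) = \<bar>y $ j - x $ j - t\<bar> + (\<Sum>i\<in>UNIV - {j}. \<bar>y $ i - x $ i\<bar>)"
    unfolding l1_norm_def by (subst sum.remove[of _ j]) (auto simp: axis_def intro!: sum.cong)
  moreover have "l1_norm (y - x) = \<bar>y $ j - x $ j\<bar> + (\<Sum>i\<in>UNIV - {j}. \<bar>y $ i - x $ i\<bar>)"
    unfolding l1_norm_def by (subst sum.remove[of _ j]) auto
  moreover have "\<bar>y $ j - x $ j - t\<bar> = \<bar>y $ j - x $ j\<bar> - \<bar>t\<bar>"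
    using assms by (auto simp: closed_segment_eq_real_ivl split: if_splits)
  ultimately show ?thesis by simp
qed

text \<open>
  What matters is that the bound is uniform in the components of \<open>p\<close> that \<open>pr\<close> forgets. It is
  one-sided because \<open>g\<close> will be a product of weights with a seminorm of a function.
\<close>

definition vanishing_over :: "'p set \<Rightarrow> ('p \<Rightarrow> 'x::topological_space) \<Rightarrow> 'x set \<Rightarrow> ('p \<Rightarrow> real) \<Rightarrow> bool" where
  "vanishing_over \<Omega> pr X g \<longleftrightarrow> (\<forall>\<eta>>0. \<exists>K. compact K \<and> K \<subseteq> X \<and> (\<forall>p\<in>\<Omega>. pr p \<notin> K \<longrightarrow> g p \<le> \<eta>))"

lemma vanishing_overD:
  assumes "vanishing_over \<Omega> pr X g" "\<eta> > 0"
  shows "\<exists>K. compact K \<and> K \<subseteq> X \<and> (\<forall>p\<in>\<Omega>. pr p \<notin> K \<longrightarrow> g p \<le> \<eta>)"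
  using assms by (simp add: vanishing_over_def)

text \<open>
  A product domain seen from one of its factors: \<open>X\<close> is that factor, \<open>pr\<close> the projection onto it,
  and \<open>emb\<close> the embedding of its directions. Both factors of \<open>U \<times> V\<close> are instances, so that each
  estimate has to be proved only once.
\<close>

locale coordinate_block =
  fixes emb :: "real ^ 'j \<Rightarrow> 'p::real_normed_vector" and pr :: "'p \<Rightarrow> real ^ 'j"
    and \<Omega> :: "'p set" and X :: "(real ^ 'j) set"
  assumes linear_emb: "linear emb" and bounded_linear_pr: "bounded_linear pr" and pr_emb: "pr (emb s) = s"
    and open_\<Omega>: "open \<Omega>" and open_X: "open X"
    and pr_\<Omega>: "p \<in> \<Omega> \<Longrightarrow> pr p \<in> X"
    and move_\<Omega>: "p \<in> \<Omega> \<Longrightarrow> pr p + s \<in> X \<Longrightarrow> p + emb s \<in> \<Omega>"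
begin

lemma linear_pr: "linear pr"
  by (rule bounded_linear.linear[OF bounded_linear_pr])

lemma continuous_on_pr: "continuous_on S pr"
  by (rule bounded_linear.continuous_on[OF bounded_linear_pr continuous_on_id])

end

locale seminorm_block = seminorm_space Q + coordinate_block emb pr \<Omega> X
  for Q :: "('e::{real_vector,t2_space} \<Rightarrow> real) set"
  and emb :: "real ^ 'j \<Rightarrow> 'p::real_normed_vector" and pr \<Omega> X
begin

abbreviation edir :: "'j \<Rightarrow> 'p" where "edir j \<equiv> emb (axis j 1)"

lemma pr_line: "pr (p + t *\<^sub>R emb s) = pr p + t *\<^sub>R s"
  by (simp add: linear_add[OF linear_pr] linear_scale[OF linear_pr] pr_emb)

lemma line_mem:
  assumes "p \<in> \<Omega>" "pr p + t *\<^sub>R s \<in> X"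
  shows "p + t *\<^sub>R emb s \<in> \<Omega>"
  using move_\<Omega>[OF assms] by (simp add: linear_scale[OF linear_emb])

text \<open>
  One walks in the block from \<open>pr p\<close> to a point \<open>y\<close> outside \<open>X\<close> along axis-parallel segments. Each
  point on the way is at least as close to \<open>y\<close> as \<open>pr p\<close> is, hence in the collar as long as it lies
  in \<open>X\<close>; before the path leaves \<open>X\<close>, the function has become arbitrarily small.
\<close>

lemma bound_via_boundary:
  fixes f :: "'p \<Rightarrow> 'e"
  assumes q: "q \<in> Q" and M: "0 \<le> M"
    and der: "\<And>j p. p \<in> \<Omega> \<Longrightarrow> has_dir_deriv f (edir j) p (d j p)"
    and van: "vanishing_over \<Omega> pr X (\<lambda>p. q (f p))"
    and bound: "\<And>j p. p \<in> \<Omega> \<Longrightarrow> pr p \<in> collar \<rho> X \<Longrightarrow> q (d j p) \<le> M"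
    and p: "p \<in> \<Omega>" "pr p \<in> collar \<rho> X"
  shows "q (f p) \<le> M * \<rho>"
proof -
  have path: "q (f p) \<le> M * l1_norm (y - pr p)"
    if "finite I" "p \<in> \<Omega>" "y \<notin> X" "\<And>i. i \<notin> I \<Longrightarrow> y $ i = pr p $ i" "l1_norm (y - pr p) \<le> \<rho>" for I p y
    using that
  proof (induction I arbitrary: p)
    case empty
    then have "y = pr p" by (simp add: vec_eq_iff)
    then show ?case using empty pr_\<Omega> by blast
  next
    case (insert j I)
    define s where "s = y $ j - pr p $ j"
    define x where "x = (\<lambda>t. pr p + t *\<^sub>R axis j 1)"
    have l1: "l1_norm (y - x t) = l1_norm (y - pr p) - \<bar>t\<bar>" if "t \<in> closed_segment 0 s" for t
      using that l1_norm_move_axis unfolding s_def x_def by blast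
    have sub: "u \<in> closed_segment 0 s" if "u \<in> closed_segment 0 t" "t \<in> closed_segment 0 s" for u t
      using that by (auto simp: closed_segment_eq_real_ivl split: if_splits)
    have mv: "q (f p) \<le> q (f (p + t *\<^sub>R edir j)) + M * \<bar>t\<bar>"
      if t: "t \<in> closed_segment 0 s" and X: "\<And>u. u \<in> closed_segment 0 t \<Longrightarrow> x u \<in> X" for t
    proof (rule mean_value_line[OF q])
      fix u assume u: "u \<in> closed_segment 0 t"
      have mem: "p + u *\<^sub>R edir j \<in> \<Omega>"
        using line_mem[OF insert.prems(1)] X[OF u] unfolding x_def .
      then show "has_dir_deriv f (edir j) (p + u *\<^sub>R edir j) (d j (p + u *\<^sub>R edir j))"
        by (rule der)
      have "l1_norm (y - x u) \<le> \<rho>"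
        using l1[OF sub[OF u t]] insert.prems(4) by simp
      then have "pr (p + u *\<^sub>R edir j) \<in> collar \<rho> X"
        using X[OF u] insert.prems(2) unfolding pr_line collar_def x_def by blast
      then show "q (d j (p + u *\<^sub>R edir j)) \<le> M"
        using bound mem by blast
    qed
    show ?case
    proof (cases "\<forall>t\<in>closed_segment 0 s. x t \<in> X")
      case True
      then have p': "p + s *\<^sub>R edir j \<in> \<Omega>"
        using line_mem[OF insert.prems(1)] unfolding x_def by auto
      have "q (f (p + s *\<^sub>R edir j)) \<le> M * l1_norm (y - pr (p + s *\<^sub>R edir j))"
      proof (rule insert.IH[OF p' insert.prems(2)])
        show "y $ i = pr (p + s *\<^sub>R edir j) $ i" if "i \<notin> I" for i
          using insert.prems(3)[of i] that unfolding pr_line by (auto simp: s_def axis_def)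
        show "l1_norm (y - pr (p + s *\<^sub>R edir j)) \<le> \<rho>"
          using l1[of s] insert.prems(4) unfolding pr_line x_def by simp
      qed
      also have "\<dots> = M * l1_norm (y - pr p) - M * \<bar>s\<bar>"
        using l1[of s] unfolding pr_line x_def by (simp add: right_diff_distrib)
      finally show ?thesis
        using mv[of s] True by auto
    next
      case False
      (* The first exit time exists because the complement of X is closed. *)
      define T where "T = {\<tau>\<in>{0..1}. x (\<tau> * s) \<notin> X}"
      have cont: "continuous_on UNIV (\<lambda>\<tau>. x (\<tau> * s))"
        unfolding x_def by (intro continuous_intros)
      have "closed ((\<lambda>\<tau>. x (\<tau> * s)) -` (- X))"
        using open_X by (intro continuous_closed_vimage) (use cont in \<open>auto simp: continuous_on_eq_continuous_at\<close>)
      moreover have "T = {0..1} \<inter> (\<lambda>\<tau>. x (\<tau> * s)) -` (- X)"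
        by (auto simp: T_def)
      ultimately have "compact T"
        by (simp add: compact_Int_closed)
      moreover have "T \<noteq> {}"
        using False by (auto simp: T_def closed_segment_def)
      ultimately have "\<exists>\<tau>0\<in>T. \<forall>\<tau>\<in>T. \<tau>0 \<le> \<tau>"
        by (rule compact_attains_inf)
      then obtain \<tau>0 where \<tau>0: "\<tau>0 \<in> T" "\<And>\<tau>. \<tau> \<in> T \<Longrightarrow> \<tau>0 \<le> \<tau>"
        by auto
      have "x 0 \<in> X" using pr_\<Omega> insert.prems(1) by (simp add: x_def)
      moreover have \<tau>0_mem: "0 \<le> \<tau>0" "\<tau>0 \<le> 1" "x (\<tau>0 * s) \<notin> X"
        using \<tau>0(1) by (simp_all add: T_def)
      ultimately have "\<tau>0 \<noteq> 0"
        by (metis mult_zero_left)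
      with \<tau>0_mem have pos: "\<tau>0 > 0" "\<tau>0 \<le> 1" "x (\<tau>0 * s) \<notin> X"
        by simp_all
      have "q (f p) \<le> M * \<bar>s\<bar> + \<eta>" if \<eta>: "\<eta> > 0" for \<eta>
      proof -
        obtain K where K: "compact K" "K \<subseteq> X" "\<And>p. p \<in> \<Omega> \<Longrightarrow> pr p \<notin> K \<Longrightarrow> q (f p) \<le> \<eta>"
          using vanishing_overD[OF van \<eta>] by auto
        have "open ((\<lambda>\<tau>. x (\<tau> * s)) -` (- K))"
          using compact_imp_closed[OF K(1)] by (intro continuous_open_vimage) (use cont in \<open>auto simp: continuous_on_eq_continuous_at\<close>)
        moreover have "\<tau>0 \<in> (\<lambda>\<tau>. x (\<tau> * s)) -` (- K)"
          using pos K(2) by auto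
        ultimately obtain e where e: "e > 0" "ball \<tau>0 e \<subseteq> (\<lambda>\<tau>. x (\<tau> * s)) -` (- K)"
          by (rule openE)
        define \<tau> where "\<tau> = max 0 (\<tau>0 - e / 2)"
        have \<tau>: "0 \<le> \<tau>" "\<tau> < \<tau>0" "\<tau> \<in> ball \<tau>0 e"
          using pos e(1) by (auto simp: \<tau>_def dist_norm max_def)
        have before: "x u \<in> X" if "u \<in> closed_segment 0 (\<tau> * s)" for u
        proof -
          have "\<exists>c. 0 \<le> c \<and> c \<le> 1 \<and> u = c * (\<tau> * s)"
            using that unfolding in_segment by auto
          then obtain c where "0 \<le> c" "c \<le> 1" "u = c * (\<tau> * s)"
            by blast
          moreover have "c * \<tau> \<le> 1 * \<tau>"
            using calculation \<tau> by (intro mult_right_mono) auto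
          ultimately have "c * \<tau> \<notin> T" "0 \<le> c * \<tau>" "c * \<tau> \<le> 1" "u = (c * \<tau>) * s"
            using \<tau>0(2)[of "c * \<tau>"] \<tau> pos by force+
          then show ?thesis by (simp add: T_def)
        qed
        have mem: "\<tau> * s \<in> closed_segment 0 s"
          using \<tau> pos by (auto simp: closed_segment_def)
        have "p + (\<tau> * s) *\<^sub>R edir j \<in> \<Omega>"
          using line_mem[OF insert.prems(1)] before[of "\<tau> * s"] unfolding x_def by simp
        moreover have "pr (p + (\<tau> * s) *\<^sub>R edir j) \<notin> K"
          using subsetD[OF e(2) \<tau>(3)] unfolding pr_line x_def by simp
        ultimately have "q (f (p + (\<tau> * s) *\<^sub>R edir j)) \<le> \<eta>"
          by (rule K(3))
        moreover have "M * \<bar>\<tau> * s\<bar> \<le> M * \<bar>s\<bar>"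
          using \<tau> pos M by (intro mult_left_mono) (auto simp: abs_mult mult_left_le_one_le)
        ultimately show ?thesis
          using mv[OF mem before] by linarith
      qed
      then have "q (f p) \<le> M * \<bar>s\<bar>"
        by (rule field_le_epsilon)
      also have "\<dots> \<le> M * l1_norm (y - pr p)"
        using l1[of s] l1_norm_nonneg[of "y - x s"] M by (intro mult_left_mono) auto
      finally show ?thesis .
    qed
  qed
  obtain y where y: "y \<notin> X" "l1_norm (y - pr p) \<le> \<rho>"
    using p(2) by (auto simp: collar_def)
  have "q (f p) \<le> M * l1_norm (y - pr p)"
    using path[of UNIV p y] p(1) y by auto
  also have "\<dots> \<le> M * \<rho>"
    using y(2) M by (rule mult_left_mono)
  finally show ?thesis .
qed

text \<open>
  Taylor's formula at the boundary, by \<open>n\<close> applications of the first-order bound. By the product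
  rule a derivative of weight times function is a sum of two terms of the same kind, which
  accounts for the factor \<open>2\<close> in each step.

  The predicate \<open>P n\<close> collects the pairs of direction lists, one for the weight and one for the
  function, that can still be extended by \<open>n\<close> directions; \<open>w\<close> is the part of the weight that
  depends on the other coordinates only.
\<close>

lemma collar_estimate:
  fixes q :: "'e \<Rightarrow> real" and \<gamma> :: "'p \<Rightarrow> 'e" and F :: "real ^ 'j \<Rightarrow> real" and w :: "'p \<Rightarrow> real"
  defines "T as vs p \<equiv> \<bar>iter_deriv as F (pr p)\<bar> * w p * q (iter_deriv vs \<gamma> p)"
  assumes q: "q \<in> Q" and \<epsilon>: "0 \<le> \<epsilon>" and \<rho>: "0 \<le> \<rho>"
    and w: "\<And>p. 0 \<le> w p" "\<And>p s. w (p + emb s) = w p"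
    and P_Suc: "\<And>n as vs j. P (Suc n) as vs \<Longrightarrow>
      P n (axis j 1 # as) vs \<and> P n as (edir j # vs) \<and>
      iter_differentiable_on X (axis j 1 # as) F \<and> iter_differentiable_on \<Omega> (edir j # vs) \<gamma>"
    and van: "\<And>n as vs. P n as vs \<Longrightarrow> vanishing_over \<Omega> pr X (T as vs)"
    and bound: "\<And>n as vs p. P n as vs \<Longrightarrow> p \<in> \<Omega> \<Longrightarrow> pr p \<in> collar \<rho> X \<Longrightarrow> T as vs p \<le> \<epsilon>"
    and P: "P n as vs" and p: "p \<in> \<Omega>" "pr p \<in> collar \<rho> X"
  shows "T as vs p \<le> \<epsilon> * (2 * \<rho>) ^ n"
  using P p
proof (induction n arbitrary: as vs p)
  case 0
  then show ?case using bound by simp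
next
  case (Suc n)
  define f where "f = (\<lambda>p. (w p * iter_deriv as F (pr p)) *\<^sub>R iter_deriv vs \<gamma> p)"
  define d where "d = (\<lambda>j p. (w p * iter_deriv (axis j 1 # as) F (pr p)) *\<^sub>R iter_deriv vs \<gamma> p
    + (w p * iter_deriv as F (pr p)) *\<^sub>R iter_deriv (edir j # vs) \<gamma> p)"
  have qT: "q ((w p * iter_deriv as F (pr p)) *\<^sub>R iter_deriv vs \<gamma> p) = T as vs p" for as vs p
    by (simp add: Q_scale[OF q] T_def abs_mult abs_of_nonneg[OF w(1)])
  have "q (f p) \<le> (2 * (\<epsilon> * (2 * \<rho>) ^ n)) * \<rho>"
  proof (rule bound_via_boundary[OF q, where d = d])
    show "0 \<le> 2 * (\<epsilon> * (2 * \<rho>) ^ n)" using \<epsilon> \<rho> by simp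
    show "vanishing_over \<Omega> pr X (\<lambda>p. q (f p))"
      using van[OF Suc.prems(1)] by (simp add: f_def qT)
    show "p \<in> \<Omega>" "pr p \<in> collar \<rho> X" by fact+
  next
    fix j p assume p: "p \<in> \<Omega>"
    have "has_dir_deriv (iter_deriv as F) (axis j 1) (pr p) (iter_deriv (axis j 1 # as) F (pr p))"
      using P_Suc[OF Suc.prems(1)] has_dir_deriv_iter pr_\<Omega>[OF p] by blast
    then have "((\<lambda>t. w p * ((1 / t) *\<^sub>R (iter_deriv as F (pr p + t *\<^sub>R axis j 1) - iter_deriv as F (pr p))))
      \<longlongrightarrow> w p * iter_deriv (axis j 1 # as) F (pr p)) (at 0)"
      unfolding has_dir_deriv_def by (intro tendsto_intros)
    moreover have "w (p + t *\<^sub>R edir j) = w p" for t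
      using w(2)[of p "t *\<^sub>R axis j 1"] by (simp add: linear_scale[OF linear_emb])
    ultimately have "has_dir_deriv (\<lambda>p. w p * iter_deriv as F (pr p)) (edir j) p (w p * iter_deriv (axis j 1 # as) F (pr p))"
      unfolding has_dir_deriv_def by (simp add: pr_line algebra_simps)
    then show "has_dir_deriv f (edir j) p (d j p)"
      unfolding f_def d_def using P_Suc[OF Suc.prems(1), of j]
      by (intro has_dir_deriv_scaleR has_dir_deriv_iter[OF _ p]) auto
    assume c: "pr p \<in> collar \<rho> X"
    have "q (d j p) \<le> T (axis j 1 # as) vs p + T as (edir j # vs) p"
      unfolding d_def qT[symmetric] by (rule Q_add[OF q])
    also have "\<dots> \<le> \<epsilon> * (2 * \<rho>) ^ n + \<epsilon> * (2 * \<rho>) ^ n"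
      using P_Suc[OF Suc.prems(1)] p c by (intro add_mono Suc.IH) auto
    finally show "q (d j p) \<le> 2 * (\<epsilon> * (2 * \<rho>) ^ n)" by linarith
  qed
  then show ?case
    by (simp add: f_def qT algebra_simps)
qed

end

section \<open>Smooth cutoff functions\<close>

text \<open>
  Differentiability of finite order as an inductive notion. Closure under products and inverses
  is then an induction on the order, without any formula for higher derivatives.
\<close>

primrec ndiff :: "nat \<Rightarrow> (real \<Rightarrow> real) \<Rightarrow> bool" where
  "ndiff 0 f \<longleftrightarrow> True"
| "ndiff (Suc n) f \<longleftrightarrow> (\<exists>f'. (\<forall>t. (f has_real_derivative f' t) (at t)) \<and> ndiff n f')"

lemma ndiff_SucI: "(\<And>t. (f has_real_derivative f' t) (at t)) \<Longrightarrow> ndiff n f' \<Longrightarrow> ndiff (Suc n) f"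
  by auto

lemma ndiff_SucD: "ndiff (Suc n) f \<Longrightarrow> ndiff n f"
proof (induction n arbitrary: f)
  case (Suc n)
  then show ?case by (metis ndiff.simps(2))
qed simp

lemma ndiff_const: "ndiff n (\<lambda>_. c)"
  by (induction n arbitrary: c) (auto intro!: exI[of _ "\<lambda>_. 0"])

lemma ndiff_add: "ndiff n f \<Longrightarrow> ndiff n g \<Longrightarrow> ndiff n (\<lambda>t. f t + g t)"
proof (induction n arbitrary: f g)
  case (Suc n)
  then obtain f' g' where "\<And>t. (f has_real_derivative f' t) (at t)" "ndiff n f'"
    "\<And>t. (g has_real_derivative g' t) (at t)" "ndiff n g'" by auto
  then show ?case
    using Suc.IH[of f' g'] by (auto intro!: exI[of _ "\<lambda>t. f' t + g' t"] derivative_intros)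
qed simp

lemma ndiff_mult: "ndiff n f \<Longrightarrow> ndiff n g \<Longrightarrow> ndiff n (\<lambda>t. f t * g t)"
proof (induction n arbitrary: f g)
  case (Suc n)
  then obtain f' g' where fg: "\<And>t. (f has_real_derivative f' t) (at t)" "ndiff n f'"
    "\<And>t. (g has_real_derivative g' t) (at t)" "ndiff n g'" by auto
  have "ndiff n (\<lambda>t. f' t * g t + g' t * f t)"
    using Suc.IH[OF fg(2) ndiff_SucD[OF Suc.prems(2)]] Suc.IH[OF fg(4) ndiff_SucD[OF Suc.prems(1)]]
    by (rule ndiff_add)
  moreover have "((\<lambda>t. f t * g t) has_real_derivative f' t * g t + g' t * f t) (at t)" for t
    by (rule DERIV_mult[OF fg(1) fg(3)])
  ultimately show ?case by (intro ndiff_SucI)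
qed simp

lemma ndiff_inverse:
  assumes "ndiff n f" "\<And>t. f t \<noteq> 0"
  shows "ndiff n (\<lambda>t. inverse (f t))"
  using assms(1)
proof (induction n)
  case (Suc n)
  then obtain f' where f: "\<And>t. (f has_real_derivative f' t) (at t)" "ndiff n f'" by auto
  have inv: "ndiff n (\<lambda>t. inverse (f t))"
    using Suc.IH ndiff_SucD[OF Suc.prems] by blast
  have "ndiff n (\<lambda>t. - 1 * (inverse (f t) * f' t * inverse (f t)))"
    by (intro ndiff_mult ndiff_const inv f)
  moreover have "((\<lambda>t. inverse (f t)) has_real_derivative - 1 * (inverse (f t) * f' t * inverse (f t))) (at t)" for t
    using DERIV_inverse'[OF f(1) assms(2), of t] by simp
  ultimately show ?case by (intro ndiff_SucI)
qed simp

lemma ndiff_reflect: "ndiff n f \<Longrightarrow> ndiff n (\<lambda>t. f (1 - t))"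
proof (induction n arbitrary: f)
  case (Suc n)
  then obtain f' where f: "\<And>t. (f has_real_derivative f' t) (at t)" "ndiff n f'" by auto
  have "ndiff n (\<lambda>t. f' (1 - t) * (0 - 1))"
    by (intro ndiff_mult ndiff_const Suc.IH f)
  moreover have "((\<lambda>t. f (1 - t)) has_real_derivative f' (1 - t) * (0 - 1)) (at t)" for t
    by (rule DERIV_chain2[OF f(1)]) (auto intro!: derivative_eq_intros)
  ultimately show ?case by (intro ndiff_SucI)
qed simp

lemma ndiff_deriv:
  assumes "ndiff (Suc n) f"
  shows "(f has_real_derivative deriv f t) (at t)" "ndiff n (deriv f)"
proof -
  obtain f' where f: "\<And>t. (f has_real_derivative f' t) (at t)" "ndiff n f'"
    using assms by auto
  then have "deriv f = f'" by (auto simp: DERIV_imp_deriv)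
  with f show "(f has_real_derivative deriv f t) (at t)" "ndiff n (deriv f)" by auto
qed

text \<open>
  The case \<open>p = 1\<close> is the classical smooth function that is flat at \<open>0\<close>. The polynomial factor
  makes the family closed under differentiation, so that smoothness is immediate.
\<close>

definition flat :: "real poly \<Rightarrow> real \<Rightarrow> real" where
  "flat p t = (if t > 0 then poly p (1 / t) * exp (- (1 / t)) else 0)"

lemma flat_tendsto_0: "(flat p \<longlongrightarrow> 0) (at 0)"
proof -
  have "((\<lambda>u. \<Sum>i\<le>degree p. coeff p i * (u ^ i / exp u)) \<longlongrightarrow> (\<Sum>i\<le>degree p. coeff p i * 0)) at_top"
    by (intro tendsto_intros tendsto_power_div_exp_0)
  then have "((\<lambda>u::real. poly p u * exp (- u)) \<longlongrightarrow> 0) at_top"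
    by (simp add: poly_altdef sum_distrib_right exp_minus divide_inverse mult.assoc)
  then have "((\<lambda>t::real. poly p (inverse t) * exp (- inverse t)) \<longlongrightarrow> 0) (at_right 0)"
    by (rule filterlim_compose[OF _ filterlim_inverse_at_top_right])
  then have r: "(flat p \<longlongrightarrow> 0) (at_right 0)"
    by (rule Lim_transform_eventually) (auto simp: flat_def eventually_at_filter inverse_eq_divide)
  have "((\<lambda>_. 0) \<longlongrightarrow> (0::real)) (at_left 0)" by simp
  then have l: "(flat p \<longlongrightarrow> 0) (at_left 0)"
    by (rule Lim_transform_eventually) (auto simp: flat_def eventually_at_filter)
  show ?thesis using l r by (simp add: filterlim_split_at)
qed

lemma flat_deriv: "(flat p has_real_derivative flat ([:0, 0, 1:] * (p - pderiv p)) t) (at t)"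
proof -
  consider "t > 0" | "t < 0" | "t = 0" by linarith
  then show ?thesis
  proof cases
    case 1
    have "((\<lambda>t. poly p (1 / t) * exp (- (1 / t))) has_real_derivative
       poly ([:0, 0, 1:] * (p - pderiv p)) (1 / t) * exp (- (1 / t))) (at t)"
      using 1 by (auto intro!: derivative_eq_intros DERIV_chain2[OF poly_DERIV]
          simp: field_simps power2_eq_square)
    then have "(flat p has_real_derivative poly ([:0, 0, 1:] * (p - pderiv p)) (1 / t) * exp (- (1 / t))) (at t)"
      by (rule has_field_derivative_transform_within_open[of _ _ _ "{0<..}"]) (use 1 in \<open>auto simp: flat_def\<close>)
    then show ?thesis using 1 by (simp add: flat_def)
  next
    case 2
    have "((\<lambda>t. 0) has_real_derivative 0) (at t)" by simp
    then have "(flat p has_real_derivative 0) (at t)"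
      by (rule has_field_derivative_transform_within_open[of _ _ _ "{..<0}"]) (use 2 in \<open>auto simp: flat_def\<close>)
    then show ?thesis using 2 by (simp add: flat_def)
  next
    case 3
    have "((\<lambda>h. (flat p (0 + h) - flat p 0) / h) \<longlongrightarrow> 0) (at 0)"
      (* Dividing by h multiplies the polynomial by its variable. *)
      using flat_tendsto_0[of "pCons 0 p"]
      by (rule Lim_transform_eventually) (auto simp: flat_def eventually_at_filter)
    then show ?thesis
      unfolding 3 DERIV_def by (simp add: flat_def)
  qed
qed

lemma ndiff_flat: "ndiff n (flat p)"
proof (induction n arbitrary: p)
  case (Suc n)
  then show ?case using flat_deriv by (intro ndiff_SucI)
qed simp

definition smooth_step :: "real \<Rightarrow> real" where
  "smooth_step t = flat 1 t * inverse (flat 1 t + flat 1 (1 - t))"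

lemma flat_1_pos: "flat 1 t + flat 1 (1 - t) \<noteq> 0"
  by (cases "t > 0") (auto simp: flat_def add_pos_nonneg less_imp_neq[symmetric]
      intro!: add_nonneg_pos[THEN less_imp_neq, THEN not_sym] add_pos_nonneg[THEN less_imp_neq, THEN not_sym])

lemma ndiff_smooth_step: "ndiff n smooth_step"
proof -
  have "ndiff n (\<lambda>t. flat 1 t * inverse (flat 1 t + flat 1 (1 - t)))"
    by (intro ndiff_mult ndiff_inverse ndiff_add ndiff_reflect ndiff_flat flat_1_pos)
  then show ?thesis by (simp add: smooth_step_def[abs_def])
qed

lemma smooth_step_eq: "t \<le> 0 \<Longrightarrow> smooth_step t = 0" "t \<ge> 1 \<Longrightarrow> smooth_step t = 1"
  using flat_1_pos[of t] by (auto simp: smooth_step_def flat_def)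

lemma smooth_step_derivs:
  "(((deriv ^^ n) smooth_step) has_real_derivative (deriv ^^ Suc n) smooth_step t) (at t)"
proof -
  have "ndiff m ((deriv ^^ n) smooth_step)" for m
  proof (induction n arbitrary: m)
    case (Suc n)
    show ?case using ndiff_deriv(2)[OF Suc.IH[of "Suc m"]] by simp
  qed (simp add: ndiff_smooth_step)
  from ndiff_deriv(1)[OF this] show ?thesis by simp
qed

lemma smooth_step_derivs_eq:
  "t \<le> 0 \<Longrightarrow> (deriv ^^ n) smooth_step t = 0"
  "t \<ge> 1 \<Longrightarrow> (deriv ^^ n) smooth_step t = (if n = 0 then 1 else 0)"
proof -
  have locally_const: "(deriv ^^ n) smooth_step t = (if n = 0 then c else 0)"
    if S: "open S" "\<And>t. t \<in> S \<Longrightarrow> smooth_step t = c" "t \<in> closure S" for S c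
  proof -
    have "(deriv ^^ n) smooth_step t = (if n = 0 then c else 0)" if "t \<in> S" for t
      using that
    proof (induction n arbitrary: t)
      case (Suc n)
      have "((\<lambda>_. if n = 0 then c else 0) has_real_derivative 0) (at t)"
        by simp
      then have "((deriv ^^ n) smooth_step has_real_derivative 0) (at t)"
        by (rule has_field_derivative_transform_within_open[OF _ S(1) Suc.prems]) (use Suc.IH in simp)
      then show ?case using smooth_step_derivs[of n t] DERIV_unique by fastforce
    qed (use S in auto)
    moreover have "continuous_on (closure S) ((deriv ^^ n) smooth_step)"
      using smooth_step_derivs by (intro DERIV_continuous_on) (rule DERIV_subset, auto)
    ultimately show ?thesis
      using S(3) continuous_constant_on_closure by blast
  qed
  show "t \<le> 0 \<Longrightarrow> (deriv ^^ n) smooth_step t = 0"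
    using locally_const[of "{..<0}" 0] smooth_step_eq by (simp split: if_splits)
  show "t \<ge> 1 \<Longrightarrow> (deriv ^^ n) smooth_step t = (if n = 0 then 1 else 0)"
    using locally_const[of "{1<..}" 1] smooth_step_eq by simp
qed

text \<open>
  The derivatives of a bump function supported in \<open>[-1, 1]\<close>. The bump function is the difference
  of two unit-spaced steps, so that its integer translates sum to \<open>1\<close> by telescoping.
\<close>

definition hat :: "nat \<Rightarrow> real \<Rightarrow> real" where
  "hat n t = (deriv ^^ n) smooth_step (t + 1) - (deriv ^^ n) smooth_step t"

lemma hat_deriv: "(hat n has_real_derivative hat (Suc n) t) (at t)"
proof -
  have "((\<lambda>t. (deriv ^^ n) smooth_step (t + 1)) has_real_derivative (deriv ^^ Suc n) smooth_step (t + 1)) (at t)"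
    using smooth_step_derivs[of n "t + 1"] by (simp only: DERIV_shift)
  from DERIV_diff[OF this smooth_step_derivs[of n t]] show ?thesis
    unfolding hat_def[abs_def] .
qed

lemma hat_eq_0: "\<bar>t\<bar> \<ge> 1 \<Longrightarrow> hat n t = 0"
  by (auto simp: hat_def smooth_step_derivs_eq abs_if split: if_splits)

lemma hat_partition: "0 \<le> t \<Longrightarrow> t < 1 \<Longrightarrow> hat n t + hat n (t - 1) = (if n = 0 then 1 else 0)"
  by (simp add: hat_def smooth_step_derivs_eq)

lemma continuous_on_hat: "continuous_on S (hat n)"
  using hat_deriv by (intro DERIV_continuous_on) (rule DERIV_subset, auto)

lemma hat_bounded: "\<exists>M. \<forall>t. \<bar>hat n t\<bar> \<le> M"
proof -
  have "bounded (hat n ` {-1..1})"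
    using compact_continuous_image[OF continuous_on_hat] compact_imp_bounded by blast
  then obtain M where M: "M > 0" "\<And>t. t \<in> {-1..1} \<Longrightarrow> \<bar>hat n t\<bar> \<le> M"
    by (auto simp: bounded_pos)
  have "\<bar>hat n t\<bar> \<le> M" for t
  proof (cases "\<bar>t\<bar> \<ge> 1")
    case False
    then have "t \<in> {-1..1}" unfolding atLeastAtMost_iff by linarith
    then show ?thesis by (rule M(2))
  qed (use M(1) hat_eq_0 in auto)
  then show ?thesis by blast
qed

definition hat_bound :: "nat \<Rightarrow> real" where
  "hat_bound n = (SOME M. \<forall>t. \<bar>hat n t\<bar> \<le> M)"

lemma hat_le_bound: "\<bar>hat n t\<bar> \<le> hat_bound n"
  using someI_ex[OF hat_bounded[of n]] unfolding hat_bound_def by blast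

text \<open>
  The derivative of multi-order \<open>c\<close> of the product bump function that belongs to the grid point
  \<open>r J\<close> of the grid of mesh \<open>r\<close>. Written in this way, the derivatives of a bump function need not
  be computed: they are read off from \<open>c\<close>.
\<close>

definition cell_bump :: "real \<Rightarrow> ('j::finite \<Rightarrow> int) \<Rightarrow> ('j \<Rightarrow> nat) \<Rightarrow> real ^ 'j \<Rightarrow> real" where
  "cell_bump r J c x = (1 / r) ^ (\<Sum>i\<in>UNIV. c i) * (\<Prod>i\<in>UNIV. hat (c i) (x $ i / r - of_int (J i)))"

lemma has_dir_deriv_realI:
  fixes f :: "'a::real_vector \<Rightarrow> real"
  assumes "((\<lambda>t. f (x + t *\<^sub>R v)) has_real_derivative D) (at 0)"
  shows "has_dir_deriv f v x D"
  using assms unfolding has_dir_deriv_def DERIV_def by (simp add: divide_inverse mult.commute)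

lemma cell_bump_deriv:
  assumes "r \<noteq> 0"
  shows "has_dir_deriv (cell_bump r J c) (axis j 1) x (cell_bump r J (c(j := Suc (c j))) x)"
proof (rule has_dir_deriv_realI)
  define R where "R = (\<Prod>i\<in>UNIV - {j}. hat (c i) (x $ i / r - of_int (J i)))"
  have split: "cell_bump r J c (x + t *\<^sub>R axis j 1) =
      (1 / r) ^ (\<Sum>i\<in>UNIV. c i) * R * hat (c j) ((x $ j + t) / r - of_int (J j))" for t
    unfolding cell_bump_def R_def
    by (subst prod.remove[of _ j]) (auto simp: axis_def intro!: prod.cong)
  have sum: "(\<Sum>i\<in>UNIV. (c(j := Suc (c j))) i) = Suc (\<Sum>i\<in>UNIV. c i)"
    by (subst (1 2) sum.remove[of _ j]) auto
  have "cell_bump r J (c(j := Suc (c j))) x =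
      (1 / r) ^ Suc (\<Sum>i\<in>UNIV. c i) * (hat (Suc (c j)) (x $ j / r - of_int (J j)) * R)"
    unfolding cell_bump_def R_def sum
    by (subst prod.remove[of _ j]) (auto intro!: prod.cong)
  also have "\<dots> = (1 / r) ^ (\<Sum>i\<in>UNIV. c i) * R * (hat (Suc (c j)) ((x $ j + 0) / r - of_int (J j)) * (1 / r))"
    by simp
  finally have eq: "cell_bump r J (c(j := Suc (c j))) x = \<dots>" .
  have "((\<lambda>t. (x $ j + t) / r - of_int (J j)) has_real_derivative 1 / r) (at 0)"
    using assms by (auto intro!: derivative_eq_intros)
  from DERIV_cmult[OF DERIV_chain2[OF hat_deriv this]]
  show "((\<lambda>t. cell_bump r J c (x + t *\<^sub>R axis j 1)) has_real_derivative cell_bump r J (c(j := Suc (c j))) x) (at 0)"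
    unfolding split eq .
qed

lemma continuous_on_cell_bump: "continuous_on S (cell_bump r J c)"
  unfolding cell_bump_def[abs_def] divide_inverse
  by (intro continuous_intros continuous_on_compose2[OF continuous_on_hat[of UNIV]]) auto

text \<open>
  Only the bump functions of these grid points can be nonzero at \<open>x\<close>.
\<close>

definition near_cells :: "real \<Rightarrow> real ^ 'j \<Rightarrow> ('j \<Rightarrow> int) set" where
  "near_cells r x = (\<Pi>\<^sub>E i\<in>UNIV. {\<lfloor>x $ i / r\<rfloor>, \<lfloor>x $ i / r\<rfloor> + 1})"

lemma near_cells_iff:
  assumes "J \<in> near_cells r x"
  shows "\<bar>x $ i / r - of_int (J i)\<bar> \<le> 1"
proof -
  have "J i \<in> {\<lfloor>x $ i / r\<rfloor>, \<lfloor>x $ i / r\<rfloor> + 1}"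
    using PiE_mem[OF assms[unfolded near_cells_def], of i] by simp
  then show ?thesis by (auto simp: abs_if) linarith+
qed

lemma cell_bump_eq_0:
  assumes "\<bar>x $ i / r - of_int (J i)\<bar> \<ge> 1"
  shows "cell_bump r J c x = 0"
  using hat_eq_0[OF assms] unfolding cell_bump_def by (auto intro!: prod_zero)

lemma cell_bump_not_near:
  assumes "J \<notin> near_cells r x"
  shows "cell_bump r J c x = 0"
proof -
  obtain i where "J i \<notin> {\<lfloor>x $ i / r\<rfloor>, \<lfloor>x $ i / r\<rfloor> + 1}"
    using assms by (auto simp: near_cells_def PiE_iff)
  then have "J i \<le> \<lfloor>x $ i / r\<rfloor> - 1 \<or> J i \<ge> \<lfloor>x $ i / r\<rfloor> + 2" by auto
  then have "\<bar>x $ i / r - of_int (J i)\<bar> \<ge> 1" by linarith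
  then show ?thesis by (rule cell_bump_eq_0)
qed

lemma finite_near_cells: "finite (near_cells r x)"
  unfolding near_cells_def by (intro finite_PiE) auto

lemma cell_bump_bound:
  assumes "r > 0"
  shows "\<bar>cell_bump r J c x\<bar> \<le> (1 / r) ^ (\<Sum>i\<in>UNIV. c i) * (\<Prod>i\<in>UNIV. hat_bound (c i))"
  unfolding cell_bump_def abs_mult abs_prod
  using assms by (intro mult_mono prod_mono prod_nonneg) (auto simp: hat_le_bound)

text \<open>
  The bound does not depend on the set \<open>G\<close>, because only boundedly many bump functions of a grid
  meet any given point.
\<close>

lemma sum_cell_bump_bound:
  fixes x :: "real ^ 'j"
  assumes "r > 0" "finite G"
  shows "\<bar>\<Sum>J\<in>G. cell_bump r J c x\<bar> \<le> 2 ^ CARD('j) * ((1 / r) ^ (\<Sum>i\<in>UNIV. c i) * (\<Prod>i\<in>UNIV. hat_bound (c i)))"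
    (is "_ \<le> _ * ?B")
proof -
  have "0 \<le> ?B"
    by (rule order_trans[OF abs_ge_zero cell_bump_bound[OF assms(1)]])
  have "(\<Sum>J\<in>G. cell_bump r J c x) = (\<Sum>J\<in>G \<inter> near_cells r x. cell_bump r J c x)"
    using assms(2) by (intro sum.mono_neutral_right) (auto simp: cell_bump_not_near)
  also have "\<bar>\<dots>\<bar> \<le> (\<Sum>J\<in>G \<inter> near_cells r x. \<bar>cell_bump r J c x\<bar>)"
    by (rule sum_abs)
  also have "\<dots> \<le> card (G \<inter> near_cells r x) * ?B"
    using cell_bump_bound[OF assms(1)] by (intro sum_bounded_above) auto
  also have "\<dots> \<le> card (near_cells r x) * ?B"
    using \<open>0 \<le> ?B\<close> finite_near_cells[of r x] by (intro mult_right_mono) (auto intro!: card_mono)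
  also have "card (near_cells r x) = 2 ^ CARD('j)"
    unfolding near_cells_def by (subst card_PiE) (auto simp: numeral_2_eq_2)
  finally show ?thesis by simp
qed

text \<open>
  The bump functions form a partition of unity, so their derivatives sum to zero. The sum over
  the nearby grid points factors into one-dimensional sums.
\<close>

lemma sum_near_cell_bumps:
  fixes x :: "real ^ 'j"
  shows "(\<Sum>J\<in>near_cells r x. cell_bump r J c x) = (if \<forall>i. c i = 0 then 1 else 0)"
proof -
  have "(\<Sum>J\<in>near_cells r x. cell_bump r J c x) = (1 / r) ^ (\<Sum>i\<in>UNIV. c i) *
    (\<Prod>i\<in>UNIV. \<Sum>j\<in>{\<lfloor>x $ i / r\<rfloor>, \<lfloor>x $ i / r\<rfloor> + 1}. hat (c i) (x $ i / r - of_int j))"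
    unfolding near_cells_def cell_bump_def
    by (subst prod_sum_PiE) (auto simp: sum_distrib_left)
  also have "(\<lambda>i. \<Sum>j\<in>{\<lfloor>x $ i / r\<rfloor>, \<lfloor>x $ i / r\<rfloor> + 1}. hat (c i) (x $ i / r - of_int j)) =
     (\<lambda>i. if c i = 0 then 1 else 0)"
  proof
    fix i
    have "(\<Sum>j\<in>{\<lfloor>x $ i / r\<rfloor>, \<lfloor>x $ i / r\<rfloor> + 1}. hat (c i) (x $ i / r - of_int j)) =
      hat (c i) (frac (x $ i / r)) + hat (c i) (frac (x $ i / r) - 1)"
      by (simp add: frac_def algebra_simps)
    then show "(\<Sum>j\<in>{\<lfloor>x $ i / r\<rfloor>, \<lfloor>x $ i / r\<rfloor> + 1}. hat (c i) (x $ i / r - of_int j)) = (if c i = 0 then 1 else 0)"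
      by (simp add: hat_partition frac_lt_1)
  qed
  also have "(1 / r) ^ (\<Sum>i\<in>UNIV. c i) * (\<Prod>i\<in>UNIV. if c i = 0 then 1 else 0) = (if \<forall>i. c i = 0 then 1 else (0::real))"
  proof (cases "\<forall>i. c i = 0")
    case False
    then have "(\<Prod>i\<in>UNIV. if c i = 0 then 1 else 0) = (0::real)"
      by (intro prod_zero) auto
    then show ?thesis using False by simp
  qed simp
  finally show ?thesis .
qed

text \<open>
  The bound on the derivatives is the one that scaling dictates for a transition from \<open>1\<close> to \<open>0\<close>
  within the width \<open>\<rho>\<close>. Besides coordinate directions the direction \<open>0\<close> is admitted: it is what the
  projection to one factor of a product makes of the directions of the other factor.
\<close>

definition cutoff :: "((real ^ 'j) list \<Rightarrow> real) \<Rightarrow> (real ^ 'j) set \<Rightarrow> real \<Rightarrow> real \<Rightarrow> (real ^ 'j \<Rightarrow> real) \<Rightarrow> bool" where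
  "cutoff C X \<rho> R h \<longleftrightarrow>
    (\<exists>K. compact K \<and> K \<subseteq> X \<and> (\<forall>x. x \<notin> K \<longrightarrow> h x = 0)) \<and>
    (\<forall>vs. set vs \<subseteq> insert 0 (range (\<lambda>j. axis j 1)) \<longrightarrow>
      iter_differentiable_on UNIV vs h \<and> continuous_on UNIV (iter_deriv vs h) \<and>
      (\<forall>x. 0 \<in> set vs \<longrightarrow> iter_deriv vs h x = 0) \<and>
      (\<forall>x. \<bar>iter_deriv vs h x\<bar> \<le> C vs * (1 / \<rho>) ^ length vs) \<and>
      (\<forall>x\<in>X - collar \<rho> X. (\<forall>i. \<bar>x $ i\<bar> \<le> R) \<longrightarrow> iter_deriv vs h x = (if vs = [] then 1 else 0)))"

text \<open>
  The iterated derivative in the directions \<open>vs\<close> of the sum of all bump functions over \<open>G\<close>; the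
  sum itself is the case of the empty list.
\<close>

definition grid_cutoff :: "real \<Rightarrow> ('j::finite \<Rightarrow> int) set \<Rightarrow> (real ^ 'j) list \<Rightarrow> real ^ 'j \<Rightarrow> real" where
  "grid_cutoff r G vs x = (if 0 \<in> set vs then 0 else \<Sum>J\<in>G. cell_bump r J (\<lambda>i. count_list vs (axis i 1)) x)"

lemma grid_cutoff_deriv:
  fixes v :: "real ^ 'j"
  assumes r: "r \<noteq> 0" and v: "v \<in> insert 0 (range (\<lambda>j. axis j 1))"
  shows "has_dir_deriv (grid_cutoff r G vs) v x (grid_cutoff r G (v # vs) x)"
proof -
  consider "0 \<in> set vs" | "v = 0" | j where "v = axis j 1" "0 \<notin> set vs" using v by auto
  then show ?thesis
  proof cases
    case 3
    define c where "c = (\<lambda>i. count_list vs (axis i 1))"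
    have c: "(\<lambda>i. count_list (v # vs) (axis i 1)) = c(j := Suc (c j))"
      using 3 by (auto simp: fun_eq_iff axis_eq_axis c_def)
    have ne: "0 \<notin> set (v # vs)" using 3 by (auto simp: axis_eq_0_iff)
    have "((\<lambda>t. \<Sum>J\<in>G. (1 / t) *\<^sub>R (cell_bump r J c (x + t *\<^sub>R v) - cell_bump r J c x)) \<longlongrightarrow>
      (\<Sum>J\<in>G. cell_bump r J (c(j := Suc (c j))) x)) (at 0)"
      using cell_bump_deriv[OF r] unfolding has_dir_deriv_def 3(1) by (intro tendsto_sum) auto
    then have "has_dir_deriv (\<lambda>x. \<Sum>J\<in>G. cell_bump r J c x) v x (\<Sum>J\<in>G. cell_bump r J (c(j := Suc (c j))) x)"
      unfolding has_dir_deriv_def by (simp add: sum_subtractf sum_divide_distrib diff_divide_distrib)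
    then show ?thesis
      using ne 3(2) unfolding grid_cutoff_def[abs_def] c c_def[symmetric] by simp
  qed (auto simp: grid_cutoff_def[abs_def] has_dir_deriv_def)
qed

lemma iter_deriv_grid_cutoff:
  fixes vs :: "(real ^ 'j) list"
  assumes r: "r \<noteq> 0" and vs: "set vs \<subseteq> insert 0 (range (\<lambda>j. axis j 1))"
  shows "iter_differentiable_on UNIV vs (grid_cutoff r G []) \<and> iter_deriv vs (grid_cutoff r G []) = grid_cutoff r G vs"
  using vs
proof (induction vs)
  case (Cons v vs)
  then have IH: "iter_differentiable_on UNIV vs (grid_cutoff r G [])" "iter_deriv vs (grid_cutoff r G []) = grid_cutoff r G vs"
    by auto
  have "has_dir_deriv (grid_cutoff r G vs) v x (grid_cutoff r G (v # vs) x)" for x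
    using Cons.prems by (intro grid_cutoff_deriv r) auto
  then have "has_dir_deriv (iter_deriv vs (grid_cutoff r G [])) v x (grid_cutoff r G (v # vs) x)" for x
    by (simp add: IH(2))
  then show ?case using IH(1) by (auto simp: fun_eq_iff dir_deriv_eqI)
qed simp

lemma sum_count_axis:
  assumes "set vs \<subseteq> range (\<lambda>j. axis j (1::real))"
  shows "(\<Sum>i\<in>UNIV. count_list vs (axis i 1)) = length vs"
proof -
  have "(\<Sum>i\<in>UNIV. count_list vs (axis i 1)) = (\<Sum>v\<in>range (\<lambda>i. axis i (1::real)). count_list vs v)"
    by (subst sum.reindex) (auto simp: inj_on_def axis_eq_axis)
  also have "\<dots> = length vs"
    by (rule sum_count_set[OF assms]) simp
  finally show ?thesis .
qed

definition cell :: "real \<Rightarrow> ('j::finite \<Rightarrow> int) \<Rightarrow> (real ^ 'j) set" where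
  "cell r J = {x. \<forall>i. \<bar>x $ i / r - of_int (J i)\<bar> \<le> 1}"

lemma compact_cell:
  assumes "r > 0"
  shows "compact (cell r J)"
proof -
  have "cell r J = cbox (\<chi> i. r * (of_int (J i) - 1)) (\<chi> i. r * (of_int (J i) + 1))"
    using assms by (auto simp: cell_def mem_box_cart abs_le_iff field_simps)
  then show ?thesis by simp
qed

text \<open>
  The cutoff function is the sum of those bump functions of a grid of mesh proportional to \<open>\<rho>\<close>
  whose cells lie in \<open>X\<close> and in a large cube. Its derivatives are controlled by the number of
  bump functions that overlap at a point, whatever the shape of \<open>X\<close>, so that the constants
  \<open>C\<close> are the same for all \<open>X\<close>, \<open>\<rho>\<close> and \<open>R\<close>.
\<close>

lemma exists_cutoff:
  "\<exists>C. \<forall>X \<rho> R. \<rho> > 0 \<longrightarrow> (\<exists>h. cutoff C (X :: (real ^ 'j) set) \<rho> R h)"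
proof -
  (* Two points of one cell differ by at most 2 r in each coordinate, hence by n r in the
     1-norm, so the points of X in a cell that meets the complement of X lie in the collar of
     width n r. *)
  define n where "n = real (2 * CARD('j))"
  have n: "n > 0" unfolding n_def by simp
  define C where "C = (\<lambda>vs :: (real ^ 'j) list. 2 ^ CARD('j) * n ^ length vs * (\<Prod>i\<in>UNIV. hat_bound (count_list vs (axis i 1))))"
  have C: "C vs \<ge> 0" for vs
    unfolding C_def using n order_trans[OF abs_ge_zero hat_le_bound] by (intro mult_nonneg_nonneg prod_nonneg) auto
  have "\<exists>h. cutoff C X \<rho> R h" if \<rho>: "\<rho> > 0" for X :: "(real ^ 'j) set" and \<rho> R :: real
  proof -
    define r where "r = \<rho> / n"
    have r: "r > 0" using \<rho> n by (simp add: r_def)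
    define G where "G = {J. cell r J \<subseteq> X \<and> (\<forall>i. \<bar>r * of_int (J i)\<bar> \<le> R + r)}"
    have "G \<subseteq> (\<Pi>\<^sub>E i\<in>UNIV. {- \<lceil>(R + r) / r\<rceil>..\<lceil>(R + r) / r\<rceil>})"
    proof
      fix J assume "J \<in> G"
      then have "\<bar>r * of_int (J i)\<bar> \<le> R + r" for i by (simp add: G_def)
      then have "\<bar>of_int (J i)\<bar> \<le> (R + r) / r" for i
        using r by (simp add: abs_mult field_simps)
      then have "\<bar>J i\<bar> \<le> \<lceil>(R + r) / r\<rceil>" for i
        using le_of_int_ceiling[of "(R + r) / r"] by (metis of_int_abs of_int_le_iff order_trans)
      then show "J \<in> (\<Pi>\<^sub>E i\<in>UNIV. {- \<lceil>(R + r) / r\<rceil>..\<lceil>(R + r) / r\<rceil>})"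
        by (auto simp: PiE_iff abs_le_iff) (metis minus_le_iff)
    qed
    moreover have "finite (\<Pi>\<^sub>E i\<in>(UNIV::'j set). {- \<lceil>(R + r) / r\<rceil>..\<lceil>(R + r) / r\<rceil>})"
      by (intro finite_PiE) auto
    ultimately have G: "finite G" by (rule finite_subset)
    have near: "near_cells r x \<subseteq> G" if x: "x \<in> X" "x \<notin> collar \<rho> X" "\<forall>i. \<bar>x $ i\<bar> \<le> R" for x
    proof
      fix J assume J: "J \<in> near_cells r x"
      have x_J: "\<bar>x $ i - r * of_int (J i)\<bar> \<le> r" for i
      proof -
        have "x $ i - r * of_int (J i) = r * (x $ i / r - of_int (J i))"
          using r by (simp add: field_simps)
        then show ?thesis
          using mult_left_mono[OF near_cells_iff[OF J, of i], of r] r by (simp add: abs_mult)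
      qed
      have "z \<in> X" if "z \<in> cell r J" for z
      proof (rule ccontr)
        assume "z \<notin> X"
        have "\<bar>z $ i - x $ i\<bar> \<le> 2 * r" for i
        proof -
          have "\<bar>z $ i / r - of_int (J i)\<bar> \<le> 1" using that by (simp add: cell_def)
          then have "\<bar>r * (z $ i / r - of_int (J i))\<bar> \<le> r"
            using mult_left_mono[of _ 1 r] r by (simp add: abs_mult)
          then have "\<bar>z $ i - r * of_int (J i)\<bar> \<le> r" using r by (simp add: right_diff_distrib)
          then show ?thesis using x_J[of i] by linarith
        qed
        then have "l1_norm (z - x) \<le> of_nat CARD('j) * (2 * r)"
          unfolding l1_norm_def using sum_bounded_above[of UNIV "\<lambda>i. \<bar>(z - x) $ i\<bar>" "2 * r"] by simp
        also have "\<dots> = \<rho>" using n by (simp add: r_def n_def)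
        finally show False using x \<open>z \<notin> X\<close> by (auto simp: collar_def)
      qed
      moreover have "\<bar>r * of_int (J i)\<bar> \<le> R + r" for i
        using x_J[of i] x(3)[rule_format, of i] by linarith
      ultimately show "J \<in> G" by (auto simp: G_def)
    qed
    define h where "h = grid_cutoff r G []"
    note deriv = iter_deriv_grid_cutoff[of r, where G = G, folded h_def]
    show "\<exists>h. cutoff C X \<rho> R h"
      unfolding cutoff_def
    proof (intro exI[of _ h] conjI allI impI)
      show "\<exists>K. compact K \<and> K \<subseteq> X \<and> (\<forall>x. x \<notin> K \<longrightarrow> h x = 0)"
      proof (intro exI[of _ "\<Union>J\<in>G. cell r J"] conjI allI impI)
        show "compact (\<Union>J\<in>G. cell r J)" using G compact_cell[OF r] by (intro compact_UN) auto
        show "(\<Union>J\<in>G. cell r J) \<subseteq> X" by (auto simp: G_def)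
        fix x assume x: "x \<notin> (\<Union>J\<in>G. cell r J)"
        have "cell_bump r J (\<lambda>i. 0) x = 0" if "J \<in> G" for J
        proof -
          have "x \<notin> cell r J" using x that by simp
          then obtain i where "\<not> \<bar>x $ i / r - of_int (J i)\<bar> \<le> 1"
            unfolding cell_def mem_Collect_eq not_all by (rule exE)
          then show ?thesis by (intro cell_bump_eq_0[of x i]) simp
        qed
        then show "h x = 0" by (simp add: h_def grid_cutoff_def)
      qed
    next
      fix vs :: "(real ^ 'j) list"
      assume vs: "set vs \<subseteq> insert 0 (range (\<lambda>j. axis j 1))"
      have D: "iter_deriv vs h = grid_cutoff r G vs" and diff: "iter_differentiable_on UNIV vs h"
        using deriv[OF _ vs] r by auto
      show "iter_differentiable_on UNIV vs h" by (rule diff)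
      show "iter_deriv vs h x = 0" if "0 \<in> set vs" for x
        using that by (simp add: D grid_cutoff_def)
      show "continuous_on UNIV (iter_deriv vs h)"
        unfolding D grid_cutoff_def[abs_def]
        by (cases "0 \<in> set vs") (auto intro!: continuous_on_sum continuous_on_cell_bump)
      have len: "(\<Sum>i\<in>UNIV. count_list vs (axis i 1)) = length vs" if "0 \<notin> set vs"
        using vs that by (intro sum_count_axis) auto
      show "\<bar>iter_deriv vs h x\<bar> \<le> C vs * (1 / \<rho>) ^ length vs" for x
      proof (cases "0 \<in> set vs")
        case True
        then show ?thesis using C[of vs] \<rho> by (simp add: D grid_cutoff_def)
      next
        case False
        have "1 / r = n * (1 / \<rho>)" by (simp add: r_def)
        then show ?thesis
          using sum_cell_bump_bound[OF r G, of "\<lambda>i. count_list vs (axis i 1)" x] False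
          unfolding D grid_cutoff_def len[OF False] C_def
          by (simp only: power_mult_distrib if_False mult_ac)
      qed
      show "\<forall>x\<in>X - collar \<rho> X. (\<forall>i. \<bar>x $ i\<bar> \<le> R) \<longrightarrow> iter_deriv vs h x = (if vs = [] then 1 else 0)"
      proof (intro ballI impI)
        fix x assume x: "x \<in> X - collar \<rho> X" "\<forall>i. \<bar>x $ i\<bar> \<le> R"
        show "iter_deriv vs h x = (if vs = [] then 1 else 0)"
        proof (cases "0 \<in> set vs")
          case True
          then show ?thesis by (auto simp: D grid_cutoff_def)
        next
          case False
          have "(\<Sum>J\<in>G. cell_bump r J (\<lambda>i. count_list vs (axis i 1)) x) =
              (\<Sum>J\<in>near_cells r x. cell_bump r J (\<lambda>i. count_list vs (axis i 1)) x)"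
            using near[of x] x G by (intro sum.mono_neutral_right) (auto simp: cell_bump_not_near)
          also have "\<dots> = (if \<forall>i. count_list vs (axis i (1::real)) = 0 then 1 else 0)"
            by (rule sum_near_cell_bumps)
          also have "(\<forall>i. count_list vs (axis i (1::real)) = 0) \<longleftrightarrow> vs = []"
            using len[OF False] by auto
          finally show ?thesis using False by (simp add: D grid_cutoff_def)
        qed
      qed
    qed
  qed
  then show ?thesis by blast
qed

section \<open>Cutting off in one block of coordinates\<close>

lemma eventually_collar_disjoint:
  assumes "compact K" "open X" "K \<subseteq> X"
  shows "\<forall>\<^sub>F \<rho> in at_right 0. collar \<rho> X \<inter> K = {}"
proof -
  obtain \<delta> where \<delta>: "\<delta> > 0" "(\<Union>x\<in>K. ball x \<delta>) \<subseteq> X"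
    using compact_subset_open_imp_ball_epsilon_subset[OF assms] by blast
  have "collar \<rho> X \<inter> K = {}" if "\<rho> < \<delta>" for \<rho>
  proof (rule ccontr)
    assume "collar \<rho> X \<inter> K \<noteq> {}"
    then obtain x y where x: "x \<in> K" "y \<notin> X" "l1_norm (y - x) \<le> \<rho>"
      by (auto simp: collar_def)
    then have "dist x y < \<delta>"
      using norm_le_l1_norm[of "y - x"] that by (simp add: dist_norm norm_minus_commute)
    then have "y \<in> ball x \<delta>" by simp
    then show False using x \<delta>(2) by blast
  qed
  then show ?thesis
    using \<delta>(1) by (auto simp: eventually_at_right_field)
qed

lemma eventually_bounded_coords:
  fixes K :: "(real ^ 'j) set"
  assumes "compact K"
  shows "\<forall>\<^sub>F R in at_top. \<forall>x\<in>K. \<forall>i. \<bar>x $ i\<bar> \<le> R"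
proof -
  obtain M where M: "\<forall>x\<in>K. norm x \<le> M"
    using compact_imp_bounded[OF assms] by (auto simp: bounded_iff)
  show ?thesis
    using eventually_ge_at_top[of M]
  proof eventually_elim
    case (elim R)
    have "\<bar>x $ i\<bar> \<le> R" if "x \<in> K" for x i
      using component_le_norm_cart[of x i] bspec[OF M that] elim by linarith
    then show ?case by blast
  qed
qed

text \<open>
  The predicate \<open>adm\<close> is meant to count directions, at most \<open>k\<close> of them in the block:
  hence it passes to sublists and permutations, and directions of the block may be exchanged for
  one another.
\<close>

locale regular_on_block = seminorm_block Q emb pr \<Omega> X
  for Q :: "('e::{real_vector,t2_space} \<Rightarrow> real) set"
  and emb :: "real ^ 'j \<Rightarrow> 'p::real_normed_vector" and pr \<Omega> X +
  fixes \<gamma> :: "'p \<Rightarrow> 'e" and adm :: "'p list \<Rightarrow> bool" and k :: enat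
  assumes adm_sub: "adm vs \<Longrightarrow> mset ws \<subseteq># mset vs \<Longrightarrow> adm ws"
    and adm_dirs: "adm vs \<Longrightarrow> v \<in> set vs \<Longrightarrow> v \<in> range (\<lambda>j. emb (axis j 1)) \<or> pr v = 0"
    and adm_replace: "adm (as @ vs) \<Longrightarrow> set as \<subseteq> range (\<lambda>j. emb (axis j 1)) \<Longrightarrow>
      set bs \<subseteq> range (\<lambda>j. emb (axis j 1)) \<Longrightarrow> length bs = length as \<Longrightarrow> adm (bs @ vs)"
    and adm_length: "adm vs \<Longrightarrow> set vs \<subseteq> range (\<lambda>j. emb (axis j 1)) \<Longrightarrow> enat (length vs) \<le> k"
    and diff_\<gamma>: "adm vs \<Longrightarrow> iter_differentiable_on \<Omega> vs \<gamma>"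
    and cont_\<gamma>: "adm vs \<Longrightarrow> continuous_on \<Omega> (iter_deriv vs \<gamma>)"
begin

abbreviation axes :: "(real ^ 'j) set" where "axes \<equiv> range (\<lambda>j. axis j 1)"

lemma adm_splits:
  assumes "adm vs" "(as, bs) \<in> set (splits vs)"
  shows "adm as" "adm bs"
  using adm_sub[OF assms(1)] mset_splits[OF assms(2)] by auto

lemma adm_pr:
  assumes "adm vs"
  shows "set (map pr vs) \<subseteq> insert 0 axes"
proof
  fix x assume "x \<in> set (map pr vs)"
  then obtain v where v: "v \<in> set vs" "x = pr v" by auto
  then show "x \<in> insert 0 axes"
    using adm_dirs[OF assms v(1)] by (auto simp: pr_emb)
qed

lemma iter_deriv_cutoff_pr:
  assumes h: "cutoff C X \<rho> R h" and as: "adm as"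
  shows "iter_differentiable_on \<Omega> as (\<lambda>p. h (pr p))"
    and "p \<in> \<Omega> \<Longrightarrow> iter_deriv as (\<lambda>p. h (pr p)) p = iter_deriv (map pr as) h (pr p)"
proof -
  have "iter_differentiable_on UNIV (map pr as) h"
    using h adm_pr[OF as] unfolding cutoff_def by blast
  from iter_deriv_compose_linear[OF linear_pr this _ open_\<Omega>]
  show "iter_differentiable_on \<Omega> as (\<lambda>p. h (pr p))"
    and "p \<in> \<Omega> \<Longrightarrow> iter_deriv as (\<lambda>p. h (pr p)) p = iter_deriv (map pr as) h (pr p)"
    by auto
qed

lemma iter_deriv_cutoff_scaleR:
  assumes h: "cutoff C X \<rho> R h" and vs: "adm vs"
  shows "iter_differentiable_on \<Omega> vs (\<lambda>p. h (pr p) *\<^sub>R \<gamma> p)"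
    and "p \<in> \<Omega> \<Longrightarrow> iter_deriv vs (\<lambda>p. h (pr p) *\<^sub>R \<gamma> p) p =
      (\<Sum>(as, bs)\<leftarrow>splits vs. iter_deriv (map pr as) h (pr p) *\<^sub>R iter_deriv bs \<gamma> p)"
proof -
  have "iter_differentiable_on \<Omega> as (\<lambda>p. h (pr p)) \<and> iter_differentiable_on \<Omega> bs \<gamma>"
    if "(as, bs) \<in> set (splits vs)" for as bs
    using adm_splits[OF vs that] iter_deriv_cutoff_pr(1)[OF h] diff_\<gamma> by blast
  note leib = iter_deriv_scaleR[OF open_\<Omega> this]
  show "iter_differentiable_on \<Omega> vs (\<lambda>p. h (pr p) *\<^sub>R \<gamma> p)"
    using leib by blast
  assume p: "p \<in> \<Omega>"
  have "iter_deriv vs (\<lambda>p. h (pr p) *\<^sub>R \<gamma> p) p =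
      (\<Sum>(as, bs)\<leftarrow>splits vs. iter_deriv as (\<lambda>p. h (pr p)) p *\<^sub>R iter_deriv bs \<gamma> p)"
    using leib p by blast
  also have "\<dots> = (\<Sum>(as, bs)\<leftarrow>splits vs. iter_deriv (map pr as) h (pr p) *\<^sub>R iter_deriv bs \<gamma> p)"
    using adm_splits(1)[OF vs] iter_deriv_cutoff_pr(2)[OF h _ p]
    by (intro arg_cong[where f = sum_list] map_cong) auto
  finally show "iter_deriv vs (\<lambda>p. h (pr p) *\<^sub>R \<gamma> p) p =
      (\<Sum>(as, bs)\<leftarrow>splits vs. iter_deriv (map pr as) h (pr p) *\<^sub>R iter_deriv bs \<gamma> p)" .
qed

lemma continuous_on_iter_deriv_cutoff_scaleR:
  assumes h: "cutoff C X \<rho> R h" and vs: "adm vs"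
  shows "continuous_on \<Omega> (iter_deriv vs (\<lambda>p. h (pr p) *\<^sub>R \<gamma> p))"
proof -
  have "continuous_on \<Omega> (\<lambda>p. \<Sum>z\<leftarrow>splits vs. iter_deriv (map pr (fst z)) h (pr p) *\<^sub>R iter_deriv (snd z) \<gamma> p)"
  proof (rule continuous_on_sum_list_Q)
    fix z assume "z \<in> set (splits vs)"
    then have z: "adm (fst z)" "adm (snd z)"
      using adm_splits[OF vs, of "fst z" "snd z"] by auto
    have "continuous_on UNIV (iter_deriv (map pr (fst z)) h)"
      using h adm_pr[OF z(1)] unfolding cutoff_def by blast
    then have "continuous_on \<Omega> (\<lambda>p. iter_deriv (map pr (fst z)) h (pr p))"
      using continuous_on_compose2[OF _ continuous_on_pr] by blast
    then show "continuous_on \<Omega> (\<lambda>p. iter_deriv (map pr (fst z)) h (pr p) *\<^sub>R iter_deriv (snd z) \<gamma> p)"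
      by (rule continuous_on_scaleR_Q[OF _ cont_\<gamma>[OF z(2)]])
  qed
  then show ?thesis
    by (rule continuous_on_eq) (use iter_deriv_cutoff_scaleR(2)[OF h vs] in \<open>simp add: case_prod_unfold\<close>)
qed

lemma seminorm_iter_deriv_cutoff_scaleR:
  assumes h: "cutoff C X \<rho> R h" and vs: "adm vs" and q: "q \<in> Q" and p: "p \<in> \<Omega>"
  shows "q (iter_deriv vs (\<lambda>p. h (pr p) *\<^sub>R \<gamma> p) p) \<le>
     (\<Sum>(as, bs)\<leftarrow>splits vs. C (map pr as) * (1 / \<rho>) ^ length as * q (iter_deriv bs \<gamma> p))"
proof -
  have "q (iter_deriv vs (\<lambda>p. h (pr p) *\<^sub>R \<gamma> p) p) \<le>
      (\<Sum>(as, bs)\<leftarrow>splits vs. q (iter_deriv (map pr as) h (pr p) *\<^sub>R iter_deriv bs \<gamma> p))"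
    unfolding iter_deriv_cutoff_scaleR(2)[OF h vs p]
    using Q_sum_list[OF q, of "map (\<lambda>(as, bs). iter_deriv (map pr as) h (pr p) *\<^sub>R iter_deriv bs \<gamma> p) (splits vs)"]
    by (simp add: comp_def case_prod_unfold)
  also have "\<dots> \<le> (\<Sum>(as, bs)\<leftarrow>splits vs. C (map pr as) * (1 / \<rho>) ^ length as * q (iter_deriv bs \<gamma> p))"
  proof (intro sum_list_mono, clarify)
    fix as bs assume "(as, bs) \<in> set (splits vs)"
    then have "set (map pr as) \<subseteq> insert 0 axes" using adm_pr adm_splits[OF vs] by blast
    then have "\<bar>iter_deriv (map pr as) h (pr p)\<bar> \<le> C (map pr as) * (1 / \<rho>) ^ length (map pr as)"
      using h unfolding cutoff_def by blast
    then show "q (iter_deriv (map pr as) h (pr p) *\<^sub>R iter_deriv bs \<gamma> p) \<le>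
        C (map pr as) * (1 / \<rho>) ^ length as * q (iter_deriv bs \<gamma> p)"
      unfolding Q_scale[OF q] using Q_nonneg[OF q] by (intro mult_right_mono) auto
  qed
  finally show ?thesis .
qed

text \<open>
  The heart of the proof. By the Leibniz rule the error is a sum of terms in which \<open>a\<close> of the
  derivatives fall on \<open>h - 1\<close>. Such a term lives in the collar of width \<open>\<rho>\<close> or outside the cube of
  size \<open>R\<close>, and the derivative of \<open>h\<close> is of size \<open>1 / \<rho>\<^sup>a\<close>. In the collar the remaining factor is
  of size \<open>\<rho>\<^sup>a\<close> by the Taylor estimate at the boundary, with a constant that is small for small
  \<open>\<rho>\<close>. Outside the cube the boundary may be far away, but \<open>R\<close> may be chosen after \<open>\<rho>\<close>, and the
  remaining factor tends to zero for large \<open>R\<close>. The nested filters express this order of choices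
  and allow finitely many such estimates to be met by one cutoff function.
\<close>

lemma eventually_cutoff_close:
  fixes F :: "real ^ 'j \<Rightarrow> real" and w :: "'p \<Rightarrow> real"
  defines "T q as us p \<equiv> \<bar>iter_deriv as F (pr p)\<bar> * w p * q (iter_deriv us \<gamma> p)"
  assumes q: "q \<in> Q" and w: "\<And>p. 0 \<le> w p" "\<And>p s. w (p + emb s) = w p"
    and diff_F: "\<And>as. set as \<subseteq> axes \<Longrightarrow> enat (length as) \<le> k \<Longrightarrow> iter_differentiable_on X as F"
    and van: "\<And>as us. set as \<subseteq> axes \<Longrightarrow> enat (length as) \<le> k \<Longrightarrow> adm us \<Longrightarrow>
      vanishing_over \<Omega> pr X (T q as us)"
    and \<epsilon>: "\<epsilon> > 0" and vs: "adm vs"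
  shows "\<forall>\<^sub>F \<rho> in at_right 0. \<forall>\<^sub>F R in at_top. \<forall>h. cutoff C X \<rho> R h \<longrightarrow>
    (\<forall>p\<in>\<Omega>. \<bar>F (pr p)\<bar> * w p * q (iter_deriv vs (\<lambda>p. h (pr p) *\<^sub>R \<gamma> p - \<gamma> p) p) \<le> \<epsilon>)"
proof -
  define L where "L = length vs"
  define cf where "cf as = (\<bar>C (map pr as)\<bar> + 1) * 2 ^ length as" for as
  define M where "M = (\<Sum>(as, bs)\<leftarrow>splits vs. cf as)"
  have cf: "cf as \<ge> 0" for as unfolding cf_def by simp
  have M: "M \<ge> 0" unfolding M_def by (intro sum_list_nonneg) (auto simp: cf)
  define e where "e = \<epsilon> / (M + 1)"
  have e: "e > 0" "M * e \<le> \<epsilon>" using \<epsilon> M by (auto simp: e_def field_simps)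
  define Us where "Us = {us. set us \<subseteq> set vs \<union> range edir \<and> length us \<le> L} \<inter> {us. adm us}"
  define As where "As = {as. set as \<subseteq> axes \<and> length as \<le> L} \<inter> {as. enat (length as) \<le> k}"
  have fin: "finite Us" "finite As"
    unfolding Us_def As_def by (intro finite_Int disjI1 finite_lists_length_le, simp)+
  have "\<forall>\<^sub>F \<rho> in at_right 0. \<forall>p\<in>\<Omega>. pr p \<in> collar \<rho> X \<longrightarrow> T q as us p \<le> e"
    if "as \<in> As" "us \<in> Us" for as us
  proof -
    have "vanishing_over \<Omega> pr X (T q as us)"
      using that by (intro van) (auto simp: As_def Us_def)
    from vanishing_overD[OF this e(1)]
    obtain K where K: "compact K" "K \<subseteq> X" "\<forall>p\<in>\<Omega>. pr p \<notin> K \<longrightarrow> T q as us p \<le> e"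
      by auto
    show ?thesis
      using eventually_collar_disjoint[OF K(1) open_X K(2)] by eventually_elim (use K(3) in auto)
  qed
  then have "\<forall>\<^sub>F \<rho> in at_right 0. \<forall>as\<in>As. \<forall>us\<in>Us. \<forall>p\<in>\<Omega>. pr p \<in> collar \<rho> X \<longrightarrow> T q as us p \<le> e"
    by (intro eventually_ball_finite[OF fin(2)] eventually_ball_finite[OF fin(1)] ballI)
  moreover have "\<forall>\<^sub>F \<rho>::real in at_right 0. 0 < \<rho> \<and> \<rho> < 1"
    using eventually_at_right_real[of 0 1] by (rule eventually_mono) auto
  ultimately show ?thesis
  proof eventually_elim
    case (elim \<rho>)
    then have \<rho>: "0 < \<rho>" "\<rho> < 1" by auto
    (* The factor \<rho>^L compensates the growth of at most L derivatives of the cutoff function. *)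
    have "\<forall>\<^sub>F R in at_top. \<forall>p\<in>\<Omega>. (\<exists>i. \<bar>pr p $ i\<bar> > R) \<longrightarrow> T q [] us p \<le> e * \<rho> ^ L"
      if "us \<in> Us" for us
    proof -
      have pos: "e * \<rho> ^ L > 0" using e(1) \<rho> by simp
      have "vanishing_over \<Omega> pr X (T q [] us)"
        using that by (intro van) (auto simp: Us_def zero_enat_def[symmetric])
      from vanishing_overD[OF this pos]
      obtain K where K: "compact K" "\<forall>p\<in>\<Omega>. pr p \<notin> K \<longrightarrow> T q [] us p \<le> e * \<rho> ^ L"
        by auto
      show ?thesis
        using eventually_bounded_coords[OF K(1)] by eventually_elim (use K(2) in \<open>force simp: not_le[symmetric]\<close>)
    qed
    then have "\<forall>\<^sub>F R in at_top. \<forall>us\<in>Us. \<forall>p\<in>\<Omega>. (\<exists>i. \<bar>pr p $ i\<bar> > R) \<longrightarrow> T q [] us p \<le> e * \<rho> ^ L"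
      by (intro eventually_ball_finite[OF fin(1)] ballI)
    then show ?case
    proof eventually_elim
      case far: (elim R)
      show ?case
      proof (intro allI impI ballI)
        fix h p assume h: "cutoff C X \<rho> R h" and p: "p \<in> \<Omega>"
        define D where "D as = iter_deriv (map pr as) (\<lambda>x. h x - 1) (pr p)" for as
        have D_bound: "\<bar>D as\<bar> \<le> (\<bar>C (map pr as)\<bar> + 1) * (1 / \<rho>) ^ length as"
          and D_zero: "pr p \<notin> collar \<rho> X \<Longrightarrow> \<forall>i. \<bar>pr p $ i\<bar> \<le> R \<Longrightarrow> D as = 0"
          and D_zero_dir: "0 \<in> set (map pr as) \<Longrightarrow> D as = 0"
          if "adm as" for as
        proof -
          have as: "set (map pr as) \<subseteq> insert 0 axes" using adm_pr that by blast
          have hD: "\<bar>iter_deriv (map pr as) h (pr p)\<bar> \<le> C (map pr as) * (1 / \<rho>) ^ length (map pr as)"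
            using h as unfolding cutoff_def by blast
          have eq: "D as = (if as = [] then h (pr p) - 1 else iter_deriv (map pr as) h (pr p))"
            by (simp add: D_def iter_deriv_minus_const)
          show "\<bar>D as\<bar> \<le> (\<bar>C (map pr as)\<bar> + 1) * (1 / \<rho>) ^ length as"
          proof (cases "as = []")
            case True
            then show ?thesis using hD eq by simp
          next
            case False
            have "C (map pr as) * (1 / \<rho>) ^ length as \<le> (\<bar>C (map pr as)\<bar> + 1) * (1 / \<rho>) ^ length as"
              using \<rho> by (intro mult_right_mono) auto
            then show ?thesis using hD eq False by simp
          qed
          show "pr p \<notin> collar \<rho> X \<Longrightarrow> \<forall>i. \<bar>pr p $ i\<bar> \<le> R \<Longrightarrow> D as = 0"
          proof -
            assume "pr p \<notin> collar \<rho> X" "\<forall>i. \<bar>pr p $ i\<bar> \<le> R"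
            then have "iter_deriv (map pr as) h (pr p) = (if map pr as = [] then 1 else 0)"
              using h as pr_\<Omega>[OF p] unfolding cutoff_def by blast
            then show ?thesis using eq by (simp split: if_splits)
          qed
          show "0 \<in> set (map pr as) \<Longrightarrow> D as = 0"
          proof -
            assume z: "0 \<in> set (map pr as)"
            then have "iter_deriv (map pr as) h (pr p) = 0"
              using h as unfolding cutoff_def by blast
            then show ?thesis using eq z by auto
          qed
        qed
        have D_pr: "iter_differentiable_on \<Omega> as (\<lambda>p. h (pr p) - 1) \<and>
            iter_deriv as (\<lambda>p. h (pr p) - 1) p = D as" if "adm as" for as
          using iter_deriv_cutoff_pr[OF h that] p
          by (auto simp: iter_deriv_minus_const D_def)
        have split_term: "\<bar>D as\<bar> * T q [] bs p \<le> cf as * e" if z: "(as, bs) \<in> set (splits vs)" for as bs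
        proof -
          have adm: "adm as" "adm bs" using adm_splits[OF vs z] .
          have T_nonneg: "0 \<le> T q [] bs p"
            unfolding T_def using w(1) Q_nonneg[OF q] by simp
          have len: "length vs = length as + length bs"
            using arg_cong[OF mset_splits[OF z], of size] by simp
          have sub: "set vs = set as \<union> set bs"
            using arg_cong[OF mset_splits[OF z], of set_mset] by simp
          have bs: "bs \<in> Us" using adm sub len by (auto simp: Us_def L_def)
          consider "pr p \<notin> collar \<rho> X" "\<forall>i. \<bar>pr p $ i\<bar> \<le> R" | "0 \<in> set (map pr as)"
            | "\<exists>i. \<bar>pr p $ i\<bar> > R" | "pr p \<in> collar \<rho> X" "0 \<notin> set (map pr as)"
            using not_le by metis
          then show ?thesis
          proof cases
            case 1
            then show ?thesis using D_zero[OF adm(1)] cf e(1) by simp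
          next
            case 2
            then show ?thesis using D_zero_dir[OF adm(1)] cf e(1) by simp
          next
            case 3
            then have "T q [] bs p \<le> e * \<rho> ^ L" using far bs p by blast
            also have "\<dots> \<le> e * \<rho> ^ length as"
              using e(1) \<rho> len by (intro mult_left_mono power_decreasing) (auto simp: L_def)
            finally have "\<bar>D as\<bar> * T q [] bs p \<le> ((\<bar>C (map pr as)\<bar> + 1) * (1 / \<rho>) ^ length as) * (e * \<rho> ^ length as)"
              using D_bound[OF adm(1)] T_nonneg \<rho> by (intro mult_mono) auto
            also have "\<dots> = (\<bar>C (map pr as)\<bar> + 1) * 1 * e"
              using \<rho> by (simp add: power_divide)
            also have "\<dots> \<le> cf as * e"
              unfolding cf_def using e(1) by (intro mult_right_mono mult_left_mono) auto
            finally show ?thesis .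
          next
            case 4
            have as: "set as \<subseteq> range edir"
            proof
              fix v assume "v \<in> set as"
              then show "v \<in> range edir" using adm_dirs[OF adm(1)] 4(2) by fastforce
            qed
            (* Besides what is needed to differentiate further, P confines the two lists to the
               finite sets As and Us, for whose members the bound by e in the collar holds. *)
            define P where "P n xs us \<longleftrightarrow> set xs \<subseteq> axes \<and> enat (length xs + n) \<le> k \<and> length xs + n \<le> L \<and>
              set us \<subseteq> set vs \<union> range edir \<and> length us + n \<le> L \<and>
              (\<forall>ns. set ns \<subseteq> range edir \<longrightarrow> length ns = n \<longrightarrow> adm (ns @ us))" for n xs us
            have P_append: "adm (ns @ us)" if "P n xs us" "set ns \<subseteq> range edir" "length ns = n" for n xs us ns
              using that by (simp add: P_def)
            have P_adm: "adm us" if "P n xs us" for n xs us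
            proof -
              have "adm (replicate n (edir undefined) @ us)"
                by (rule P_append[OF that]) auto
              then show ?thesis by (rule adm_sub) simp
            qed
            have P_k: "enat (length xs) \<le> k" if "P n xs us" for n xs us
              using that unfolding P_def by (metis enat_ord_simps(1) le_add1 order_trans)
            have "T q [] bs p \<le> e * (2 * \<rho>) ^ length as"
              unfolding T_def
            proof (rule collar_estimate[OF q, where P = P])
              show "0 \<le> e" "0 \<le> \<rho>" using e \<rho> by auto
              show "0 \<le> w p" for p by (rule w(1))
              show "w (p + emb s) = w p" for p s by (rule w(2))
            next
              fix n xs us j assume P: "P (Suc n) xs us"
              have 1: "P n (axis j 1 # xs) us"
                unfolding P_def
              proof (intro conjI allI impI)
                fix ns :: "'p list" assume "set ns \<subseteq> range edir" "length ns = n"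
                then have "adm ((edir j # ns) @ us)" by (intro P_append[OF P]) auto
                then show "adm (ns @ us)" by (rule adm_sub) simp
              qed (use P in \<open>auto simp: P_def\<close>)
              moreover have 2: "P n xs (edir j # us)"
                unfolding P_def
              proof (intro conjI allI impI)
                fix ns :: "'p list" assume "set ns \<subseteq> range edir" "length ns = n"
                then have "adm ((edir j # ns) @ us)" by (intro P_append[OF P]) auto
                then show "adm (ns @ edir j # us)" by (rule adm_sub) simp
              next
                have "enat (length xs + n) \<le> enat (length xs + Suc n)" by simp
                also have "\<dots> \<le> k" using P unfolding P_def by blast
                finally show "enat (length xs + n) \<le> k" .
              qed (use P in \<open>auto simp: P_def\<close>)
              moreover have "iter_differentiable_on X (axis j 1 # xs) F"
                using P_k[OF 1] 1 by (intro diff_F) (auto simp: P_def)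
              moreover have "iter_differentiable_on \<Omega> (edir j # us) \<gamma>"
                by (rule diff_\<gamma>[OF P_adm[OF 2]])
              ultimately show "P n (axis j 1 # xs) us \<and> P n xs (edir j # us) \<and>
                iter_differentiable_on X (axis j 1 # xs) F \<and> iter_differentiable_on \<Omega> (edir j # us) \<gamma>" by blast
            next
              fix n xs us assume P: "P n xs us"
              have xs: "set xs \<subseteq> axes" using P by (simp add: P_def)
              show "vanishing_over \<Omega> pr X (\<lambda>p. \<bar>iter_deriv xs F (pr p)\<bar> * w p * q (iter_deriv us \<gamma> p))"
                using van[OF xs P_k[OF P] P_adm[OF P]] unfolding T_def .
              fix p assume p: "p \<in> \<Omega>" "pr p \<in> collar \<rho> X"
              have "xs \<in> As" "us \<in> Us"
                using P P_k[OF P] P_adm[OF P] by (auto simp: As_def Us_def P_def)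
              then show "\<bar>iter_deriv xs F (pr p)\<bar> * w p * q (iter_deriv us \<gamma> p) \<le> e"
                using elim p unfolding T_def by blast
            next
              have "adm (as @ bs)" using vs by (rule adm_sub) (simp add: mset_splits[OF z])
              then have "adm (ns @ bs)" if "set ns \<subseteq> range edir" "length ns = length as" for ns
                using adm_replace as that by blast
              then show "P (length as) [] bs"
                using adm_length[OF adm(1) as] len sub by (auto simp: P_def L_def)
            qed (use p 4 in auto)
            then have "\<bar>D as\<bar> * T q [] bs p \<le> ((\<bar>C (map pr as)\<bar> + 1) * (1 / \<rho>) ^ length as) * (e * (2 * \<rho>) ^ length as)"
              using D_bound[OF adm(1)] T_nonneg \<rho> by (intro mult_mono) auto
            also have "\<dots> = cf as * e"
              using \<rho> by (simp add: cf_def power_divide power_mult_distrib)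
            finally show ?thesis .
          qed
        qed
        have diffs: "iter_differentiable_on \<Omega> as (\<lambda>p. h (pr p) - 1) \<and> iter_differentiable_on \<Omega> bs \<gamma>"
          if "(as, bs) \<in> set (splits vs)" for as bs
          using D_pr diff_\<gamma> adm_splits[OF vs that] by blast
        have "iter_deriv vs (\<lambda>p. (h (pr p) - 1) *\<^sub>R \<gamma> p) p =
          (\<Sum>(as, bs)\<leftarrow>splits vs. iter_deriv as (\<lambda>p. h (pr p) - 1) p *\<^sub>R iter_deriv bs \<gamma> p)"
          using iter_deriv_scaleR[OF open_\<Omega> diffs] p by blast
        also have "\<dots> = (\<Sum>(as, bs)\<leftarrow>splits vs. D as *\<^sub>R iter_deriv bs \<gamma> p)"
          using adm_splits(1)[OF vs] D_pr by (intro arg_cong[where f = sum_list] map_cong) auto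
        finally have "q (iter_deriv vs (\<lambda>p. h (pr p) *\<^sub>R \<gamma> p - \<gamma> p) p) = q (\<Sum>(as, bs)\<leftarrow>splits vs. D as *\<^sub>R iter_deriv bs \<gamma> p)"
          by (simp add: scaleR_left_diff_distrib)
        also have "\<dots> \<le> (\<Sum>(as, bs)\<leftarrow>splits vs. \<bar>D as\<bar> * q (iter_deriv bs \<gamma> p))"
          using Q_sum_list[OF q, of "map (\<lambda>(as, bs). D as *\<^sub>R iter_deriv bs \<gamma> p) (splits vs)"]
          by (simp add: comp_def case_prod_unfold Q_scale[OF q])
        finally have "\<bar>F (pr p)\<bar> * w p * q (iter_deriv vs (\<lambda>p. h (pr p) *\<^sub>R \<gamma> p - \<gamma> p) p)
          \<le> \<bar>F (pr p)\<bar> * w p * (\<Sum>(as, bs)\<leftarrow>splits vs. \<bar>D as\<bar> * q (iter_deriv bs \<gamma> p))"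
          using w(1) by (intro mult_left_mono) auto
        also have "\<dots> = (\<Sum>(as, bs)\<leftarrow>splits vs. \<bar>D as\<bar> * T q [] bs p)"
          unfolding T_def by (simp add: sum_list_const_mult[symmetric] case_prod_unfold mult_ac)
        also have "\<dots> \<le> (\<Sum>(as, bs)\<leftarrow>splits vs. cf as * e)"
          using split_term by (intro sum_list_mono) auto
        also have "\<dots> = M * e"
          unfolding M_def by (simp add: sum_list_mult_const[symmetric] case_prod_unfold)
        also have "\<dots> \<le> \<epsilon>" by (rule e(2))
        finally show "\<bar>F (pr p)\<bar> * w p * q (iter_deriv vs (\<lambda>p. h (pr p) *\<^sub>R \<gamma> p - \<gamma> p) p) \<le> \<epsilon>" .
      qed
    qed
  qed
qed

end

section \<open>The seminorms of a locally convex space\<close>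

lemma real_seminorm_space: "seminorm_space {abs :: real \<Rightarrow> real}"
proof
  show "open S \<longleftrightarrow> (\<forall>x\<in>S. \<exists>q\<in>{abs}. \<exists>\<epsilon>>0. \<forall>y. q (y - x) < \<epsilon> \<longrightarrow> y \<in> S)" for S :: "real set"
    by (simp add: open_dist dist_real_def)
qed (auto simp: abs_mult)

text \<open>
  Seminorms over the real scalars are used for the calculus, since gauges of convex
  neighbourhoods are such seminorms; homogeneity over the full ground field would require balanced
  neighbourhoods.
\<close>

definition real_seminorms :: "('e::{real_vector, topological_space} \<Rightarrow> real) set" where
  "real_seminorms = {q. (\<forall>x y. q (x + y) \<le> q x + q y) \<and> (\<forall>r x. q (r *\<^sub>R x) = \<bar>r\<bar> * q x) \<and> continuous_on UNIV q}"

context locally_convex_space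
begin

lemma continuous_on_scaleR_right: "continuous_on S (\<lambda>x::'e. r *\<^sub>R x)"
proof -
  have "continuous_on S ((\<lambda>(c, x). smul c x) \<circ> (\<lambda>x. (of_real r, x)))"
    by (intro continuous_on_compose continuous_intros continuous_on_subset[OF continuous_smul]) auto
  then show ?thesis by (simp add: comp_def smul_of_real)
qed

lemma tendsto_scaleR_to_0: "((\<lambda>r. r *\<^sub>R (x::'e)) \<longlongrightarrow> 0) (at 0)"
proof -
  have "continuous_on UNIV ((\<lambda>(c, x). smul c x) \<circ> (\<lambda>r::real. (of_real r, x)))"
    by (intro continuous_on_compose continuous_intros continuous_on_subset[OF continuous_smul]) auto
  then have "continuous_on UNIV (\<lambda>r. r *\<^sub>R x)" by (simp add: comp_def smul_of_real)
  then show ?thesis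
    unfolding continuous_on_def by (metis UNIV_I scale_zero_left scaleR_zero_left)
qed

lemma continuous_seminorms_subset: "continuous_seminorms smul \<subseteq> real_seminorms"
proof
  fix q assume q: "q \<in> continuous_seminorms smul"
  have "q (r *\<^sub>R x) = \<bar>r\<bar> * q x" for r x
  proof -
    have "q (smul (of_real r) x) = norm (of_real r :: 'k) * q x"
      using q by (simp add: continuous_seminorms_def)
    then show ?thesis by (simp add: smul_of_real)
  qed
  then show "q \<in> real_seminorms"
    using q by (simp add: continuous_seminorms_def real_seminorms_def)
qed

text \<open>
  The seminorm is the Minkowski functional of a convex neighbourhood of zero, made symmetric by
  intersecting it with its negative.
\<close>

lemma exists_real_seminorm:
  assumes S: "open (S :: 'e set)" "0 \<in> S"
  shows "\<exists>q\<in>real_seminorms. \<forall>x. q x < 1 \<longrightarrow> x \<in> S"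
proof -
  obtain N C where NC: "open N" "(0::'e) \<in> N" "N \<subseteq> C" "convex C" "C \<subseteq> S"
    using convex_nhds_0[OF S] by blast
  define B where "B = C \<inter> uminus ` C"
  define p where "p x = Inf {t. 0 < t \<and> (1 / t) *\<^sub>R x \<in> B}" for x :: 'e
  have B_neg: "- x \<in> B" if "x \<in> B" for x
    using that by (auto simp: B_def image_iff)
  have B_convex: "convex B" unfolding B_def
    using NC(4) by (intro convex_Int convex_negations) auto
  have B_0: "0 \<in> B" using NC(2,3) by (auto simp: B_def image_iff intro!: bexI[of _ 0])
  have nonempty: "{t. 0 < t \<and> (1 / t) *\<^sub>R x \<in> B} \<noteq> {}" for x
  proof -
    have "\<forall>\<^sub>F r in at 0. r *\<^sub>R x \<in> N" "\<forall>\<^sub>F r in at 0. r *\<^sub>R (- x) \<in> N"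
      by (rule topological_tendstoD[OF tendsto_scaleR_to_0 NC(1,2)])+
    then have "\<forall>\<^sub>F r in at_right 0. r *\<^sub>R x \<in> N" "\<forall>\<^sub>F r in at_right 0. r *\<^sub>R (- x) \<in> N"
      unfolding eventually_at_split by simp_all
    moreover have "\<forall>\<^sub>F r::real in at_right 0. 0 < r"
      by (simp add: eventually_at_right_less)
    ultimately have "\<forall>\<^sub>F r in at_right 0. 0 < r \<and> r *\<^sub>R x \<in> N \<and> r *\<^sub>R (- x) \<in> N"
      by eventually_elim auto
    then obtain r where r: "0 < r" "r *\<^sub>R x \<in> N" "r *\<^sub>R (- x) \<in> N"
      using eventually_happens'[OF trivial_limit_at_right_real] by blast
    then have "r *\<^sub>R x \<in> B"
      using NC(3) by (auto simp: B_def image_iff intro!: bexI[of _ "- (r *\<^sub>R x)"])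
    then have "1 / r \<in> {t. 0 < t \<and> (1 / t) *\<^sub>R x \<in> B}" using r by simp
    then show ?thesis by blast
  qed
  have bdd: "bdd_below {t. 0 < t \<and> (1 / t) *\<^sub>R x \<in> B}" for x
    by (rule bdd_belowI[of _ 0]) auto
  have p_le: "p x \<le> t" if "0 < t" "(1 / t) *\<^sub>R x \<in> B" for x t
    unfolding p_def using that bdd by (intro cInf_lower) auto
  have p_less: "(1 / s) *\<^sub>R x \<in> B" if "p x < s" for x s
  proof -
    have "\<exists>t\<in>{t. 0 < t \<and> (1 / t) *\<^sub>R x \<in> B}. t < s"
      using that unfolding p_def cInf_less_iff[OF nonempty bdd] .
    then obtain t where t: "0 < t" "(1 / t) *\<^sub>R x \<in> B" "t < s"
      by blast
    have "(t / s) *\<^sub>R ((1 / t) *\<^sub>R x) + (1 - t / s) *\<^sub>R 0 \<in> B"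
      using t B_0 by (intro convexD[OF B_convex]) auto
    then show ?thesis using t by simp
  qed
  have p_nonneg: "0 \<le> p x" for x
    unfolding p_def using nonempty by (intro cInf_greatest) auto
  have p_add: "p (x + y) \<le> p x + p y" for x y
  proof (rule field_le_epsilon)
    fix e :: real assume e: "e > 0"
    define s t where "s = p x + e / 2" and "t = p y + e / 2"
    have st: "s > 0" "t > 0" "p x < s" "p y < t"
      using p_nonneg[of x] p_nonneg[of y] e by (auto simp: s_def t_def)
    have "(s / (s + t)) *\<^sub>R ((1 / s) *\<^sub>R x) + (t / (s + t)) *\<^sub>R ((1 / t) *\<^sub>R y) \<in> B"
      using st p_less by (intro convexD[OF B_convex]) (auto simp: add_divide_distrib[symmetric])
    then have "(1 / (s + t)) *\<^sub>R (x + y) \<in> B"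
      using st by (simp add: scaleR_add_right)
    then have "p (x + y) \<le> s + t" using st by (intro p_le) auto
    then show "p (x + y) \<le> p x + p y + e" by (simp add: s_def t_def)
  qed
  have p_0: "p 0 = 0"
  proof (rule antisym[OF field_le_epsilon p_nonneg])
    fix e :: real assume "e > 0"
    then show "p 0 \<le> 0 + e" using B_0 by (intro p_le) auto
  qed
  have p_scale_le: "p (r *\<^sub>R x) \<le> \<bar>r\<bar> * p x" if "r \<noteq> 0" for r x
  proof (rule field_le_epsilon)
    fix e :: real assume e: "e > 0"
    define s where "s = p x + e / \<bar>r\<bar>"
    have s: "p x < s" "0 < s" using e that p_nonneg[of x] by (auto simp: s_def add_nonneg_pos)
    have "(1 / (\<bar>r\<bar> * s)) *\<^sub>R (r *\<^sub>R x) \<in> B"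
      using p_less[OF s(1)] B_neg[OF p_less[OF s(1)]] that by (cases "r > 0") (auto simp: abs_if)
    then have "p (r *\<^sub>R x) \<le> \<bar>r\<bar> * s" using s that by (intro p_le) auto
    also have "\<dots> = \<bar>r\<bar> * p x + e" using that by (simp add: s_def distrib_left)
    finally show "p (r *\<^sub>R x) \<le> \<bar>r\<bar> * p x + e" .
  qed
  have p_scale: "p (r *\<^sub>R x) = \<bar>r\<bar> * p x" for r x
  proof (cases "r = 0")
    case False
    have "\<bar>r\<bar> * p x = \<bar>r\<bar> * p ((1 / r) *\<^sub>R (r *\<^sub>R x))" using False by simp
    also have "\<dots> \<le> \<bar>r\<bar> * (\<bar>1 / r\<bar> * p (r *\<^sub>R x))"
      using False by (intro mult_left_mono p_scale_le) auto
    also have "\<dots> = p (r *\<^sub>R x)" using False by simp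
    finally show ?thesis using p_scale_le[OF False, of x] by linarith
  qed (simp add: p_0)
  have p_minus: "p (- x) = p x" for x
    using p_scale[of "-1" x] by simp
  have p_diff: "\<bar>p y - p x\<bar> \<le> p (y - x)" for x y
  proof -
    have "p y \<le> p (y - x) + p x" using p_add[of "y - x" x] by simp
    moreover have "p x \<le> p (- (y - x)) + p y" using p_add[of "- (y - x)" y] by simp
    ultimately show ?thesis unfolding p_minus by linarith
  qed
  have p_cont: "continuous_on UNIV p"
    unfolding continuous_on_def
  proof (intro ballI tendstoI)
    fix x :: 'e and e :: real assume e: "e > 0"
    have "continuous_on UNIV (\<lambda>y. (2 / e) *\<^sub>R (y - x))" "continuous_on UNIV (\<lambda>y. (2 / e) *\<^sub>R (- (y - x)))"
      by (rule continuous_on_compose2[OF continuous_on_scaleR_right[of UNIV]],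
          intro continuous_intros, rule subset_UNIV)+
    then have "((\<lambda>y. (2 / e) *\<^sub>R (y - x)) \<longlongrightarrow> (2 / e) *\<^sub>R (x - x)) (at x within UNIV)"
      "((\<lambda>y. (2 / e) *\<^sub>R (- (y - x))) \<longlongrightarrow> (2 / e) *\<^sub>R (- (x - x))) (at x within UNIV)"
      unfolding continuous_on_def by blast+
    then have "\<forall>\<^sub>F y in at x within UNIV. (2 / e) *\<^sub>R (y - x) \<in> N" "\<forall>\<^sub>F y in at x within UNIV. (2 / e) *\<^sub>R (- (y - x)) \<in> N"
      using NC(1,2) by (auto elim!: topological_tendstoD)
    then show "\<forall>\<^sub>F y in at x within UNIV. dist (p y) (p x) < e"
    proof eventually_elim
      case (elim y)
      then have "(1 / (e / 2)) *\<^sub>R (y - x) \<in> B"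
        using NC(3) by (auto simp: B_def image_iff scaleR_diff_right intro!: bexI[of _ "(2 / e) *\<^sub>R (- (y - x))"])
      then have "p (y - x) \<le> e / 2" using e by (intro p_le) auto
      then show ?case using p_diff[of y x] e by (simp add: dist_real_def)
    qed
  qed
  have "x \<in> S" if "p x < 1" for x
    using p_less[OF that] NC(5) by (auto simp: B_def)
  moreover have "p \<in> real_seminorms"
    using p_add p_scale p_cont by (simp add: real_seminorms_def)
  ultimately show ?thesis by blast
qed

end

lemma seminorm_space_real_seminorms:
  fixes smul :: "'k::real_normed_field \<Rightarrow> 'e \<Rightarrow> 'e::{real_vector, topological_ab_group_add, t2_space}"
  assumes "locally_convex_space smul"
  shows "seminorm_space (real_seminorms :: ('e \<Rightarrow> real) set)"
proof
  interpret locally_convex_space smul by fact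
  fix S :: "'e set"
  show "open S \<longleftrightarrow> (\<forall>x\<in>S. \<exists>q\<in>real_seminorms. \<exists>\<epsilon>>0. \<forall>y. q (y - x) < \<epsilon> \<longrightarrow> y \<in> S)"
  proof
    assume S: "open S"
    show "\<forall>x\<in>S. \<exists>q\<in>real_seminorms. \<exists>\<epsilon>>0. \<forall>y. q (y - x) < \<epsilon> \<longrightarrow> y \<in> S"
    proof
      fix x assume x: "x \<in> S"
      have "continuous_on UNIV (\<lambda>y. y + x)" by (intro continuous_intros)
      then have "open ((\<lambda>y. y + x) -` S)"
        using S by (simp add: continuous_on_open_vimage)
      then obtain q where "q \<in> real_seminorms" "\<forall>y. q y < 1 \<longrightarrow> y \<in> (\<lambda>y. y + x) -` S"
        using exists_real_seminorm[of "(\<lambda>y. y + x) -` S"] x by auto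
      then show "\<exists>q\<in>real_seminorms. \<exists>\<epsilon>>0. \<forall>y. q (y - x) < \<epsilon> \<longrightarrow> y \<in> S"
        by (intro bexI[of _ q] exI[of _ 1]) (auto dest: spec[of _ "_ - x"])
    qed
  next
    assume *: "\<forall>x\<in>S. \<exists>q\<in>real_seminorms. \<exists>\<epsilon>>0. \<forall>y. q (y - x) < \<epsilon> \<longrightarrow> y \<in> S"
    show "open S"
    proof (subst open_subopen, rule ballI)
      fix x assume "x \<in> S"
      then obtain q e where q: "q \<in> real_seminorms" "e > 0" "\<forall>y. q (y - x) < e \<longrightarrow> y \<in> S"
        using * by blast
      have "q (0 *\<^sub>R 0) = \<bar>0\<bar> * q 0" using q(1) unfolding real_seminorms_def by blast
      then have "q 0 = 0" by simp
      moreover have "continuous_on UNIV q" using q(1) by (simp add: real_seminorms_def)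
      then have "continuous_on UNIV (\<lambda>y. q (y - x))"
        by (rule continuous_on_compose2) (auto intro!: continuous_intros)
      then have "open {y. q (y - x) < e}"
        by (intro open_Collect_less continuous_intros) auto
      ultimately show "\<exists>T. open T \<and> x \<in> T \<and> T \<subseteq> S"
        using q by (intro exI[of _ "{y. q (y - x) < e}"]) auto
    qed
  qed
qed (auto simp: real_seminorms_def)

section \<open>Multi-indices and lists of directions\<close>

text \<open>
  Sorting by the rank of the coordinates puts a list of coordinate directions into the order in which a multi-index lists them.
\<close>

definition axis_key :: "(real, 'n::{finite, linorder}) vec \<Rightarrow> nat" where
  "axis_key v = card {i. i < (THE i. v = axis i 1)}"

lemma axis_key_axis: "axis_key (axis i 1 :: (real, 'n::{finite, linorder}) vec) = card {j. j < i}"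
proof -
  have "(THE j. axis i 1 = (axis j 1 :: (real, 'n) vec)) = i"
    by (rule the_equality) (auto simp: axis_eq_axis)
  then show ?thesis by (simp add: axis_key_def)
qed

lemma card_below_less:
  fixes i j :: "'n::{finite, linorder}"
  assumes "i < j"
  shows "card {k. k < i} < card {k. k < j}"
  using assms by (intro psubset_card_mono) auto

lemma card_below_less_CARD: "card {k. k < (i :: 'n::{finite, linorder})} < CARD('n)"
  by (intro psubset_card_mono) auto

lemma axis_key_mono:
  fixes i j :: "'n::{finite, linorder}"
  shows "i \<le> j \<Longrightarrow> axis_key (axis i 1 :: (real, 'n) vec) \<le> axis_key (axis j 1 :: (real, 'n) vec)"
  using card_below_less[of i j] by (cases "i = j") (auto simp: axis_key_axis less_imp_le)

lemma inj_on_axis_key: "inj_on axis_key (range (\<lambda>i. axis i 1 :: (real, 'n::{finite, linorder}) vec))"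
proof (rule inj_onI, clarify)
  fix i j :: 'n assume "axis_key (axis i 1 :: (real, 'n) vec) = axis_key (axis j 1 :: (real, 'n) vec)"
  then have "i = j"
    using card_below_less[of i j] card_below_less[of j i] by (cases i j rule: linorder_cases) (auto simp: axis_key_axis)
  then show "axis i 1 = (axis j 1 :: (real, 'n) vec)" by simp
qed

lemma set_mi_dirs: "set (mi_dirs \<alpha>) \<subseteq> range (\<lambda>i. axis i 1)"
  by (auto simp: mi_dirs_def)

lemma sorted_mi_dirs: "sorted (map axis_key (mi_dirs (\<alpha> :: 'n::{finite, linorder} \<Rightarrow> nat)))"
proof -
  have "sorted (map axis_key (concat (map (\<lambda>i. replicate (\<alpha> i) (axis i 1 :: (real, 'n) vec)) is)))"
    if "sorted is" for "is"
    using that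
  proof (induction "is")
    case (Cons i "is")
    then show ?case by (auto simp: sorted_append axis_key_mono)
  qed simp
  then show ?thesis by (simp add: mi_dirs_def)
qed

lemma count_list_mi_dirs:
  "count_list (mi_dirs (\<alpha> :: 'n::{finite, linorder} \<Rightarrow> nat)) (axis j 1) = \<alpha> j"
proof -
  have rep: "count_list (replicate n x) y = (if x = y then n else 0)" for n and x y :: "(real, 'n) vec"
    by (induction n) auto
  have "count_list (concat (map (\<lambda>i. replicate (\<alpha> i) (axis i 1 :: (real, 'n) vec)) is)) (axis j 1)
      = (if j \<in> set is then \<alpha> j else 0)" if "distinct is" for "is"
    using that by (induction "is") (auto simp: rep axis_eq_axis)
  from this[of "sorted_list_of_set UNIV"] show ?thesis by (simp add: mi_dirs_def)
qed

lemma mset_mi_dirs: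
  fixes vs :: "(real, 'n::{finite, linorder}) vec list"
  assumes "set vs \<subseteq> range (\<lambda>i. axis i 1)"
  shows "mset (mi_dirs (\<lambda>i. count_list vs (axis i 1))) = mset vs"
proof (rule multiset_eqI)
  fix v :: "(real, 'n) vec"
  show "count (mset (mi_dirs (\<lambda>i. count_list vs (axis i 1)))) v = count (mset vs) v"
  proof (cases "v \<in> range (\<lambda>i. axis i 1)")
    case True
    then show ?thesis by (auto simp: count_mset count_list_mi_dirs)
  next
    case False
    then have "v \<notin> set vs" "v \<notin> set (mi_dirs (\<lambda>i. count_list vs (axis i 1)))"
      using assms set_mi_dirs by blast+
    then show ?thesis by (simp add: count_mset count_list_0_iff)
  qed
qed

lemma length_mi_dirs: "enat (length (mi_dirs \<alpha>)) = mi_order (\<alpha> :: 'n::{finite, linorder} \<Rightarrow> nat)"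
  using sum_count_axis[OF set_mi_dirs[of \<alpha>]] by (simp add: count_list_mi_dirs mi_order_def)

lemma mi_order_count:
  fixes vs :: "(real, 'n::{finite, linorder}) vec list"
  assumes "set vs \<subseteq> range (\<lambda>i. axis i 1)"
  shows "mi_order (\<lambda>i. count_list vs (axis i 1)) = enat (length vs)"
  using sum_count_axis[OF assms] by (simp add: mi_order_def)

lemma sort_axis_key:
  fixes vs :: "(real, 'n::{finite, linorder}) vec list"
  assumes "set vs \<subseteq> range (\<lambda>i. axis i 1)"
  shows "sort_key axis_key vs = mi_dirs (\<lambda>i. count_list vs (axis i 1))"
  using assms mset_mi_dirs[OF assms] sorted_mi_dirs inj_on_subset[OF inj_on_axis_key]
  by (intro sort_key_inj_key_eq) auto

text \<open>
  This makes hypotheses on derivatives that are indexed by multi-indices available for all orders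
  of differentiation.
\<close>

lemma Ck_nonneg_iter_deriv:
  fixes f :: "(real, 'n::{finite, linorder}) vec \<Rightarrow> real"
  assumes f: "f \<in> Ck_nonneg k U" and U: "open U"
    and vs: "set vs \<subseteq> range (\<lambda>i. axis i 1)" "enat (length vs) \<le> k"
  shows "iter_differentiable_on U vs f"
    and "\<exists>\<alpha>. mi_order \<alpha> \<le> k \<and> (\<forall>x\<in>U. iter_deriv vs f x = partial_deriv \<alpha> f x)"
proof -
  interpret seminorm_space "{abs :: real \<Rightarrow> real}" by (rule real_seminorm_space)
  define adm where "adm vs \<longleftrightarrow> set vs \<subseteq> range (\<lambda>i. axis i 1) \<and> enat (length vs) \<le> k"
    for vs :: "(real, 'n) vec list"
  have mi: "mi_order (\<lambda>i. count_list vs (axis i 1)) \<le> k" if "adm vs" for vs :: "(real, 'n) vec list"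
    using that mi_order_count[of vs] by (simp add: adm_def)
  have *: "iter_differentiable_on U vs f \<and> (\<forall>x\<in>U. iter_deriv vs f x = iter_deriv (sort_key axis_key vs) f x)"
  proof (rule iter_deriv_sort_key[OF U, where adm = adm])
    fix vs ws :: "(real, 'n) vec list" assume "adm vs" and sub: "mset ws \<subseteq># mset vs"
    moreover have "enat (length ws) \<le> enat (length vs)" using size_mset_mono[OF sub] by simp
    moreover have "set ws \<subseteq> set vs" using set_mset_mono[OF sub] by simp
    ultimately show "adm ws" unfolding adm_def by (meson order_trans)
  next
    fix vs :: "(real, 'n) vec list" assume adm: "adm vs" and "sorted (map axis_key vs)"
    then have "vs = mi_dirs (\<lambda>i. count_list vs (axis i 1))"
      using sort_axis_key[of vs] sort_key_id_if_sorted[of axis_key vs] by (simp add: adm_def)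
    then show "iter_differentiable_on U vs f \<and> continuous_on U (iter_deriv vs f)"
      using f mi[OF adm] unfolding Ck_nonneg_def by auto
  next
    show "adm vs" using vs by (simp add: adm_def)
  qed
  then show "iter_differentiable_on U vs f" by blast
  show "\<exists>\<alpha>. mi_order \<alpha> \<le> k \<and> (\<forall>x\<in>U. iter_deriv vs f x = partial_deriv \<alpha> f x)"
    using * mi[of vs] vs unfolding sort_axis_key[OF vs(1)] adm_def by blast
qed

definition x_dirs :: "((real, 'n::finite) vec \<times> (real, 'm::finite) vec) set" where
  "x_dirs = range (\<lambda>i. (axis i 1, 0))"

definition y_dirs :: "((real, 'n::finite) vec \<times> (real, 'm::finite) vec) set" where
  "y_dirs = range (\<lambda>j. (0, axis j 1))"

definition coord_dirs_le :: "enat \<Rightarrow> enat \<Rightarrow> ((real, 'n::finite) vec \<times> (real, 'm::finite) vec) list \<Rightarrow> bool" where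
  "coord_dirs_le k l vs \<longleftrightarrow> set vs \<subseteq> x_dirs \<union> y_dirs \<and> enat (length (filter (\<lambda>v. snd v = 0) vs)) \<le> k \<and>
    enat (length (filter (\<lambda>v. snd v \<noteq> 0) vs)) \<le> l"

definition axis_key2 :: "(real, 'n::{finite, linorder}) vec \<times> (real, 'm::{finite, linorder}) vec \<Rightarrow> nat" where
  "axis_key2 v = (if snd v = 0 then axis_key (fst v) else CARD('n) + axis_key (snd v))"

lemma axis_key_less: "v \<in> range (\<lambda>i. axis i 1) \<Longrightarrow> axis_key (v :: (real, 'n::{finite, linorder}) vec) < CARD('n)"
  using card_below_less_CARD by (auto simp: axis_key_axis)

lemma inj_on_axis_key2:
  "inj_on axis_key2 (x_dirs \<union> y_dirs :: ((real, 'n::{finite, linorder}) vec \<times> (real, 'm::{finite, linorder}) vec) set)"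
proof (rule inj_onI)
  fix u v :: "(real, 'n) vec \<times> (real, 'm) vec"
  assume *: "u \<in> x_dirs \<union> y_dirs" "v \<in> x_dirs \<union> y_dirs" "axis_key2 u = axis_key2 v"
  have less: "axis_key (axis i 1 :: (real, 'n) vec) < CARD('n)" for i
    by (rule axis_key_less) simp
  from * show "u = v"
    using inj_onD[OF inj_on_axis_key[where 'n = 'n], of "fst u" "fst v"]
      inj_onD[OF inj_on_axis_key[where 'n = 'm], of "snd u" "snd v"] less
    by (auto simp: x_dirs_def y_dirs_def axis_key2_def dest: less_imp_neq)
      (metis less not_add_less1)+
qed

lemma coord_dirs_le_mi_dirs2:
  assumes "mi_order \<alpha> \<le> k" "mi_order \<beta> \<le> l"
  shows "coord_dirs_le k l (mi_dirs2 \<alpha> \<beta>)"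
proof -
  have "axis i (1::real) \<noteq> 0" for i :: 'b by simp
  then have "filter (\<lambda>v. v \<noteq> 0) (mi_dirs \<beta>) = mi_dirs \<beta>" "filter (\<lambda>v. v = 0) (mi_dirs \<beta>) = []"
    using set_mi_dirs[of \<beta>] by (auto simp: filter_id_conv filter_empty_conv)
  moreover have "set (mi_dirs2 \<alpha> \<beta>) \<subseteq> x_dirs \<union> y_dirs"
    using set_mi_dirs[of \<alpha>] set_mi_dirs[of \<beta>] by (force simp: mi_dirs2_def x_dirs_def y_dirs_def)
  ultimately show ?thesis
    using assms length_mi_dirs[of \<alpha>] length_mi_dirs[of \<beta>]
    by (simp add: coord_dirs_le_def mi_dirs2_def filter_map comp_def)
qed

lemma sort_axis_key2:
  fixes vs :: "((real, 'n::{finite, linorder}) vec \<times> (real, 'm::{finite, linorder}) vec) list"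
  assumes "coord_dirs_le k l vs"
  shows "\<exists>\<alpha> \<beta>. mi_order \<alpha> \<le> k \<and> mi_order \<beta> \<le> l \<and> sort_key axis_key2 vs = mi_dirs2 \<alpha> \<beta>"
proof -
  define us where "us = map fst (filter (\<lambda>v. snd v = 0) vs)"
  define ws where "ws = map snd (filter (\<lambda>v. snd v \<noteq> 0) vs)"
  define \<alpha> where "\<alpha> = (\<lambda>i. count_list us (axis i 1))"
  define \<beta> where "\<beta> = (\<lambda>i. count_list ws (axis i 1))"
  have vs: "set vs \<subseteq> x_dirs \<union> y_dirs" using assms by (simp add: coord_dirs_le_def)
  have us: "set us \<subseteq> range (\<lambda>i. axis i 1)" and ws: "set ws \<subseteq> range (\<lambda>i. axis i 1)"
    using vs by (auto simp: us_def ws_def x_dirs_def y_dirs_def)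
  have split: "map (\<lambda>v. (v, 0)) us = filter (\<lambda>v. snd v = 0) vs" "map (\<lambda>v. (0, v)) ws = filter (\<lambda>v. snd v \<noteq> 0) vs"
    using vs by (auto simp: us_def ws_def x_dirs_def y_dirs_def intro!: map_idI)
  have "mset (mi_dirs2 \<alpha> \<beta>) = image_mset (\<lambda>v. (v, 0)) (mset us) + image_mset (\<lambda>v. (0, v)) (mset ws)"
    using mset_mi_dirs[OF us] mset_mi_dirs[OF ws] by (simp add: mi_dirs2_def \<alpha>_def \<beta>_def)
  also have "\<dots> = mset (filter (\<lambda>v. snd v = 0) vs) + mset (filter (\<lambda>v. snd v \<noteq> 0) vs)"
    unfolding split[symmetric] by simp
  also have "\<dots> = mset vs" by simp
  finally have mset: "mset vs = mset (mi_dirs2 \<alpha> \<beta>)" by simp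
  have ne: "v \<noteq> 0" if "v \<in> set (mi_dirs \<beta>)" for v
    using that set_mi_dirs[of \<beta>] by auto
  have "sorted (map axis_key2 (mi_dirs2 \<alpha> \<beta>))"
  proof -
    have 1: "map axis_key2 (map (\<lambda>v. (v, 0 :: (real, 'm) vec)) (mi_dirs \<alpha>)) = map axis_key (mi_dirs \<alpha>)"
      by (simp add: axis_key2_def)
    have 2: "map axis_key2 (map (\<lambda>v. (0 :: (real, 'n) vec, v)) (mi_dirs \<beta>)) = map (\<lambda>v. CARD('n) + axis_key v) (mi_dirs \<beta>)"
      using ne by (simp add: axis_key2_def)
    have "sorted (map (\<lambda>v. CARD('n) + axis_key v) (mi_dirs \<beta>))"
      using sorted_mi_dirs[of \<beta>] by (simp add: sorted_map)
    moreover have "axis_key v < CARD('n)" if "v \<in> set (mi_dirs \<alpha>)" for v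
      using that set_mi_dirs axis_key_less by blast
    ultimately show ?thesis
      unfolding mi_dirs2_def map_append 1 2
      by (auto simp: sorted_append sorted_mi_dirs dest: less_imp_le intro!: trans_le_add1)
  qed
  then have "sort_key axis_key2 vs = mi_dirs2 \<alpha> \<beta>"
    using mset inj_on_subset[OF inj_on_axis_key2 vs] by (intro sort_key_inj_key_eq)
  moreover have "mi_order \<alpha> \<le> k" "mi_order \<beta> \<le> l"
    using assms mi_order_count[OF us] mi_order_count[OF ws]
    by (simp_all add: \<alpha>_def \<beta>_def us_def ws_def coord_dirs_le_def)
  ultimately show ?thesis by blast
qed

lemma coord_dirs_le_sub:
  assumes "coord_dirs_le k l vs" "mset ws \<subseteq># mset vs"
  shows "coord_dirs_le k l ws"
proof -
  have "set ws \<subseteq> set vs" using set_mset_mono[OF assms(2)] by simp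
  moreover have "length (filter P ws) \<le> length (filter P vs)" for P
    using size_mset_mono[OF multiset_filter_mono[OF assms(2), of P]]
    by (metis mset_filter size_mset)
  then have "enat (length (filter P ws)) \<le> enat (length (filter P vs))" for P by simp
  ultimately show ?thesis
    using assms(1) unfolding coord_dirs_le_def by (meson order_trans)
qed

text \<open>
  The same for functions of two groups of variables, where directions of both groups may be
  interleaved.
\<close>

lemma (in seminorm_space) Ckl_iter_deriv:
  fixes \<gamma> :: "(real, 'n::{finite, linorder}) vec \<times> (real, 'm::{finite, linorder}) vec \<Rightarrow> 'e"
  assumes \<gamma>: "\<gamma> \<in> Ckl k l U V" and UV: "open U" "open V" and vs: "coord_dirs_le k l vs"
  shows "iter_differentiable_on (U \<times> V) vs \<gamma>" and "continuous_on (U \<times> V) (iter_deriv vs \<gamma>)"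
    and "\<exists>\<alpha> \<beta>. mi_order \<alpha> \<le> k \<and> mi_order \<beta> \<le> l \<and> (\<forall>p\<in>U \<times> V. iter_deriv vs \<gamma> p = partial_deriv2 \<alpha> \<beta> \<gamma> p)"
proof -
  have S: "open (U \<times> V)" using UV by (rule open_Times)
  have *: "iter_differentiable_on (U \<times> V) vs \<gamma> \<and> (\<forall>x\<in>U \<times> V. iter_deriv vs \<gamma> x = iter_deriv (sort_key axis_key2 vs) \<gamma> x)"
  proof (rule iter_deriv_sort_key[OF S, where adm = "coord_dirs_le k l"])
    fix vs :: "((real, 'n) vec \<times> (real, 'm) vec) list"
    assume ok: "coord_dirs_le k l vs" and "sorted (map axis_key2 vs)"
    then obtain \<alpha> \<beta> where "mi_order \<alpha> \<le> k" "mi_order \<beta> \<le> l" "vs = mi_dirs2 \<alpha> \<beta>"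
      using sort_axis_key2[OF ok] sort_key_id_if_sorted[of axis_key2 vs] by auto
    then show "iter_differentiable_on (U \<times> V) vs \<gamma> \<and> continuous_on (U \<times> V) (iter_deriv vs \<gamma>)"
      using \<gamma> by (simp add: Ckl_def)
  qed (use vs coord_dirs_le_sub in auto)
  obtain \<alpha> \<beta> where ab: "mi_order \<alpha> \<le> k" "mi_order \<beta> \<le> l" "sort_key axis_key2 vs = mi_dirs2 \<alpha> \<beta>"
    using sort_axis_key2[OF vs] by blast
  show "iter_differentiable_on (U \<times> V) vs \<gamma>" using * by blast
  show "\<exists>\<alpha> \<beta>. mi_order \<alpha> \<le> k \<and> mi_order \<beta> \<le> l \<and> (\<forall>p\<in>U \<times> V. iter_deriv vs \<gamma> p = partial_deriv2 \<alpha> \<beta> \<gamma> p)"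
    using * ab by metis
  have "continuous_on (U \<times> V) (partial_deriv2 \<alpha> \<beta> \<gamma>)"
    using \<gamma> ab by (simp add: Ckl_def)
  then show "continuous_on (U \<times> V) (iter_deriv vs \<gamma>)"
    by (rule continuous_on_eq) (use * ab(3) in auto)
qed

section \<open>Approximation in the weighted space\<close>

context regular_on_block
begin

text \<open>
  This is where the hypotheses on the weights enter: a derivative of \<open>f\<close> is dominated by a weight
  \<open>g\<close>, and \<open>g\<close> is negligible outside compact sets compared with a weight \<open>g'\<close>, against which the
  derivatives of \<open>\<gamma>\<close> are still bounded.
\<close>

lemma weighted_vanishing:
  assumes q: "q \<in> Q"
    and W: "\<And>f as. f \<in> W \<Longrightarrow> set as \<subseteq> axes \<Longrightarrow> enat (length as) \<le> k \<Longrightarrow> \<exists>g\<in>W. \<forall>x\<in>X. \<bar>iter_deriv as f x\<bar> \<le> g x"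
    and o: "o_condition X W"
    and w: "\<And>p. 0 \<le> w p"
    and bounded: "\<And>f. f \<in> W \<Longrightarrow> \<exists>B. \<forall>p\<in>\<Omega>. f (pr p) * w p * q (iter_deriv us \<gamma> p) \<le> B"
    and f: "f \<in> W" and as: "set as \<subseteq> axes" "enat (length as) \<le> k"
  shows "vanishing_over \<Omega> pr X (\<lambda>p. \<bar>iter_deriv as f (pr p)\<bar> * w p * q (iter_deriv us \<gamma> p))"
  unfolding vanishing_over_def
proof (intro allI impI)
  fix \<eta> :: real assume \<eta>: "\<eta> > 0"
  obtain g where g: "g \<in> W" "\<And>x. x \<in> X \<Longrightarrow> \<bar>iter_deriv as f x\<bar> \<le> g x"
    using W[OF f as] by auto
  obtain g' where g': "g' \<in> W" "little_o_on X g g'"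
    using o g(1) by (auto simp: o_condition_def)
  obtain B where B: "\<And>p. p \<in> \<Omega> \<Longrightarrow> g' (pr p) * w p * q (iter_deriv us \<gamma> p) \<le> B"
    using bounded[OF g'(1)] by auto
  define e where "e = \<eta> / (\<bar>B\<bar> + 1)"
  have e: "e > 0" "e * \<bar>B\<bar> \<le> \<eta>" using \<eta> by (auto simp: e_def field_simps)
  obtain K where K: "compact K" "K \<subseteq> X" "\<And>x. x \<in> X - K \<Longrightarrow> g x \<le> e * g' x"
    using g'(2) e(1) unfolding little_o_on_def by auto
  have "\<bar>iter_deriv as f (pr p)\<bar> * w p * q (iter_deriv us \<gamma> p) \<le> \<eta>" if p: "p \<in> \<Omega>" "pr p \<notin> K" for p
  proof -
    have "\<bar>iter_deriv as f (pr p)\<bar> \<le> e * g' (pr p)"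
      using g(2)[OF pr_\<Omega>[OF p(1)]] K(3)[of "pr p"] pr_\<Omega>[OF p(1)] p(2) by auto
    then have "\<bar>iter_deriv as f (pr p)\<bar> * (w p * q (iter_deriv us \<gamma> p)) \<le> e * g' (pr p) * (w p * q (iter_deriv us \<gamma> p))"
      using w Q_nonneg[OF q] by (intro mult_right_mono) auto
    also have "\<dots> = e * (g' (pr p) * w p * q (iter_deriv us \<gamma> p))" by (simp add: mult_ac)
    also have "\<dots> \<le> e * \<bar>B\<bar>" using B[OF p(1)] e(1) by (intro mult_left_mono) auto
    also have "\<dots> \<le> \<eta>" by (rule e(2))
    finally show ?thesis by (simp add: mult_ac)
  qed
  then show "\<exists>K. compact K \<and> K \<subseteq> X \<and> (\<forall>p\<in>\<Omega>. pr p \<notin> K \<longrightarrow> \<bar>iter_deriv as f (pr p)\<bar> * w p * q (iter_deriv us \<gamma> p) \<le> \<eta>)"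
    using K(1,2) by blast
qed

lemma exists_close_cutoff:
  assumes fin: "finite T"
    and T: "\<And>f w q vs. (f, w, q, vs) \<in> T \<Longrightarrow> f \<in> W \<and> w \<in> W' \<and> q \<in> Q' \<and> adm vs"
    and Q': "Q' \<subseteq> Q"
    and W_nonneg: "\<And>f x. f \<in> W \<Longrightarrow> x \<in> X \<Longrightarrow> 0 \<le> f x"
    and W_diff: "\<And>f as. f \<in> W \<Longrightarrow> set as \<subseteq> axes \<Longrightarrow> enat (length as) \<le> k \<Longrightarrow> iter_differentiable_on X as f"
    and W: "\<And>f as. f \<in> W \<Longrightarrow> set as \<subseteq> axes \<Longrightarrow> enat (length as) \<le> k \<Longrightarrow> \<exists>g\<in>W. \<forall>x\<in>X. \<bar>iter_deriv as f x\<bar> \<le> g x"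
    and o: "o_condition X W"
    and W': "\<And>w p. w \<in> W' \<Longrightarrow> 0 \<le> w p" "\<And>w p s. w \<in> W' \<Longrightarrow> w (p + emb s) = w p"
    and bounded: "\<And>f w q us. f \<in> W \<Longrightarrow> w \<in> W' \<Longrightarrow> q \<in> Q' \<Longrightarrow> adm us \<Longrightarrow>
        \<exists>B. \<forall>p\<in>\<Omega>. f (pr p) * w p * q (iter_deriv us \<gamma> p) \<le> B"
    and \<epsilon>: "\<epsilon> > 0"
  shows "\<exists>C \<rho> R h. cutoff C X \<rho> R h \<and> (\<forall>(f, w, q, vs)\<in>T. \<forall>p\<in>\<Omega>.
    f (pr p) * w p * q (iter_deriv vs (\<lambda>p. h (pr p) *\<^sub>R \<gamma> p - \<gamma> p) p) \<le> \<epsilon>)"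
proof -
  obtain C :: "(real ^ 'j) list \<Rightarrow> real" where C: "\<And>X \<rho> R. \<rho> > 0 \<Longrightarrow> \<exists>h. cutoff C X \<rho> R h"
    using exists_cutoff by blast
  define P where "P c \<rho> R \<longleftrightarrow> (\<forall>h. cutoff C X \<rho> R h \<longrightarrow> (case c of (f, w, q, vs) \<Rightarrow> \<forall>p\<in>\<Omega>.
    f (pr p) * w p * q (iter_deriv vs (\<lambda>p. h (pr p) *\<^sub>R \<gamma> p - \<gamma> p) p) \<le> \<epsilon>))" for c \<rho> R
  have "\<forall>\<^sub>F \<rho> in at_right 0. \<forall>\<^sub>F R in at_top. P c \<rho> R" if c: "c \<in> T" for c
  proof -
    obtain f w q vs where cc: "c = (f, w, q, vs)" by (cases c)
    then have cT: "f \<in> W" "w \<in> W'" "q \<in> Q'" "q \<in> Q" "adm vs" using T c Q' by blast+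
    have "\<forall>\<^sub>F \<rho> in at_right 0. \<forall>\<^sub>F R in at_top. \<forall>h. cutoff C X \<rho> R h \<longrightarrow>
      (\<forall>p\<in>\<Omega>. \<bar>f (pr p)\<bar> * w p * q (iter_deriv vs (\<lambda>p. h (pr p) *\<^sub>R \<gamma> p - \<gamma> p) p) \<le> \<epsilon>)"
    proof (rule eventually_cutoff_close[OF cT(4)])
      show "0 \<le> w p" "w (p + emb s) = w p" for p s using W' cT(2) by auto
      show "vanishing_over \<Omega> pr X (\<lambda>p. \<bar>iter_deriv as f (pr p)\<bar> * w p * q (iter_deriv us \<gamma> p))"
        if "set as \<subseteq> axes" "enat (length as) \<le> k" "adm us" for as us
        by (rule weighted_vanishing[where W = W]) (use that cT W o W'(1) bounded in auto)
    qed (use cT W_diff \<epsilon> in auto)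
    moreover have "\<bar>f (pr p)\<bar> = f (pr p)" if "p \<in> \<Omega>" for p
      using W_nonneg[OF cT(1) pr_\<Omega>[OF that]] by simp
    ultimately show ?thesis unfolding P_def cc by simp
  qed
  then have "\<forall>\<^sub>F \<rho> in at_right 0. \<forall>c\<in>T. \<forall>\<^sub>F R in at_top. P c \<rho> R"
    by (intro eventually_ball_finite[OF fin] ballI)
  moreover have "\<forall>\<^sub>F \<rho>::real in at_right 0. 0 < \<rho>"
    by (rule eventually_at_right_less)
  ultimately have "\<forall>\<^sub>F \<rho> in at_right 0. (\<forall>c\<in>T. \<forall>\<^sub>F R in at_top. P c \<rho> R) \<and> 0 < \<rho>"
    by eventually_elim auto
  then obtain \<rho> where \<rho>: "\<forall>c\<in>T. \<forall>\<^sub>F R in at_top. P c \<rho> R" "0 < \<rho>"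
    using eventually_happens'[OF trivial_limit_at_right_real] by blast
  have "\<forall>\<^sub>F R in at_top. \<forall>c\<in>T. P c \<rho> R"
    by (rule eventually_ball_finite[OF fin \<rho>(1)])
  then obtain R where R: "\<forall>c\<in>T. P c \<rho> R"
    using eventually_happens'[OF trivial_limit_at_top_linorder] by blast
  obtain h where "cutoff C X \<rho> R h" using C[OF \<rho>(2)] by blast
  with R show ?thesis unfolding P_def by blast
qed

end

context seminorm_space
begin

lemma x_block:
  fixes \<gamma> :: "(real, 'n::{finite, linorder}) vec \<times> (real, 'm::{finite, linorder}) vec \<Rightarrow> 'e"
  assumes \<gamma>: "\<gamma> \<in> Ckl k l U V" and UV: "open U" "open V"
  shows "regular_on_block Q (\<lambda>s. (s, 0)) fst (U \<times> V) U \<gamma> (coord_dirs_le k l) k"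
proof (intro regular_on_block.intro seminorm_block.intro coordinate_block.intro regular_on_block_axioms.intro)
  show "seminorm_space Q" by (rule seminorm_space_axioms)
  show "linear (\<lambda>s::(real, 'n) vec. (s, 0 :: (real, 'm) vec))" by (rule linearI) auto
  show "bounded_linear (fst :: (real, 'n) vec \<times> (real, 'm) vec \<Rightarrow> _)" by (rule bounded_linear_fst)
  show "open (U \<times> V)" using UV by (rule open_Times)
next
  fix vs ws :: "((real, 'n) vec \<times> (real, 'm) vec) list"
  show "coord_dirs_le k l vs \<Longrightarrow> mset ws \<subseteq># mset vs \<Longrightarrow> coord_dirs_le k l ws" by (rule coord_dirs_le_sub)
  show "v \<in> range (\<lambda>j. (axis j 1, 0)) \<or> fst v = 0" if "coord_dirs_le k l vs" "v \<in> set vs" for v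
    using that by (auto simp: coord_dirs_le_def x_dirs_def y_dirs_def)
  have filt: "filter (\<lambda>v. snd v = 0) us = us" "filter (\<lambda>v. snd v \<noteq> 0) us = []"
    if "set us \<subseteq> range (\<lambda>j. (axis j 1, 0))" for us :: "((real, 'n) vec \<times> (real, 'm) vec) list"
    using that by (auto simp: filter_id_conv filter_empty_conv)
  show "enat (length vs) \<le> k" if "coord_dirs_le k l vs" "set vs \<subseteq> range (\<lambda>j. (axis j 1, 0))"
    using that filt[OF that(2)] by (simp add: coord_dirs_le_def)
  show "coord_dirs_le k l (bs @ vs)" if "coord_dirs_le k l (as @ vs)" "set as \<subseteq> range (\<lambda>j. (axis j 1, 0))"
    "set bs \<subseteq> range (\<lambda>j. (axis j 1, 0))" "length bs = length as" for as bs
    using that filt[OF that(2)] filt[OF that(3)] by (simp add: coord_dirs_le_def x_dirs_def le_supI1)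
  show "coord_dirs_le k l vs \<Longrightarrow> iter_differentiable_on (U \<times> V) vs \<gamma>"
    "coord_dirs_le k l vs \<Longrightarrow> continuous_on (U \<times> V) (iter_deriv vs \<gamma>)"
    using Ckl_iter_deriv[OF \<gamma> UV] by auto
qed (use UV in auto)

lemma y_block:
  fixes \<gamma> :: "(real, 'n::{finite, linorder}) vec \<times> (real, 'm::{finite, linorder}) vec \<Rightarrow> 'e"
  assumes \<gamma>: "\<gamma> \<in> Ckl k l U V" and UV: "open U" "open V"
  shows "regular_on_block Q (\<lambda>s. (0, s)) snd (U \<times> V) V \<gamma> (coord_dirs_le k l) l"
proof (intro regular_on_block.intro seminorm_block.intro coordinate_block.intro regular_on_block_axioms.intro)
  show "seminorm_space Q" by (rule seminorm_space_axioms)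
  show "linear (\<lambda>s::(real, 'm) vec. (0 :: (real, 'n) vec, s))" by (rule linearI) auto
  show "bounded_linear (snd :: (real, 'n) vec \<times> (real, 'm) vec \<Rightarrow> _)" by (rule bounded_linear_snd)
  show "open (U \<times> V)" using UV by (rule open_Times)
next
  fix vs ws :: "((real, 'n) vec \<times> (real, 'm) vec) list"
  show "coord_dirs_le k l vs \<Longrightarrow> mset ws \<subseteq># mset vs \<Longrightarrow> coord_dirs_le k l ws" by (rule coord_dirs_le_sub)
  show "v \<in> range (\<lambda>j. (0, axis j 1)) \<or> snd v = 0" if "coord_dirs_le k l vs" "v \<in> set vs" for v
    using that by (auto simp: coord_dirs_le_def x_dirs_def y_dirs_def)
  have filt: "filter (\<lambda>v. snd v = 0) us = []" "filter (\<lambda>v. snd v \<noteq> 0) us = us"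
    if "set us \<subseteq> range (\<lambda>j. (0, axis j 1))" for us :: "((real, 'n) vec \<times> (real, 'm) vec) list"
    using that by (auto simp: filter_id_conv filter_empty_conv)
  show "enat (length vs) \<le> l" if "coord_dirs_le k l vs" "set vs \<subseteq> range (\<lambda>j. (0, axis j 1))"
    using that filt[OF that(2)] by (simp add: coord_dirs_le_def)
  show "coord_dirs_le k l (bs @ vs)" if "coord_dirs_le k l (as @ vs)" "set as \<subseteq> range (\<lambda>j. (0, axis j 1))"
    "set bs \<subseteq> range (\<lambda>j. (0, axis j 1))" "length bs = length as" for as bs
    using that filt[OF that(2)] filt[OF that(3)] by (simp add: coord_dirs_le_def y_dirs_def le_supI2)
  show "coord_dirs_le k l vs \<Longrightarrow> iter_differentiable_on (U \<times> V) vs \<gamma>"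
    "coord_dirs_le k l vs \<Longrightarrow> continuous_on (U \<times> V) (iter_deriv vs \<gamma>)"
    using Ckl_iter_deriv[OF \<gamma> UV] by auto
qed (use UV in auto)

end

lemma weighted_seminorm_le:
  assumes "\<And>p. p \<in> U \<times> V \<Longrightarrow> f p * q (partial_deriv2 \<alpha> \<beta> \<gamma> p) \<le> B"
  shows "weighted_seminorm U V f \<alpha> \<beta> q \<gamma> \<le> ennreal B"
  unfolding weighted_seminorm_def using assms by (intro SUP_least ennreal_leI)

lemma weighted_seminorm_finite_iff:
  "weighted_seminorm U V f \<alpha> \<beta> q \<gamma> < \<infinity> \<longleftrightarrow> (\<exists>B. \<forall>p\<in>U \<times> V. f p * q (partial_deriv2 \<alpha> \<beta> \<gamma> p) \<le> B)"
proof
  assume fin: "weighted_seminorm U V f \<alpha> \<beta> q \<gamma> < \<infinity>"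
  have "f p * q (partial_deriv2 \<alpha> \<beta> \<gamma> p) \<le> enn2real (weighted_seminorm U V f \<alpha> \<beta> q \<gamma>)" if "p \<in> U \<times> V" for p
  proof -
    have "ennreal (f p * q (partial_deriv2 \<alpha> \<beta> \<gamma> p)) \<le> weighted_seminorm U V f \<alpha> \<beta> q \<gamma>"
      unfolding weighted_seminorm_def using that by (rule SUP_upper)
    also have "\<dots> = ennreal (enn2real (weighted_seminorm U V f \<alpha> \<beta> q \<gamma>))" using fin by simp
    finally show ?thesis by (simp add: ennreal_le_iff)
  qed
  then show "\<exists>B. \<forall>p\<in>U \<times> V. f p * q (partial_deriv2 \<alpha> \<beta> \<gamma> p) \<le> B" by blast
next
  assume "\<exists>B. \<forall>p\<in>U \<times> V. f p * q (partial_deriv2 \<alpha> \<beta> \<gamma> p) \<le> B"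
  then obtain B where "\<And>p. p \<in> U \<times> V \<Longrightarrow> f p * q (partial_deriv2 \<alpha> \<beta> \<gamma> p) \<le> B" by blast
  from weighted_seminorm_le[of U V f q \<alpha> \<beta> \<gamma> B, OF this] show "weighted_seminorm U V f \<alpha> \<beta> q \<gamma> < \<infinity>"
    unfolding infinity_ennreal_def by (rule order_le_less_trans[OF _ ennreal_less_top])
qed

lemma mi_order_0: "mi_order (\<lambda>_. 0) = 0"
  by (simp add: mi_order_def zero_enat_def)

lemma mi_dirs_0: "mi_dirs (\<lambda>_. 0 :: nat) = []"
  by (simp add: mi_dirs_def)

locale weighted_space = locally_convex_space smul
  for smul :: "'k::real_normed_field \<Rightarrow> 'e \<Rightarrow> 'e::{real_vector, topological_ab_group_add, t2_space}" +
  fixes U :: "(real, 'n::{finite, linorder}) vec set"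
    and V :: "(real, 'm::{finite, linorder}) vec set"
    and k l :: enat
    and W1 :: "((real, 'n) vec \<Rightarrow> real) set"
    and W2 :: "((real, 'm) vec \<Rightarrow> real) set"
  assumes open_U: "open U" and open_V: "open V"
    and W1_Ck: "W1 \<subseteq> Ck_nonneg k U" and W1_weights: "set_of_weights U W1"
    and W1_o: "o_condition U W1"
    and W1_deriv: "\<And>f \<alpha>. f \<in> W1 \<Longrightarrow> mi_order \<alpha> \<le> k \<Longrightarrow> \<exists>g\<in>W1. \<forall>x\<in>U. \<bar>partial_deriv \<alpha> f x\<bar> \<le> g x"
    and W2_Ck: "W2 \<subseteq> Ck_nonneg l V" and W2_weights: "set_of_weights V W2"
    and W2_o: "o_condition V W2"
    and W2_deriv: "\<And>f \<beta>. f \<in> W2 \<Longrightarrow> mi_order \<beta> \<le> l \<Longrightarrow> \<exists>g\<in>W2. \<forall>y\<in>V. \<bar>partial_deriv \<beta> f y\<bar> \<le> g y"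
begin

sublocale S: seminorm_space "real_seminorms :: ('e \<Rightarrow> real) set"
  by (rule seminorm_space_real_seminorms) (rule locally_convex_space_axioms)

abbreviation "W \<equiv> tensor_weights U V W1 W2"
abbreviation "weighted \<equiv> weighted_Ckl smul k l U V W"

lemma open_UV: "open (U \<times> V)"
  using open_U open_V by (rule open_Times)

lemma q_real: "q \<in> continuous_seminorms smul \<Longrightarrow> q \<in> real_seminorms"
  using continuous_seminorms_subset by blast

lemma W1_nonneg: "f \<in> W1 \<Longrightarrow> x \<in> U \<Longrightarrow> 0 \<le> f x"
  using W1_weights by (auto simp: set_of_weights_def PiE_iff subset_iff)

lemma W2_nonneg: "f \<in> W2 \<Longrightarrow> x \<in> V \<Longrightarrow> 0 \<le> f x"
  using W2_weights by (auto simp: set_of_weights_def PiE_iff subset_iff)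

lemma W_E:
  assumes "f \<in> W"
  obtains f1 f2 where "f1 \<in> W1" "f2 \<in> W2" "\<And>p. p \<in> U \<times> V \<Longrightarrow> f p = f1 (fst p) * f2 (snd p)"
  using assms by (auto simp: tensor_weights_def)

lemma W_I:
  assumes "f1 \<in> W1" "f2 \<in> W2"
  shows "(\<lambda>(x, y)\<in>U \<times> V. f1 x * f2 y) \<in> W"
  using assms by (auto simp: tensor_weights_def)

lemma W_nonneg: "f \<in> W \<Longrightarrow> p \<in> U \<times> V \<Longrightarrow> 0 \<le> f p"
  by (erule W_E) (force intro: mult_nonneg_nonneg[OF W1_nonneg W2_nonneg])

lemma weighted_bound:
  assumes "\<gamma> \<in> weighted" "f \<in> W" "q \<in> continuous_seminorms smul" "coord_dirs_le k l vs"
  shows "\<exists>B. \<forall>p\<in>U \<times> V. f p * q (iter_deriv vs \<gamma> p) \<le> B"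
proof -
  have \<gamma>: "\<gamma> \<in> Ckl k l U V" using assms(1) by (simp add: weighted_Ckl_def)
  obtain \<alpha> \<beta> where ab: "mi_order \<alpha> \<le> k" "mi_order \<beta> \<le> l"
    "\<forall>p\<in>U \<times> V. iter_deriv vs \<gamma> p = partial_deriv2 \<alpha> \<beta> \<gamma> p"
    using S.Ckl_iter_deriv(3)[OF \<gamma> open_U open_V assms(4)] by blast
  have "weighted_seminorm U V f \<alpha> \<beta> q \<gamma> < \<infinity>"
    using assms ab by (simp add: weighted_Ckl_def)
  then show ?thesis unfolding weighted_seminorm_finite_iff using ab(3) by auto
qed

lemma cut_weighted:
  fixes emb :: "real ^ 'j \<Rightarrow> (real, 'n) vec \<times> (real, 'm) vec"
  assumes \<gamma>: "\<gamma> \<in> weighted"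
    and block: "regular_on_block real_seminorms emb pr (U \<times> V) X \<gamma> (coord_dirs_le k l) \<kappa>"
    and h: "cutoff C X \<rho> R h"
  shows "restrict (\<lambda>p. h (pr p) *\<^sub>R \<gamma> p) (U \<times> V) \<in> weighted"
proof -
  interpret B: regular_on_block real_seminorms emb pr "U \<times> V" X \<gamma> "coord_dirs_le k l" \<kappa> by (rule block)
  define \<eta> where "\<eta> = restrict (\<lambda>p. h (pr p) *\<^sub>R \<gamma> p) (U \<times> V)"
  have eq: "\<eta> p = h (pr p) *\<^sub>R \<gamma> p" if "p \<in> U \<times> V" for p
    unfolding \<eta>_def by (rule restrict_apply'[OF that])
  have D_eq: "iter_deriv vs \<eta> p = iter_deriv vs (\<lambda>p. h (pr p) *\<^sub>R \<gamma> p) p" if "p \<in> U \<times> V" for vs p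
    by (rule iter_deriv_cong[OF open_UV eq that])
  have diff_eq: "iter_differentiable_on (U \<times> V) vs \<eta> \<longleftrightarrow> iter_differentiable_on (U \<times> V) vs (\<lambda>p. h (pr p) *\<^sub>R \<gamma> p)" for vs
    by (rule iter_differentiable_on_cong[OF open_UV eq])
  have "\<eta> \<in> Ckl k l U V"
    unfolding Ckl_def
  proof (intro CollectI conjI allI impI)
    show "\<eta> \<in> U \<times> V \<rightarrow>\<^sub>E UNIV" by (simp add: \<eta>_def PiE_iff)
    fix \<alpha> :: "'n \<Rightarrow> nat" and \<beta> :: "'m \<Rightarrow> nat" assume "mi_order \<alpha> \<le> k" "mi_order \<beta> \<le> l"
    then have ok: "coord_dirs_le k l (mi_dirs2 \<alpha> \<beta>)" by (rule coord_dirs_le_mi_dirs2)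
    show "iter_differentiable_on (U \<times> V) (mi_dirs2 \<alpha> \<beta>) \<eta>"
      unfolding diff_eq by (rule B.iter_deriv_cutoff_scaleR(1)[OF h ok])
    show "continuous_on (U \<times> V) (partial_deriv2 \<alpha> \<beta> \<eta>)"
      by (rule continuous_on_eq[OF B.continuous_on_iter_deriv_cutoff_scaleR[OF h ok]]) (rule D_eq[symmetric])
  qed
  moreover have "weighted_seminorm U V f \<alpha> \<beta> q \<eta> < \<infinity>"
    if f: "f \<in> W" and q: "q \<in> continuous_seminorms smul" and ab: "mi_order \<alpha> \<le> k" "mi_order \<beta> \<le> l"
    for f q and \<alpha> :: "'n \<Rightarrow> nat" and \<beta> :: "'m \<Rightarrow> nat"
  proof -
    define vs where "vs = mi_dirs2 \<alpha> \<beta>"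
    have ok: "coord_dirs_le k l vs" unfolding vs_def using ab by (rule coord_dirs_le_mi_dirs2)
    have "\<forall>us. \<exists>b. coord_dirs_le k l us \<longrightarrow> (\<forall>p\<in>U \<times> V. f p * q (iter_deriv us \<gamma> p) \<le> b)"
      using weighted_bound[OF \<gamma> f q] by blast
    then obtain b where b: "\<And>us p. coord_dirs_le k l us \<Longrightarrow> p \<in> U \<times> V \<Longrightarrow> f p * q (iter_deriv us \<gamma> p) \<le> b us"
      by metis
    have "f p * q (partial_deriv2 \<alpha> \<beta> \<eta> p) \<le> (\<Sum>(as, bs)\<leftarrow>splits vs. \<bar>C (map pr as) * (1 / \<rho>) ^ length as\<bar> * b bs)"
      if p: "p \<in> U \<times> V" for p
    proof -
      have "q (partial_deriv2 \<alpha> \<beta> \<eta> p) \<le> (\<Sum>(as, bs)\<leftarrow>splits vs. C (map pr as) * (1 / \<rho>) ^ length as * q (iter_deriv bs \<gamma> p))"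
        using B.seminorm_iter_deriv_cutoff_scaleR[OF h ok q_real[OF q] p] D_eq[OF p] unfolding vs_def by simp
      then have "f p * q (partial_deriv2 \<alpha> \<beta> \<eta> p) \<le>
          f p * (\<Sum>(as, bs)\<leftarrow>splits vs. C (map pr as) * (1 / \<rho>) ^ length as * q (iter_deriv bs \<gamma> p))"
        using W_nonneg[OF f p] by (rule mult_left_mono)
      also have "\<dots> = (\<Sum>(as, bs)\<leftarrow>splits vs. C (map pr as) * (1 / \<rho>) ^ length as * (f p * q (iter_deriv bs \<gamma> p)))"
        by (simp add: sum_list_const_mult[symmetric] case_prod_unfold mult_ac)
      also have "\<dots> \<le> (\<Sum>(as, bs)\<leftarrow>splits vs. \<bar>C (map pr as) * (1 / \<rho>) ^ length as\<bar> * b bs)"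
      proof (intro sum_list_mono, clarify)
        fix as bs assume "(as, bs) \<in> set (splits vs)"
        then have "f p * q (iter_deriv bs \<gamma> p) \<le> b bs"
          using b B.adm_splits(2)[OF ok] p by blast
        moreover have "0 \<le> f p * q (iter_deriv bs \<gamma> p)"
          using W_nonneg[OF f p] S.Q_nonneg[OF q_real[OF q]] by simp
        ultimately show "C (map pr as) * (1 / \<rho>) ^ length as * (f p * q (iter_deriv bs \<gamma> p)) \<le>
            \<bar>C (map pr as) * (1 / \<rho>) ^ length as\<bar> * b bs"
          by (intro mult_mono) auto
      qed
      finally show ?thesis .
    qed
    then show ?thesis unfolding weighted_seminorm_finite_iff by blast
  qed
  ultimately show ?thesis unfolding \<eta>_def[symmetric] weighted_Ckl_def by blast
qed

text \<open>
  Cutting off in one factor only. The sets \<open>A\<close> and \<open>P\<close> contain the weights on this factor and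
  those on the other one, the latter as functions on the whole space.
\<close>

lemma approx_block:
  fixes emb :: "(real, 'j::{finite, linorder}) vec \<Rightarrow> (real, 'n) vec \<times> (real, 'm) vec"
  assumes \<gamma>: "\<gamma> \<in> weighted"
    and block: "regular_on_block real_seminorms emb pr (U \<times> V) X \<gamma> (coord_dirs_le k l) \<kappa>"
    and A: "A \<subseteq> Ck_nonneg \<kappa> X" "o_condition X A" "\<And>f x. f \<in> A \<Longrightarrow> x \<in> X \<Longrightarrow> 0 \<le> f x"
    and A_deriv: "\<And>f \<alpha>. f \<in> A \<Longrightarrow> mi_order \<alpha> \<le> \<kappa> \<Longrightarrow> \<exists>g\<in>A. \<forall>x\<in>X. \<bar>partial_deriv \<alpha> f x\<bar> \<le> g x"
    and P: "\<And>w p. w \<in> P \<Longrightarrow> 0 \<le> w p" "\<And>w p s. w \<in> P \<Longrightarrow> w (p + emb s) = w p"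
    and AP: "\<And>f w. f \<in> A \<Longrightarrow> w \<in> P \<Longrightarrow> \<exists>g\<in>W. \<forall>p\<in>U \<times> V. g p = f (pr p) * w p"
    and fin: "finite T"
    and T: "\<And>f w q vs. (f, w, q, vs) \<in> T \<Longrightarrow> f \<in> A \<and> w \<in> P \<and> q \<in> continuous_seminorms smul \<and> coord_dirs_le k l vs"
    and \<epsilon>: "\<epsilon> > 0"
  shows "\<exists>\<eta>\<in>weighted. (\<exists>K. compact K \<and> K \<subseteq> X \<and> (\<forall>p\<in>U \<times> V. pr p \<notin> K \<longrightarrow> \<eta> p = 0)) \<and>
    (\<forall>p\<in>U \<times> V. \<gamma> p = 0 \<longrightarrow> \<eta> p = 0) \<and>
    (\<forall>(f, w, q, vs)\<in>T. \<forall>p\<in>U \<times> V. f (pr p) * w p * q (iter_deriv vs (\<lambda>p. \<eta> p - \<gamma> p) p) \<le> \<epsilon>)"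
proof -
  interpret B: regular_on_block real_seminorms emb pr "U \<times> V" X \<gamma> "coord_dirs_le k l" \<kappa> by (rule block)
  have "\<exists>C \<rho> R h. cutoff C X \<rho> R h \<and> (\<forall>(f, w, q, vs)\<in>T. \<forall>p\<in>U \<times> V.
    f (pr p) * w p * q (iter_deriv vs (\<lambda>p. h (pr p) *\<^sub>R \<gamma> p - \<gamma> p) p) \<le> \<epsilon>)"
  proof (rule B.exists_close_cutoff[where W = A and W' = P and Q' = "continuous_seminorms smul"])
    show "finite T" "continuous_seminorms smul \<subseteq> real_seminorms" "o_condition X A" "\<epsilon> > 0"
      by (rule fin continuous_seminorms_subset A(2) \<epsilon>)+
    show "0 \<le> f x" if "f \<in> A" "x \<in> X" for f x using that by (rule A(3))
    show "0 \<le> w p" "w (p + emb s) = w p" if "w \<in> P" for w p s using P that by blast+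
    show "f \<in> A \<and> w \<in> P \<and> q \<in> continuous_seminorms smul \<and> coord_dirs_le k l vs"
      if "(f, w, q, vs) \<in> T" for f w q vs
      using that by (rule T)
    show "iter_differentiable_on X as f" if "f \<in> A" "set as \<subseteq> range (\<lambda>j. axis j 1)" "enat (length as) \<le> \<kappa>" for f as
      using Ck_nonneg_iter_deriv(1)[OF _ B.open_X] that A(1) by blast
    show "\<exists>g\<in>A. \<forall>x\<in>X. \<bar>iter_deriv as f x\<bar> \<le> g x"
      if f: "f \<in> A" and as: "set as \<subseteq> range (\<lambda>j. axis j 1)" "enat (length as) \<le> \<kappa>" for f as
    proof -
      obtain \<alpha> where "mi_order \<alpha> \<le> \<kappa>" "\<forall>x\<in>X. iter_deriv as f x = partial_deriv \<alpha> f x"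
        using Ck_nonneg_iter_deriv(2)[OF _ B.open_X as] f A(1) by blast
      then show ?thesis using A_deriv[OF f] by fastforce
    qed
    show "\<exists>B. \<forall>p\<in>U \<times> V. f (pr p) * w p * q (iter_deriv us \<gamma> p) \<le> B"
      if fw: "f \<in> A" "w \<in> P" and q: "q \<in> continuous_seminorms smul" and us: "coord_dirs_le k l us" for f w q us
    proof -
      obtain g where g: "g \<in> W" "\<forall>p\<in>U \<times> V. g p = f (pr p) * w p" using AP[OF fw] by blast
      obtain B where "\<forall>p\<in>U \<times> V. g p * q (iter_deriv us \<gamma> p) \<le> B"
        using weighted_bound[OF \<gamma> g(1) q us] by blast
      then show ?thesis using g(2) by (intro exI[of _ B]) simp
    qed
  qed
  then obtain C \<rho> R h where h: "cutoff C X \<rho> R h"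
    and close: "\<And>f w q vs p. (f, w, q, vs) \<in> T \<Longrightarrow> p \<in> U \<times> V \<Longrightarrow>
      f (pr p) * w p * q (iter_deriv vs (\<lambda>p. h (pr p) *\<^sub>R \<gamma> p - \<gamma> p) p) \<le> \<epsilon>"
    by blast
  define \<eta> where "\<eta> = restrict (\<lambda>p. h (pr p) *\<^sub>R \<gamma> p) (U \<times> V)"
  have eq: "\<eta> p = h (pr p) *\<^sub>R \<gamma> p" if "p \<in> U \<times> V" for p
    unfolding \<eta>_def by (rule restrict_apply'[OF that])
  obtain K where K: "compact K" "K \<subseteq> X" "\<And>x. x \<notin> K \<Longrightarrow> h x = 0"
    using h unfolding cutoff_def by blast
  have "iter_deriv vs (\<lambda>p. \<eta> p - \<gamma> p) p = iter_deriv vs (\<lambda>p. h (pr p) *\<^sub>R \<gamma> p - \<gamma> p) p" if "p \<in> U \<times> V" for vs p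
    by (rule iter_deriv_cong[OF open_UV _ that]) (simp add: eq)
  then have "\<forall>(f, w, q, vs)\<in>T. \<forall>p\<in>U \<times> V. f (pr p) * w p * q (iter_deriv vs (\<lambda>p. \<eta> p - \<gamma> p) p) \<le> \<epsilon>"
    using close by auto
  moreover have "\<eta> \<in> weighted" using cut_weighted[OF \<gamma> block h, folded \<eta>_def] .
  moreover have "\<exists>K. compact K \<and> K \<subseteq> X \<and> (\<forall>p\<in>U \<times> V. pr p \<notin> K \<longrightarrow> \<eta> p = 0)"
    using K eq by (intro exI[of _ K]) simp
  moreover have "\<forall>p\<in>U \<times> V. \<gamma> p = 0 \<longrightarrow> \<eta> p = 0" using eq by simp
  ultimately show ?thesis by blast
qed

lemma Ckl_diff:
  fixes \<gamma> \<eta> :: "(real, 'n) vec \<times> (real, 'm) vec \<Rightarrow> 'e"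
  assumes "\<gamma> \<in> Ckl k l U V" "\<eta> \<in> Ckl k l U V" "coord_dirs_le k l vs" "p \<in> U \<times> V"
  shows "iter_deriv vs (\<lambda>p. \<eta> p - \<gamma> p) p = iter_deriv vs \<eta> p - iter_deriv vs \<gamma> p"
  by (rule S.iter_deriv_diff(2)[OF open_UV S.Ckl_iter_deriv(1)[OF assms(2) open_U open_V assms(3)]
        S.Ckl_iter_deriv(1)[OF assms(1) open_U open_V assms(3)] assms(4)])

text \<open>
  The function is cut off in the first factor, and the result, which belongs to the weighted space
  again, in the second one. The second step does not enlarge the support, so that the final
  support lies in a product of compact sets.
\<close>

lemma approx_compact_supp:
  assumes \<gamma>: "\<gamma> \<in> weighted" and fin: "finite T"
    and T: "\<And>f \<alpha> \<beta> q. (f, \<alpha>, \<beta>, q) \<in> T \<Longrightarrow> f \<in> W \<and> mi_order \<alpha> \<le> k \<and> mi_order \<beta> \<le> l \<and> q \<in> continuous_seminorms smul"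
    and \<epsilon>: "\<epsilon> > 0"
  shows "\<exists>\<eta>\<in>weighted \<inter> Ckl_compact_supp k l U V. \<forall>(f, \<alpha>, \<beta>, q)\<in>T.
    weighted_seminorm U V f \<alpha> \<beta> q (\<lambda>p. \<eta> p - \<gamma> p) \<le> ennreal \<epsilon>"
proof -
  have "\<forall>f\<in>W. \<exists>c. fst c \<in> W1 \<and> snd c \<in> W2 \<and> (\<forall>p\<in>U \<times> V. f p = fst c (fst p) * snd c (snd p))"
  proof
    fix f assume "f \<in> W"
    then obtain f1 f2 where "f1 \<in> W1" "f2 \<in> W2" "\<And>p. p \<in> U \<times> V \<Longrightarrow> f p = f1 (fst p) * f2 (snd p)"
      using W_E by blast
    then show "\<exists>c. fst c \<in> W1 \<and> snd c \<in> W2 \<and> (\<forall>p\<in>U \<times> V. f p = fst c (fst p) * snd c (snd p))"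
      by (intro exI[of _ "(f1, f2)"]) simp
  qed
  then obtain c where c: "\<And>f. f \<in> W \<Longrightarrow> fst (c f) \<in> W1 \<and> snd (c f) \<in> W2 \<and> (\<forall>p\<in>U \<times> V. f p = fst (c f) (fst p) * snd (c f) (snd p))"
    by metis
  (* Weights are extended by 0 off their domains, where they need not be nonnegative. *)
  define x_w where "x_w = (\<lambda>f (p :: (real, 'n) vec \<times> (real, 'm) vec). if fst p \<in> U then f (fst p) else 0 :: real)"
  define y_w where "y_w = (\<lambda>f (p :: (real, 'n) vec \<times> (real, 'm) vec). if snd p \<in> V then f (snd p) else 0 :: real)"
  define Tx where "Tx = (\<lambda>(f, \<alpha>, \<beta>, q). (fst (c f), y_w (snd (c f)), q, mi_dirs2 \<alpha> \<beta>)) ` T"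
  define Ty where "Ty = (\<lambda>(f, \<alpha>, \<beta>, q). (snd (c f), x_w (fst (c f)), q, mi_dirs2 \<alpha> \<beta>)) ` T"
  have \<gamma>': "\<gamma> \<in> Ckl k l U V" using \<gamma> by (simp add: weighted_Ckl_def)
  have "\<exists>\<eta>\<in>weighted. (\<exists>K. compact K \<and> K \<subseteq> U \<and> (\<forall>p\<in>U \<times> V. fst p \<notin> K \<longrightarrow> \<eta> p = 0)) \<and>
    (\<forall>p\<in>U \<times> V. \<gamma> p = 0 \<longrightarrow> \<eta> p = 0) \<and>
    (\<forall>(f, w, q, vs)\<in>Tx. \<forall>p\<in>U \<times> V. f (fst p) * w p * q (iter_deriv vs (\<lambda>p. \<eta> p - \<gamma> p) p) \<le> \<epsilon> / 2)"
  proof (rule approx_block[OF \<gamma> S.x_block[OF \<gamma>' open_U open_V], where A = W1 and P = "y_w ` W2"])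
    show "\<exists>g\<in>W. \<forall>p\<in>U \<times> V. g p = f (fst p) * w p" if f: "f \<in> W1" and w: "w \<in> y_w ` W2" for f w
    proof -
      obtain f2 where "w = y_w f2" "f2 \<in> W2" using w by (rule imageE)
      then show ?thesis by (intro bexI[OF _ W_I[OF f \<open>f2 \<in> W2\<close>]]) (auto simp: y_w_def)
    qed
    show "f \<in> W1 \<and> w \<in> y_w ` W2 \<and> q \<in> continuous_seminorms smul \<and> coord_dirs_le k l vs"
      if "(f, w, q, vs) \<in> Tx" for f w q vs
      using that T c coord_dirs_le_mi_dirs2 unfolding Tx_def by fastforce
    show "finite Tx" unfolding Tx_def using fin by simp
  qed (use W1_Ck W1_o W1_nonneg W1_deriv W2_nonneg \<epsilon> in \<open>auto simp: y_w_def\<close>)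
  then obtain \<gamma>1 where \<gamma>1: "\<gamma>1 \<in> weighted"
    and ex_K1: "\<exists>K. compact K \<and> K \<subseteq> U \<and> (\<forall>p\<in>U \<times> V. fst p \<notin> K \<longrightarrow> \<gamma>1 p = 0)"
    and all_Tx: "\<forall>(f, w, q, vs)\<in>Tx. \<forall>p\<in>U \<times> V. f (fst p) * w p * q (iter_deriv vs (\<lambda>p. \<gamma>1 p - \<gamma> p) p) \<le> \<epsilon> / 2"
    by (elim bexE conjE)
  obtain K1 where K1: "compact K1" "K1 \<subseteq> U" "\<forall>p\<in>U \<times> V. fst p \<notin> K1 \<longrightarrow> \<gamma>1 p = 0"
    using ex_K1 by (elim exE conjE)
  have close1: "f (fst p) * w p * q (iter_deriv vs (\<lambda>p. \<gamma>1 p - \<gamma> p) p) \<le> \<epsilon> / 2"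
    if "(f, w, q, vs) \<in> Tx" "p \<in> U \<times> V" for f w q vs p
    by (rule bspec[OF bspec[OF all_Tx that(1), unfolded prod.case] that(2)])
  have \<gamma>1': "\<gamma>1 \<in> Ckl k l U V" using \<gamma>1 by (simp add: weighted_Ckl_def)
  have "\<exists>\<eta>\<in>weighted. (\<exists>K. compact K \<and> K \<subseteq> V \<and> (\<forall>p\<in>U \<times> V. snd p \<notin> K \<longrightarrow> \<eta> p = 0)) \<and>
    (\<forall>p\<in>U \<times> V. \<gamma>1 p = 0 \<longrightarrow> \<eta> p = 0) \<and>
    (\<forall>(f, w, q, vs)\<in>Ty. \<forall>p\<in>U \<times> V. f (snd p) * w p * q (iter_deriv vs (\<lambda>p. \<eta> p - \<gamma>1 p) p) \<le> \<epsilon> / 2)"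
  proof (rule approx_block[OF \<gamma>1 S.y_block[OF \<gamma>1' open_U open_V], where A = W2 and P = "x_w ` W1"])
    show "\<exists>g\<in>W. \<forall>p\<in>U \<times> V. g p = f (snd p) * w p" if f: "f \<in> W2" and w: "w \<in> x_w ` W1" for f w
    proof -
      obtain f1 where "w = x_w f1" "f1 \<in> W1" using w by (rule imageE)
      then show ?thesis by (intro bexI[OF _ W_I[OF \<open>f1 \<in> W1\<close> f]]) (auto simp: x_w_def)
    qed
    show "f \<in> W2 \<and> w \<in> x_w ` W1 \<and> q \<in> continuous_seminorms smul \<and> coord_dirs_le k l vs"
      if "(f, w, q, vs) \<in> Ty" for f w q vs
      using that T c coord_dirs_le_mi_dirs2 unfolding Ty_def by fastforce
    show "finite Ty" unfolding Ty_def using fin by simp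
  qed (use W2_Ck W2_o W2_nonneg W2_deriv W1_nonneg \<epsilon> in \<open>auto simp: x_w_def\<close>)
  then obtain \<eta> where \<eta>: "\<eta> \<in> weighted"
    and ex_K2: "\<exists>K. compact K \<and> K \<subseteq> V \<and> (\<forall>p\<in>U \<times> V. snd p \<notin> K \<longrightarrow> \<eta> p = 0)"
    and zero: "\<forall>p\<in>U \<times> V. \<gamma>1 p = 0 \<longrightarrow> \<eta> p = 0"
    and all_Ty: "\<forall>(f, w, q, vs)\<in>Ty. \<forall>p\<in>U \<times> V. f (snd p) * w p * q (iter_deriv vs (\<lambda>p. \<eta> p - \<gamma>1 p) p) \<le> \<epsilon> / 2"
    by (elim bexE conjE)
  obtain K2 where K2: "compact K2" "K2 \<subseteq> V" "\<forall>p\<in>U \<times> V. snd p \<notin> K2 \<longrightarrow> \<eta> p = 0"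
    using ex_K2 by (elim exE conjE)
  have close2: "f (snd p) * w p * q (iter_deriv vs (\<lambda>p. \<eta> p - \<gamma>1 p) p) \<le> \<epsilon> / 2"
    if "(f, w, q, vs) \<in> Ty" "p \<in> U \<times> V" for f w q vs p
    by (rule bspec[OF bspec[OF all_Ty that(1), unfolded prod.case] that(2)])
  have \<eta>': "\<eta> \<in> Ckl k l U V" using \<eta> by (simp add: weighted_Ckl_def)
  have supp: "{p \<in> U \<times> V. \<eta> p \<noteq> 0} \<subseteq> K1 \<times> K2"
  proof
    fix p assume p: "p \<in> {p \<in> U \<times> V. \<eta> p \<noteq> 0}"
    then have "fst p \<in> K1" "snd p \<in> K2" using bspec[OF K1(3), of p] bspec[OF K2(3), of p] bspec[OF zero, of p] by blast+
    then show "p \<in> K1 \<times> K2" by (simp add: mem_Times_iff)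
  qed
  have cK: "compact (K1 \<times> K2)" using K1(1) K2(1) by (rule compact_Times)
  have cl: "closure {p \<in> U \<times> V. \<eta> p \<noteq> 0} \<subseteq> K1 \<times> K2"
    using supp compact_imp_closed[OF cK] by (rule closure_minimal)
  have "closure {p \<in> U \<times> V. \<eta> p \<noteq> 0} \<subseteq> U \<times> V" using cl K1(2) K2(2) by blast
  then have "support_in (U \<times> V) \<eta> = K1 \<times> K2 \<inter> closure {p \<in> U \<times> V. \<eta> p \<noteq> 0}"
    unfolding support_in_def using cl by blast
  then have "compact (support_in (U \<times> V) \<eta>)"
    using cK by (simp add: compact_Int_closed)
  then have "\<eta> \<in> Ckl_compact_supp k l U V" using \<eta>' by (simp add: Ckl_compact_supp_def)
  moreover have "weighted_seminorm U V f \<alpha> \<beta> q (\<lambda>p. \<eta> p - \<gamma> p) \<le> ennreal \<epsilon>" if t: "(f, \<alpha>, \<beta>, q) \<in> T" for f \<alpha> \<beta> q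
  proof (rule weighted_seminorm_le)
    fix p assume p: "p \<in> U \<times> V"
    define vs where "vs = mi_dirs2 \<alpha> \<beta>"
    have f: "f \<in> W" and q: "q \<in> real_seminorms" and vs: "coord_dirs_le k l vs"
      using T[OF t] q_real coord_dirs_le_mi_dirs2 unfolding vs_def by auto
    have fp: "fst (c f) (fst p) * y_w (snd (c f)) p = f p" "snd (c f) (snd p) * x_w (fst (c f)) p = f p"
      using c[OF f] p by (auto simp: y_w_def x_w_def)
    have "(fst (c f), y_w (snd (c f)), q, vs) \<in> Tx" "(snd (c f), x_w (fst (c f)), q, vs) \<in> Ty"
      unfolding Tx_def Ty_def vs_def by (rule image_eqI[OF _ t], simp)+
    from close1[OF this(1) p] close2[OF this(2) p]
    have 1: "f p * q (iter_deriv vs (\<lambda>p. \<gamma>1 p - \<gamma> p) p) \<le> \<epsilon> / 2"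
      and 2: "f p * q (iter_deriv vs (\<lambda>p. \<eta> p - \<gamma>1 p) p) \<le> \<epsilon> / 2"
      unfolding fp by auto
    have "iter_deriv vs (\<lambda>p. \<eta> p - \<gamma> p) p = iter_deriv vs (\<lambda>p. \<eta> p - \<gamma>1 p) p + iter_deriv vs (\<lambda>p. \<gamma>1 p - \<gamma> p) p"
      using Ckl_diff[OF \<gamma>' \<eta>' vs p] Ckl_diff[OF \<gamma>1' \<eta>' vs p] Ckl_diff[OF \<gamma>' \<gamma>1' vs p] by simp
    then have "q (iter_deriv vs (\<lambda>p. \<eta> p - \<gamma> p) p) \<le> q (iter_deriv vs (\<lambda>p. \<eta> p - \<gamma>1 p) p) + q (iter_deriv vs (\<lambda>p. \<gamma>1 p - \<gamma> p) p)"
      using S.Q_add[OF q] by simp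
    from mult_left_mono[OF this W_nonneg[OF f p]]
    show "f p * q (partial_deriv2 \<alpha> \<beta> (\<lambda>p. \<eta> p - \<gamma> p) p) \<le> \<epsilon>"
      using 1 2 unfolding vs_def[symmetric] by (simp add: distrib_left)
  qed
  ultimately show ?thesis using \<eta> by (intro bexI[of _ \<eta>]) auto
qed

lemma continuous_on_weight1: "f \<in> W1 \<Longrightarrow> continuous_on U f"
proof -
  assume f: "f \<in> W1"
  have "mi_order (\<lambda>_. 0 :: nat) \<le> k" by (simp add: mi_order_0)
  then have "continuous_on U (partial_deriv (\<lambda>_. 0) f)"
    using f W1_Ck unfolding Ck_nonneg_def by blast
  then show "continuous_on U f" by (simp add: mi_dirs_0)
qed

lemma continuous_on_weight2: "f \<in> W2 \<Longrightarrow> continuous_on V f"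
proof -
  assume f: "f \<in> W2"
  have "mi_order (\<lambda>_. 0 :: nat) \<le> l" by (simp add: mi_order_0)
  then have "continuous_on V (partial_deriv (\<lambda>_. 0) f)"
    using f W2_Ck unfolding Ck_nonneg_def by blast
  then show "continuous_on V f" by (simp add: mi_dirs_0)
qed

lemma compact_supp_weighted: "Ckl_compact_supp k l U V \<subseteq> weighted"
proof
  fix \<gamma> :: "(real, 'n) vec \<times> (real, 'm) vec \<Rightarrow> 'e" assume "\<gamma> \<in> Ckl_compact_supp k l U V"
  then have \<gamma>: "\<gamma> \<in> Ckl k l U V" and K: "compact (support_in (U \<times> V) \<gamma>)"
    by (auto simp: Ckl_compact_supp_def)
  have "weighted_seminorm U V f \<alpha> \<beta> q \<gamma> < \<infinity>"
    if f: "f \<in> W" and q: "q \<in> continuous_seminorms smul" and ab: "mi_order \<alpha> \<le> k" "mi_order \<beta> \<le> l" for f q \<alpha> \<beta>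
  proof -
    define K where "K = support_in (U \<times> V) \<gamma>"
    have KUV: "K \<subseteq> U \<times> V" by (auto simp: K_def support_in_def)
    obtain f1 f2 where f12: "f1 \<in> W1" "f2 \<in> W2" "\<And>p. p \<in> U \<times> V \<Longrightarrow> f p = f1 (fst p) * f2 (snd p)"
      using W_E[OF f] by blast
    have "continuous_on (U \<times> V) (\<lambda>p. f1 (fst p) * f2 (snd p) * q (partial_deriv2 \<alpha> \<beta> \<gamma> p))"
    proof (intro continuous_on_mult S.continuous_on_Q q_real[OF q])
      show "continuous_on (U \<times> V) (\<lambda>p. f1 (fst p))"
        by (rule continuous_on_compose2[OF continuous_on_weight1[OF f12(1)] continuous_on_fst[OF continuous_on_id]]) auto
      show "continuous_on (U \<times> V) (\<lambda>p. f2 (snd p))"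
        by (rule continuous_on_compose2[OF continuous_on_weight2[OF f12(2)] continuous_on_snd[OF continuous_on_id]]) auto
      show "continuous_on (U \<times> V) (partial_deriv2 \<alpha> \<beta> \<gamma>)"
        using \<gamma> ab by (simp add: Ckl_def)
    qed
    then have "continuous_on K (\<lambda>p. f1 (fst p) * f2 (snd p) * q (partial_deriv2 \<alpha> \<beta> \<gamma> p))"
      using KUV by (rule continuous_on_subset)
    then have "bounded ((\<lambda>p. f1 (fst p) * f2 (snd p) * q (partial_deriv2 \<alpha> \<beta> \<gamma> p)) ` K)"
      using K unfolding K_def[symmetric] by (intro compact_imp_bounded compact_continuous_image)
    then obtain B where B: "B > 0" "\<And>p. p \<in> K \<Longrightarrow> \<bar>f1 (fst p) * f2 (snd p) * q (partial_deriv2 \<alpha> \<beta> \<gamma> p)\<bar> \<le> B"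
      unfolding bounded_pos by auto
    have "f p * q (partial_deriv2 \<alpha> \<beta> \<gamma> p) \<le> B" if p: "p \<in> U \<times> V" for p
    proof (cases "p \<in> K")
      case True
      then show ?thesis using B(2)[OF True] f12(3)[OF p] by simp
    next
      case False
      define G where "G = (U \<times> V) - closure {x \<in> U \<times> V. \<gamma> x \<noteq> 0}"
      have G: "open G" "p \<in> G"
        using open_UV False p by (auto simp: G_def K_def support_in_def)
      have "\<gamma> y = 0" if "y \<in> G" for y
        using that closure_subset[of "{x \<in> U \<times> V. \<gamma> x \<noteq> 0}"] unfolding G_def by blast
      then have "partial_deriv2 \<alpha> \<beta> \<gamma> p = iter_deriv (mi_dirs2 \<alpha> \<beta>) (\<lambda>_. 0) p"
        by (intro iter_deriv_cong[OF G(1) _ G(2)])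
      then show ?thesis using B(1) S.Q_zero[OF q_real[OF q]] by (simp add: iter_deriv_zero)
    qed
    then show ?thesis unfolding weighted_seminorm_finite_iff by blast
  qed
  then show "\<gamma> \<in> weighted" using \<gamma> by (simp add: weighted_Ckl_def)
qed

lemma weighted_seminorm_triangle:
  assumes "\<gamma> \<in> Ckl k l U V" "\<gamma>1 \<in> Ckl k l U V" "\<eta> \<in> Ckl k l U V"
    and f: "f \<in> W" and q: "q \<in> continuous_seminorms smul" and ab: "mi_order \<alpha> \<le> k" "mi_order \<beta> \<le> l"
  shows "weighted_seminorm U V f \<alpha> \<beta> q (\<lambda>p. \<eta> p - \<gamma> p) \<le>
    weighted_seminorm U V f \<alpha> \<beta> q (\<lambda>p. \<eta> p - \<gamma>1 p) + weighted_seminorm U V f \<alpha> \<beta> q (\<lambda>p. \<gamma>1 p - \<gamma> p)"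
  unfolding weighted_seminorm_def
proof (rule SUP_least)
  fix p assume p: "p \<in> U \<times> V"
  define D where "D \<eta> = partial_deriv2 \<alpha> \<beta> \<eta> p" for \<eta> :: "(real, 'n) vec \<times> (real, 'm) vec \<Rightarrow> 'e"
  have "D (\<lambda>p. \<eta> p - \<gamma> p) = D (\<lambda>p. \<eta> p - \<gamma>1 p) + D (\<lambda>p. \<gamma>1 p - \<gamma> p)"
    unfolding D_def using assms(1-3) by (simp add: Ckl_diff[OF _ _ coord_dirs_le_mi_dirs2[OF ab] p])
  then have "q (D (\<lambda>p. \<eta> p - \<gamma> p)) \<le> q (D (\<lambda>p. \<eta> p - \<gamma>1 p)) + q (D (\<lambda>p. \<gamma>1 p - \<gamma> p))"
    using S.Q_add[OF q_real[OF q]] by simp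
  from mult_left_mono[OF this W_nonneg[OF f p]]
  have "ennreal (f p * q (D (\<lambda>p. \<eta> p - \<gamma> p))) \<le> ennreal (f p * q (D (\<lambda>p. \<eta> p - \<gamma>1 p)) + f p * q (D (\<lambda>p. \<gamma>1 p - \<gamma> p)))"
    by (intro ennreal_leI) (simp add: distrib_left)
  also have "\<dots> = ennreal (f p * q (D (\<lambda>p. \<eta> p - \<gamma>1 p))) + ennreal (f p * q (D (\<lambda>p. \<gamma>1 p - \<gamma> p)))"
    using W_nonneg[OF f p] S.Q_nonneg[OF q_real[OF q]] by (intro ennreal_plus) auto
  also have "\<dots> \<le> (SUP p\<in>U \<times> V. ennreal (f p * q (partial_deriv2 \<alpha> \<beta> (\<lambda>p. \<eta> p - \<gamma>1 p) p))) +
      (SUP p\<in>U \<times> V. ennreal (f p * q (partial_deriv2 \<alpha> \<beta> (\<lambda>p. \<gamma>1 p - \<gamma> p) p)))"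
    unfolding D_def using p by (intro add_mono SUP_upper)
  finally show "ennreal (f p * q (partial_deriv2 \<alpha> \<beta> (\<lambda>p. \<eta> p - \<gamma> p) p)) \<le> \<dots>"
    unfolding D_def .
qed

section \<open>Density\<close>

definition subbase :: "((real, 'n) vec \<times> (real, 'm) vec \<Rightarrow> 'e) set set" where
  "subbase = {{\<eta> \<in> weighted. weighted_seminorm U V f \<alpha> \<beta> q (\<lambda>p. \<eta> p - \<gamma> p) < ennreal \<epsilon>} | \<gamma> f \<alpha> \<beta> q \<epsilon>.
      \<gamma> \<in> weighted \<and> f \<in> W \<and> q \<in> continuous_seminorms smul \<and> mi_order \<alpha> \<le> k \<and> mi_order \<beta> \<le> l \<and> \<epsilon> > 0}"

lemma subbaseI:
  assumes "\<gamma> \<in> weighted" "f \<in> W" "q \<in> continuous_seminorms smul" "mi_order \<alpha> \<le> k" "mi_order \<beta> \<le> l" "\<epsilon> > 0"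
  shows "{\<eta> \<in> weighted. weighted_seminorm U V f \<alpha> \<beta> q (\<lambda>p. \<eta> p - \<gamma> p) < ennreal \<epsilon>} \<in> subbase"
  unfolding subbase_def using assms by blast

lemma weighted_topology_subbase: "weighted_topology smul k l U V W = topology_generated_by subbase"
  by (simp add: weighted_topology_def subbase_def)

definition seminorm_indices :: "(((real, 'n) vec \<times> (real, 'm) vec \<Rightarrow> real) \<times> ('n \<Rightarrow> nat) \<times> ('m \<Rightarrow> nat) \<times> ('e \<Rightarrow> real)) set" where
  "seminorm_indices = {(f, \<alpha>, \<beta>, q). f \<in> W \<and> mi_order \<alpha> \<le> k \<and> mi_order \<beta> \<le> l \<and> q \<in> continuous_seminorms smul}"

definition seminorm_ball where
  "seminorm_ball \<gamma> T \<epsilon> = {\<eta> \<in> weighted. \<forall>(f, \<alpha>, \<beta>, q)\<in>T. weighted_seminorm U V f \<alpha> \<beta> q (\<lambda>p. \<eta> p - \<gamma> p) \<le> ennreal \<epsilon>}"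

lemma seminorm_ball_mono:
  assumes "T1 \<subseteq> T2" "\<epsilon>2 \<le> \<epsilon>1"
  shows "seminorm_ball \<gamma> T2 \<epsilon>2 \<subseteq> seminorm_ball \<gamma> T1 \<epsilon>1"
proof
  fix \<eta> assume \<eta>: "\<eta> \<in> seminorm_ball \<gamma> T2 \<epsilon>2"
  have "weighted_seminorm U V f \<alpha> \<beta> q (\<lambda>p. \<eta> p - \<gamma> p) \<le> ennreal \<epsilon>1" if "(f, \<alpha>, \<beta>, q) \<in> T1" for f \<alpha> \<beta> q
  proof -
    have "(f, \<alpha>, \<beta>, q) \<in> T2" using assms(1) that by (rule subsetD)
    then have "weighted_seminorm U V f \<alpha> \<beta> q (\<lambda>p. \<eta> p - \<gamma> p) \<le> ennreal \<epsilon>2"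
      using \<eta> unfolding seminorm_ball_def by auto
    then show ?thesis by (rule order_trans) (rule ennreal_leI[OF assms(2)])
  qed
  then show "\<eta> \<in> seminorm_ball \<gamma> T1 \<epsilon>1" using \<eta> by (simp add: seminorm_ball_def split_paired_all)
qed

lemma neighbourhood_contains_ball:
  assumes "generate_topology_on subbase S" "\<gamma> \<in> S" "\<gamma> \<in> weighted"
  shows "\<exists>T \<epsilon>. finite T \<and> T \<subseteq> seminorm_indices \<and> \<epsilon> > 0 \<and> seminorm_ball \<gamma> T \<epsilon> \<subseteq> S"
  using assms(1,2)
proof (induction rule: generate_topology_on.induct)
  case Empty
  then show ?case by simp
next
  case (Int a b)
  then obtain T1 \<epsilon>1 T2 \<epsilon>2 where 1: "finite T1" "T1 \<subseteq> seminorm_indices" "\<epsilon>1 > 0" "seminorm_ball \<gamma> T1 \<epsilon>1 \<subseteq> a"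
    and 2: "finite T2" "T2 \<subseteq> seminorm_indices" "\<epsilon>2 > 0" "seminorm_ball \<gamma> T2 \<epsilon>2 \<subseteq> b"
    by blast
  have "seminorm_ball \<gamma> (T1 \<union> T2) (min \<epsilon>1 \<epsilon>2) \<subseteq> a \<inter> b"
    using seminorm_ball_mono[of T1 "T1 \<union> T2" "min \<epsilon>1 \<epsilon>2" \<epsilon>1 \<gamma>] seminorm_ball_mono[of T2 "T1 \<union> T2" "min \<epsilon>1 \<epsilon>2" \<epsilon>2 \<gamma>]
      1(4) 2(4) by auto
  then show ?case
    using 1(1-3) 2(1-3) by (intro exI[of _ "T1 \<union> T2"] exI[of _ "min \<epsilon>1 \<epsilon>2"]) auto
next
  case (UN K)
  then obtain s where "s \<in> K" "\<gamma> \<in> s" by blast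
  with UN.IH[OF this] show ?case by blast
next
  case (Basis s)
  then obtain \<gamma>0 f \<alpha> \<beta> q \<epsilon>0 where s: "s = {\<eta> \<in> weighted. weighted_seminorm U V f \<alpha> \<beta> q (\<lambda>p. \<eta> p - \<gamma>0 p) < ennreal \<epsilon>0}"
    and \<gamma>0: "\<gamma>0 \<in> weighted" and c: "f \<in> W" "q \<in> continuous_seminorms smul" "mi_order \<alpha> \<le> k" "mi_order \<beta> \<le> l" "\<epsilon>0 > 0"
    unfolding subbase_def by blast
  define d where "d = enn2real (weighted_seminorm U V f \<alpha> \<beta> q (\<lambda>p. \<gamma> p - \<gamma>0 p))"
  have less: "weighted_seminorm U V f \<alpha> \<beta> q (\<lambda>p. \<gamma> p - \<gamma>0 p) < ennreal \<epsilon>0"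
    using Basis.prems unfolding s by simp
  then have fin: "weighted_seminorm U V f \<alpha> \<beta> q (\<lambda>p. \<gamma> p - \<gamma>0 p) = ennreal d"
    unfolding d_def by (metis ennreal_enn2real ennreal_less_top order_less_trans)
  have d: "0 \<le> d" "d < \<epsilon>0"
    using less c(5) unfolding fin by (auto simp: d_def ennreal_less_iff)
  define \<epsilon> where "\<epsilon> = (\<epsilon>0 - d) / 2"
  have \<epsilon>: "\<epsilon> > 0" "\<epsilon> + d < \<epsilon>0" using d by (auto simp: \<epsilon>_def field_simps)
  have "\<eta> \<in> s" if "\<eta> \<in> seminorm_ball \<gamma> {(f, \<alpha>, \<beta>, q)} \<epsilon>" for \<eta>
  proof -
    have \<eta>: "\<eta> \<in> weighted" "weighted_seminorm U V f \<alpha> \<beta> q (\<lambda>p. \<eta> p - \<gamma> p) \<le> ennreal \<epsilon>"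
      using that by (simp_all add: seminorm_ball_def)
    have "weighted_seminorm U V f \<alpha> \<beta> q (\<lambda>p. \<eta> p - \<gamma>0 p) \<le>
      weighted_seminorm U V f \<alpha> \<beta> q (\<lambda>p. \<eta> p - \<gamma> p) + weighted_seminorm U V f \<alpha> \<beta> q (\<lambda>p. \<gamma> p - \<gamma>0 p)"
      using \<gamma>0 assms(3) \<eta>(1) c by (intro weighted_seminorm_triangle) (auto simp: weighted_Ckl_def)
    also have "\<dots> \<le> ennreal \<epsilon> + ennreal d" unfolding fin using \<eta>(2) by (rule add_right_mono)
    also have "\<dots> = ennreal (\<epsilon> + d)" using \<epsilon>(1) d(1) by (simp add: ennreal_plus)
    also have "\<dots> < ennreal \<epsilon>0" using \<epsilon>(2) c(5) by (intro ennreal_lessI)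
    finally show ?thesis unfolding s using \<eta>(1) by simp
  qed
  then show ?case
    using c \<epsilon>(1) by (intro exI[of _ "{(f, \<alpha>, \<beta>, q)}"] exI[of _ \<epsilon>]) (simp add: seminorm_indices_def subsetI)
qed

lemma topspace_weighted: "topspace (weighted_topology smul k l U V W) = weighted"
proof -
  have "\<exists>S\<in>subbase. \<gamma> \<in> S" if \<gamma>: "\<gamma> \<in> weighted" for \<gamma>
  proof -
    obtain f1 f2 where "f1 \<in> W1" "f2 \<in> W2"
      using W1_weights W2_weights by (auto simp: set_of_weights_def)
    then obtain f where f: "f \<in> W" using W_I by blast
    have q: "(\<lambda>_. 0) \<in> continuous_seminorms smul" by (simp add: continuous_seminorms_def)
    have "weighted_seminorm U V f (\<lambda>_. 0) (\<lambda>_. 0) (\<lambda>_. 0) (\<lambda>p. \<gamma> p - \<gamma> p) \<le> ennreal 0"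
      by (rule weighted_seminorm_le) simp
    then have "weighted_seminorm U V f (\<lambda>_. 0) (\<lambda>_. 0) (\<lambda>_. 0) (\<lambda>p. \<gamma> p - \<gamma> p) < ennreal 1"
      by (rule order_le_less_trans) (simp add: ennreal_less_iff)
    then have "\<gamma> \<in> {\<eta> \<in> weighted. weighted_seminorm U V f (\<lambda>_. 0) (\<lambda>_. 0) (\<lambda>_. 0) (\<lambda>p. \<eta> p - \<gamma> p) < ennreal 1}"
      using \<gamma> by simp
    moreover have "\<dots> \<in> subbase"
      by (rule subbaseI[OF \<gamma> f q]) (simp_all add: mi_order_0)
    ultimately show ?thesis by (rule bexI)
  qed
  moreover have "S \<subseteq> weighted" if "S \<in> subbase" for S
    using that unfolding subbase_def by blast
  ultimately show ?thesis
    unfolding weighted_topology_subbase topology_generated_by_topspace by blast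
qed

lemma closure_compact_supp: "weighted_topology smul k l U V W closure_of Ckl_compact_supp k l U V = weighted"
proof
  show "weighted_topology smul k l U V W closure_of Ckl_compact_supp k l U V \<subseteq> weighted"
    using closure_of_subset_topspace[of "weighted_topology smul k l U V W"] unfolding topspace_weighted .
  show "weighted \<subseteq> weighted_topology smul k l U V W closure_of Ckl_compact_supp k l U V"
  proof
    fix \<gamma> assume \<gamma>: "\<gamma> \<in> weighted"
    have "\<exists>\<eta>. \<eta> \<in> Ckl_compact_supp k l U V \<and> \<eta> \<in> S"
      if S: "\<gamma> \<in> S" "openin (weighted_topology smul k l U V W) S" for S
    proof -
      have "generate_topology_on subbase S"
        using S(2) unfolding weighted_topology_subbase openin_topology_generated_by_iff .
      from neighbourhood_contains_ball[OF this S(1) \<gamma>]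
      obtain T \<epsilon> where T: "finite T" "T \<subseteq> seminorm_indices" "\<epsilon> > 0" "seminorm_ball \<gamma> T \<epsilon> \<subseteq> S"
        by blast
      have "f \<in> W \<and> mi_order \<alpha> \<le> k \<and> mi_order \<beta> \<le> l \<and> q \<in> continuous_seminorms smul"
        if "(f, \<alpha>, \<beta>, q) \<in> T" for f \<alpha> \<beta> q
        using subsetD[OF T(2) that] by (simp add: seminorm_indices_def)
      from approx_compact_supp[OF \<gamma> T(1) this T(3)]
      obtain \<eta> where "\<eta> \<in> Ckl_compact_supp k l U V" "\<eta> \<in> seminorm_ball \<gamma> T \<epsilon>"
        unfolding seminorm_ball_def by blast
      then show ?thesis using T(4) by blast
    qed
    then show "\<gamma> \<in> weighted_topology smul k l U V W closure_of Ckl_compact_supp k l U V"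
      using \<gamma> unfolding in_closure_of topspace_weighted by blast
  qed
qed

end

theorem proposition3p26:
  fixes smul :: "'k::real_normed_field \<Rightarrow> 'e \<Rightarrow> 'e::{real_vector, topological_ab_group_add, t2_space}"
    and U :: "(real, 'n::{finite, linorder}) vec set"
    and V :: "(real, 'm::{finite, linorder}) vec set"
    and k l :: enat
    and W1 :: "((real, 'n) vec \<Rightarrow> real) set"
    and W2 :: "((real, 'm) vec \<Rightarrow> real) set"
  assumes "locally_convex_space smul"
    and "open U" and "open V"
    and "W1 \<subseteq> Ck_nonneg k U" and "set_of_weights U W1"
    and "o_condition U W1"
    and "\<And>f \<alpha>. f \<in> W1 \<Longrightarrow> mi_order \<alpha> \<le> k \<Longrightarrow> \<exists>g\<in>W1. \<forall>x\<in>U. \<bar>partial_deriv \<alpha> f x\<bar> \<le> g x"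
    and "W2 \<subseteq> Ck_nonneg l V" and "set_of_weights V W2"
    and "o_condition V W2"
    and "\<And>f \<beta>. f \<in> W2 \<Longrightarrow> mi_order \<beta> \<le> l \<Longrightarrow> \<exists>g\<in>W2. \<forall>y\<in>V. \<bar>partial_deriv \<beta> f y\<bar> \<le> g y"
  shows "Ckl_compact_supp k l U V \<subseteq> weighted_Ckl smul k l U V (tensor_weights U V W1 W2) \<and>
         weighted_topology smul k l U V (tensor_weights U V W1 W2) closure_of Ckl_compact_supp k l U V =
           weighted_Ckl smul k l U V (tensor_weights U V W1 W2)"
proof -
  interpret weighted_space smul U V k l W1 W2
    using assms by (intro weighted_space.intro weighted_space_axioms.intro)
  show ?thesis using compact_supp_weighted closure_compact_supp by blast
qed

end
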